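(* Let $\mathcal{E}: 0\to I\to E\xrightarrow{\pi}H\to 0$ be an extension of a Rota-Baxter group $(H,R_H)$ by an abelian Rota-Baxter group $(I,R_I)$ such that $[\mathcal{E}]\in\mathrm{Ext}_\mu(H,I)$. Then we have the following exact sequence of groups $$0\to \mathrm{Z}^1_{RBE}(H,I)\to \mathrm{Aut}_I(E,R_E)\xrightarrow{\rho(\mathcal{E})}\mathrm{C}_\mu\xrightarrow{\omega(\mathcal{E})}\mathrm{H}^2_{RBE}(H,I),$$ where $\omega(\mathcal{E})$ is, in general, only a derivation.
   Context: A Rota-Baxter operator (of weight 1) on a group $G$ is a map $R_G:G\to G$ with $R_G(x)R_G(y)=R_G(xR_G(x)yR_G(x)^{-1})$ for all $x,y$; $(G,R_G)$ is then a Rota-Baxter group. Morphisms are group homomorphisms commuting with the operators; $\mathrm{Aut}(G,R_G)$ is the group of Rota-Baxter automorphisms. Write $x\circ_{R_G}y=xR_G(x)yR_G(x)^{-1}$. A Rota-Baxter extension of $(H,R_H)$ by $(I,R_I)$ is a Rota-Baxter group $(E,R_E)$ with a short exact sequence of groups $0\to I\xrightarrow{i}E\xrightarrow{\pi}H\to 0$ in which $i,\pi$ are morphisms of Rota-Baxter groups; $I$ is identified with $i(I)$. Two extensions are equivalent if there is a Rota-Baxter isomorphism between the middle groups inducing the identity on $I$ and on $H$. An st-section is a map $s:H\to E$ with $\pi s=\mathrm{Id}_H$ sending the identity to the identity. $I$ is abelian (written additively in formulas inside $I$). The action of the extension is the anti-homomorphism $\mu:H\to\mathrm{Aut}(I)$,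 $\mu_h(y)=s(h)^{-1}ys(h)$ (independent of $s$). Throughout, $\mu$ is a fixed action for which $(I,R_I)$ is a right $(H,R_H)$-module, i.e. $\mu_{R_H(h)}(R_I(z))=R_I\big(\mu_{hR_H(h)}(z+R_I(z))-\mu_{R_H(h)}(R_I(z))\big)$ for all $h\in H$, $z\in I$. $\mathrm{Ext}_\mu(H,I)$ is the set of equivalence classes of extensions with action $\mu$. Cohomology: $C^n(H,I)$ is the group of functions $H^n\to I$ vanishing on degenerate tuples (some argument is the identity). For $\theta\in C^1(H,I)$: $(\delta^1\theta)(h_1,h_2)=\theta(h_2)-\theta(h_1h_2)+\mu_{h_2}(\theta(h_1))$, $\Phi^1(\theta)(h)=R_I(\mu_{R_H(h)}(\theta(h)))-\theta(R_H(h))$, $(\partial^1\theta)(h_1,h_2)=\theta(h_2)-\theta(h_1\circ_{R_H}h_2)+\mu_{R_H(h_2)}(\theta(h_1))$. For $f\in C^2(H,I)$: $$\Phi^2(f)(h_1,h_2)=f(R_H(h_1),R_H(h_2))-R_I\Big(\mu_{R_H(h_1\circ_{R_H}h_2)}\big(f(h_1R_H(h_1),h_2R_H(h_1)^{-1})+\mu_{h_2R_H(h_1)^{-1}}(f(h_1,R_H(h_1)))+f(h_2,R_H(h_1)^{-1})-f(R_H(h_1),R_H(h_1)^{-1})\big)\Big).$$ $\mathrm{Z}^1_{RBE}(H,I)$ is the group of $\lambda\in C^1(H,I)$ with $\lambda(h_1h_2)=\lambda(h_2)+\mu_{h_2}(\lambda(h_1))$ and $\lambda(R_H(h))=R_I(\mu_{R_H(h)}(\lambda(h)))$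 for all $h_1,h_2,h\in H$. $\mathrm{Z}^2_{RBE}(H,I)$ is the group of pairs $(\tau,g)\in C^2(H,I)\oplus C^1(H,I)$ with $\tau(h_1,h_2h_3)+\tau(h_2,h_3)-\tau(h_1h_2,h_3)-\mu_{h_3}(\tau(h_1,h_2))=0$ and $(\partial^1g)(h_1,h_2)-R_I\big(\mu_{R_H(h_2)}(\mu_{h_2}(g(h_1))-g(h_1))\big)-\Phi^2(\tau)(h_1,h_2)=0$ for all arguments. $\mathrm{B}^2_{RBE}(H,I)=\{(\delta^1\theta,-\Phi^1(\theta)):\theta\in C^1(H,I)\}$ and $\mathrm{H}^2_{RBE}(H,I)=\mathrm{Z}^2_{RBE}(H,I)/\mathrm{B}^2_{RBE}(H,I)$. For $(\tau,g)\in \mathrm{Z}^2_{RBE}(H,I)$, $\mathcal{E}(\tau,g)$ denotes the extension with middle group $H\times I$, product $(h_1,y_1)(h_2,y_2)=(h_1h_2,\mu_{h_2}(y_1)+y_2+\tau(h_1,h_2))$, operator $R(h,y)=(R_H(h),g(h)+R_I(\mu_{R_H(h)}(y)))$, and natural injection and projection. The set $\mathrm{Ext}_\mu(H,I)$ is identified with $\mathrm{H}^2_{RBE}(H,I)$ through $[(\tau,g)]\leftrightarrow[\mathcal{E}(\tau,g)]$, and $\mathrm{H}^2_{RBE}(H,I)$ acts faithfully and transitively on $\mathrm{Ext}_\mu(H,I)$ by translation, $[\mathcal{E}(\tau,g)]^{[(\tau_1,g_1)]}=[\mathcal{E}(\tau+\tau_1,g+g_1)]$. $\mathrm{C}_\mu=\{(\phi,\psi)\in\mathrm{Aut}(H,R_H)\times\mathrm{Aut}(I,R_I):\mu_h=\psi^{-1}\mu_{\phi(h)}\psi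 \text{ for all } h\in H\}$. It acts on $\mathrm{Ext}_\mu(H,I)$: $[\mathcal{E}]^{(\phi,\psi)}$ is the class of $0\to I\xrightarrow{i\psi}E\xrightarrow{\phi^{-1}\pi}H\to 0$. It acts on $\mathrm{H}^2_{RBE}(H,I)$ by $[(\tau,g)]^{(\phi,\psi)}=[(\tau^{(\phi,\psi)},g^{(\phi,\psi)})]$, where $f^{(\phi,\psi)}(h_1,\dots,h_n)=\psi^{-1}(f(\phi(h_1),\dots,\phi(h_n)))$. The map $\omega(\mathcal{E}):\mathrm{C}_\mu\to\mathrm{H}^2_{RBE}(H,I)$ sends $c$ to the unique $h_c$ with $[\mathcal{E}]^c=[\mathcal{E}]^{h_c}$. Derivation means $\omega(\mathcal{E})(c_1c_2)=\omega(\mathcal{E})(c_1)^{c_2}+\omega(\mathcal{E})(c_2)$; exactness at $\mathrm{C}_\mu$ refers to the set-theoretic kernel $\{c\in\mathrm{C}_\mu:[\mathcal{E}]^c=[\mathcal{E}]\}$ of $\omega(\mathcal{E})$. $\mathrm{Aut}_I(E,R_E)=\{\gamma\in\mathrm{Aut}(E,R_E):\gamma(y)\in I\text{ for all }y\in I\}$ (the automorphisms which normalize $I$). For such $\gamma$, $\gamma_I=\gamma|_I$ and $\gamma_H(h)=\pi(\gamma(s(h)))$ (independent of the st-section $s$) is the induced automorphism of $H$; $\rho(\mathcal{E})(\gamma)=(\gamma_H,\gamma_I)$. The map $\mathrm{Z}^1_{RBE}(H,I)\to\mathrm{Aut}_I(E,R_E)$ sends $\lambda$ to the automorphism $s(h)y\mapsto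 s(h)\lambda(h)y$ ($h\in H$, $y\in I$), which is independent of $s$.
   Formalization: The class [(τ,g)] is identified with [E(τ,−g)], not [E(τ,g)] (which need not be a Rota-Baxter group for (τ,g) in Z²), so translation is [E(τ,−g)]^[(τ1,g1)]=[E(τ+τ1,−(g+g1))]; and Aut_I consists of γ with γ(I)=I, not only γ(I)⊆I. *)

theory Defs
  imports "HOL-Algebra.Algebra"
begin

section \<open>Rota-Baxter groups\<close>

record 'a rb_monoid = "'a monoid" +
  rb :: "'a \<Rightarrow> 'a"

definition rb_circ :: "('a, 'm) rb_monoid_scheme \<Rightarrow> 'a \<Rightarrow> 'a \<Rightarrow> 'a" where
  "rb_circ G x y = x \<otimes>\<^bsub>G\<^esub> rb G x \<otimes>\<^bsub>G\<^esub> y \<otimes>\<^bsub>G\<^esub> inv\<^bsub>G\<^esub> (rb G x)"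

locale rota_baxter_group = group G for G :: "('a, 'm) rb_monoid_scheme" (structure) +
  assumes rb_closed: "x \<in> carrier G \<Longrightarrow> rb G x \<in> carrier G"
    and rb_mult: "\<lbrakk>x \<in> carrier G; y \<in> carrier G\<rbrakk> \<Longrightarrow> rb G x \<otimes> rb G y = rb G (rb_circ G x y)"

definition rb_hom :: "('a, 'm) rb_monoid_scheme \<Rightarrow> ('b, 'n) rb_monoid_scheme \<Rightarrow> ('a \<Rightarrow> 'b) set" where
  "rb_hom G K = {f \<in> hom G K. \<forall>x\<in>carrier G. f (rb G x) = rb K (f x)}"

text \<open>As for \<^const>\<open>AutoGroup\<close>, the elements are extensional and the product is composition:
  \<open>g \<otimes> f = g \<circ> f\<close> on the carrier.\<close>

definition rb_Aut :: "('a, 'm) rb_monoid_scheme \<Rightarrow> ('a \<Rightarrow> 'a) monoid" where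
  "rb_Aut G = (AutoGroup G)\<lparr>carrier := auto G \<inter> rb_hom G G\<rparr>"


section \<open>Modules\<close>

text \<open>The abelian group \<open>I\<close> is written multiplicatively, following HOL-Algebra.\<close>

definition anti_action ::
    "('h, 'm) rb_monoid_scheme \<Rightarrow> ('i, 'n) rb_monoid_scheme \<Rightarrow> ('h \<Rightarrow> 'i \<Rightarrow> 'i) \<Rightarrow> bool" where
  "anti_action H I \<mu> \<longleftrightarrow>
     (\<forall>h\<in>carrier H. \<mu> h \<in> carrier (AutoGroup I)) \<and>
     (\<forall>h\<in>carrier H. \<forall>k\<in>carrier H. \<mu> (h \<otimes>\<^bsub>H\<^esub> k) = \<mu> k \<otimes>\<^bsub>AutoGroup I\<^esub> \<mu> h)"

definition rb_module ::
    "('h, 'm) rb_monoid_scheme \<Rightarrow> ('i, 'n) rb_monoid_scheme \<Rightarrow> ('h \<Rightarrow> 'i \<Rightarrow> 'i) \<Rightarrow> bool" where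
  "rb_module H I \<mu> \<longleftrightarrow> anti_action H I \<mu> \<and>
     (\<forall>h\<in>carrier H. \<forall>z\<in>carrier I.
        \<mu> (rb H h) (rb I z) =
        rb I (\<mu> (h \<otimes>\<^bsub>H\<^esub> rb H h) (z \<otimes>\<^bsub>I\<^esub> rb I z) \<otimes>\<^bsub>I\<^esub> inv\<^bsub>I\<^esub> (\<mu> (rb H h) (rb I z))))"


section \<open>Extensions\<close>

record ('i, 'e, 'h) rb_ext =
  mid :: "'e rb_monoid"
  incl :: "'i \<Rightarrow> 'e"
  prj :: "'e \<Rightarrow> 'h"

definition is_rb_extension ::
    "('h, 'm) rb_monoid_scheme \<Rightarrow> ('i, 'n) rb_monoid_scheme \<Rightarrow> ('i, 'e, 'h) rb_ext \<Rightarrow> bool" where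
  "is_rb_extension H I \<E> \<longleftrightarrow>
     rota_baxter_group (mid \<E>) \<and>
     incl \<E> \<in> rb_hom I (mid \<E>) \<and> inj_on (incl \<E>) (carrier I) \<and>
     prj \<E> \<in> rb_hom (mid \<E>) H \<and> prj \<E> ` carrier (mid \<E>) = carrier H \<and>
     incl \<E> ` carrier I = kernel (mid \<E>) H (prj \<E>)"

definition st_section ::
    "('h, 'm) rb_monoid_scheme \<Rightarrow> ('i, 'e, 'h) rb_ext \<Rightarrow> ('h \<Rightarrow> 'e) \<Rightarrow> bool" where
  "st_section H \<E> s \<longleftrightarrow>
     s \<in> carrier H \<rightarrow> carrier (mid \<E>) \<and> (\<forall>h\<in>carrier H. prj \<E> (s h) = h) \<and> s \<one>\<^bsub>H\<^esub> = \<one>\<^bsub>mid \<E>\<^esub>"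

definition has_action ::
    "('h, 'm) rb_monoid_scheme \<Rightarrow> ('i, 'n) rb_monoid_scheme \<Rightarrow> ('h \<Rightarrow> 'i \<Rightarrow> 'i) \<Rightarrow>
     ('i, 'e, 'h) rb_ext \<Rightarrow> bool" where
  "has_action H I \<mu> \<E> \<longleftrightarrow>
     (\<forall>s. st_section H \<E> s \<longrightarrow>
        (\<forall>h\<in>carrier H. \<forall>y\<in>carrier I.
           incl \<E> (\<mu> h y) = inv\<^bsub>mid \<E>\<^esub> (s h) \<otimes>\<^bsub>mid \<E>\<^esub> incl \<E> y \<otimes>\<^bsub>mid \<E>\<^esub> s h))"

definition rb_ext_equiv ::
    "('i, 'n) rb_monoid_scheme \<Rightarrow> ('i, 'e, 'h) rb_ext \<Rightarrow> ('i, 'f, 'h) rb_ext \<Rightarrow> bool" where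
  "rb_ext_equiv I \<E> Y \<longleftrightarrow>
     (\<exists>\<gamma> \<in> iso (mid \<E>) (mid Y) \<inter> rb_hom (mid \<E>) (mid Y).
        (\<forall>y\<in>carrier I. \<gamma> (incl \<E> y) = incl Y y) \<and>
        (\<forall>x\<in>carrier (mid \<E>). prj Y (\<gamma> x) = prj \<E> x))"

text \<open>Every extension with action \<open>\<mu>\<close>, whatever the type \<open>'e\<close> of its middle group, is equivalent
  to one whose middle group lives on the type \<open>'h \<times> 'i\<close>.  The class of an extension is therefore
  represented by its members over that type, so that the classes form one HOL set.\<close>

definition ext_class ::
    "('h, 'm) rb_monoid_scheme \<Rightarrow> ('i, 'n) rb_monoid_scheme \<Rightarrow> ('h \<Rightarrow> 'i \<Rightarrow> 'i) \<Rightarrow>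
     ('i, 'e, 'h) rb_ext \<Rightarrow> ('i, 'h \<times> 'i, 'h) rb_ext set" where
  "ext_class H I \<mu> \<E> =
     {Y. is_rb_extension H I Y \<and> has_action H I \<mu> Y \<and> rb_ext_equiv I \<E> Y}"

definition Ext ::
    "('h, 'm) rb_monoid_scheme \<Rightarrow> ('i, 'n) rb_monoid_scheme \<Rightarrow> ('h \<Rightarrow> 'i \<Rightarrow> 'i) \<Rightarrow>
     ('i, 'h \<times> 'i, 'h) rb_ext set set" where
  "Ext H I \<mu> =
     ext_class H I \<mu> ` {\<E> :: ('i, 'h \<times> 'i, 'h) rb_ext. is_rb_extension H I \<E> \<and> has_action H I \<mu> \<E>}"


section \<open>Cohomology\<close>

definition C1 :: "('h, 'm) rb_monoid_scheme \<Rightarrow> ('i, 'n) rb_monoid_scheme \<Rightarrow> ('h \<Rightarrow> 'i) monoid" where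
  "C1 H I = (product_group (carrier H) (\<lambda>_. I))
     \<lparr>carrier := {f \<in> carrier H \<rightarrow>\<^sub>E carrier I. f \<one>\<^bsub>H\<^esub> = \<one>\<^bsub>I\<^esub>}\<rparr>"

definition C2 :: "('h, 'm) rb_monoid_scheme \<Rightarrow> ('i, 'n) rb_monoid_scheme \<Rightarrow> ('h \<times> 'h \<Rightarrow> 'i) monoid" where
  "C2 H I = (product_group (carrier H \<times> carrier H) (\<lambda>_. I))
     \<lparr>carrier := {f \<in> carrier H \<times> carrier H \<rightarrow>\<^sub>E carrier I.
        \<forall>h\<in>carrier H. f (h, \<one>\<^bsub>H\<^esub>) = \<one>\<^bsub>I\<^esub> \<and> f (\<one>\<^bsub>H\<^esub>, h) = \<one>\<^bsub>I\<^esub>}\<rparr>"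

definition delta1 ::
    "('h, 'm) rb_monoid_scheme \<Rightarrow> ('i, 'n) rb_monoid_scheme \<Rightarrow> ('h \<Rightarrow> 'i \<Rightarrow> 'i) \<Rightarrow>
     ('h \<Rightarrow> 'i) \<Rightarrow> 'h \<times> 'h \<Rightarrow> 'i" where
  "delta1 H I \<mu> \<theta> = (\<lambda>(h1, h2) \<in> carrier H \<times> carrier H.
     \<theta> h2 \<otimes>\<^bsub>I\<^esub> inv\<^bsub>I\<^esub> (\<theta> (h1 \<otimes>\<^bsub>H\<^esub> h2)) \<otimes>\<^bsub>I\<^esub> \<mu> h2 (\<theta> h1))"

definition Phi1 ::
    "('h, 'm) rb_monoid_scheme \<Rightarrow> ('i, 'n) rb_monoid_scheme \<Rightarrow> ('h \<Rightarrow> 'i \<Rightarrow> 'i) \<Rightarrow>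
     ('h \<Rightarrow> 'i) \<Rightarrow> 'h \<Rightarrow> 'i" where
  "Phi1 H I \<mu> \<theta> = (\<lambda>h \<in> carrier H.
     rb I (\<mu> (rb H h) (\<theta> h)) \<otimes>\<^bsub>I\<^esub> inv\<^bsub>I\<^esub> (\<theta> (rb H h)))"

definition partial1 ::
    "('h, 'm) rb_monoid_scheme \<Rightarrow> ('i, 'n) rb_monoid_scheme \<Rightarrow> ('h \<Rightarrow> 'i \<Rightarrow> 'i) \<Rightarrow>
     ('h \<Rightarrow> 'i) \<Rightarrow> 'h \<times> 'h \<Rightarrow> 'i" where
  "partial1 H I \<mu> \<theta> = (\<lambda>(h1, h2) \<in> carrier H \<times> carrier H.
     \<theta> h2 \<otimes>\<^bsub>I\<^esub> inv\<^bsub>I\<^esub> (\<theta> (rb_circ H h1 h2)) \<otimes>\<^bsub>I\<^esub> \<mu> (rb H h2) (\<theta> h1))"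

definition Phi2 ::
    "('h, 'm) rb_monoid_scheme \<Rightarrow> ('i, 'n) rb_monoid_scheme \<Rightarrow> ('h \<Rightarrow> 'i \<Rightarrow> 'i) \<Rightarrow>
     ('h \<times> 'h \<Rightarrow> 'i) \<Rightarrow> 'h \<times> 'h \<Rightarrow> 'i" where
  "Phi2 H I \<mu> f = (\<lambda>(h1, h2) \<in> carrier H \<times> carrier H.
     let r = rb H h1; r' = inv\<^bsub>H\<^esub> r in
     f (r, rb H h2) \<otimes>\<^bsub>I\<^esub> inv\<^bsub>I\<^esub> (rb I (\<mu> (rb H (rb_circ H h1 h2))
       (f (h1 \<otimes>\<^bsub>H\<^esub> r, h2 \<otimes>\<^bsub>H\<^esub> r') \<otimes>\<^bsub>I\<^esub> \<mu> (h2 \<otimes>\<^bsub>H\<^esub> r') (f (h1, r))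
        \<otimes>\<^bsub>I\<^esub> f (h2, r') \<otimes>\<^bsub>I\<^esub> inv\<^bsub>I\<^esub> (f (r, r'))))))"

definition Z1_RBE ::
    "('h, 'm) rb_monoid_scheme \<Rightarrow> ('i, 'n) rb_monoid_scheme \<Rightarrow> ('h \<Rightarrow> 'i \<Rightarrow> 'i) \<Rightarrow> ('h \<Rightarrow> 'i) monoid" where
  "Z1_RBE H I \<mu> = (C1 H I)\<lparr>carrier := {l \<in> carrier (C1 H I).
     (\<forall>h1\<in>carrier H. \<forall>h2\<in>carrier H. l (h1 \<otimes>\<^bsub>H\<^esub> h2) = l h2 \<otimes>\<^bsub>I\<^esub> \<mu> h2 (l h1)) \<and>
     (\<forall>h\<in>carrier H. l (rb H h) = rb I (\<mu> (rb H h) (l h)))}\<rparr>"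

definition Z2_RBE ::
    "('h, 'm) rb_monoid_scheme \<Rightarrow> ('i, 'n) rb_monoid_scheme \<Rightarrow> ('h \<Rightarrow> 'i \<Rightarrow> 'i) \<Rightarrow>
     (('h \<times> 'h \<Rightarrow> 'i) \<times> ('h \<Rightarrow> 'i)) monoid" where
  "Z2_RBE H I \<mu> = (C2 H I \<times>\<times> C1 H I)\<lparr>carrier := {(\<tau>, g) \<in> carrier (C2 H I \<times>\<times> C1 H I).
     (\<forall>h1\<in>carrier H. \<forall>h2\<in>carrier H. \<forall>h3\<in>carrier H.
        \<tau> (h1, h2 \<otimes>\<^bsub>H\<^esub> h3) \<otimes>\<^bsub>I\<^esub> \<tau> (h2, h3) \<otimes>\<^bsub>I\<^esub> inv\<^bsub>I\<^esub> (\<tau> (h1 \<otimes>\<^bsub>H\<^esub> h2, h3))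
          \<otimes>\<^bsub>I\<^esub> inv\<^bsub>I\<^esub> (\<mu> h3 (\<tau> (h1, h2))) = \<one>\<^bsub>I\<^esub>) \<and>
     (\<forall>h1\<in>carrier H. \<forall>h2\<in>carrier H.
        partial1 H I \<mu> g (h1, h2)
          \<otimes>\<^bsub>I\<^esub> inv\<^bsub>I\<^esub> (rb I (\<mu> (rb H h2) (\<mu> h2 (g h1) \<otimes>\<^bsub>I\<^esub> inv\<^bsub>I\<^esub> (g h1))))
          \<otimes>\<^bsub>I\<^esub> inv\<^bsub>I\<^esub> (Phi2 H I \<mu> \<tau> (h1, h2)) = \<one>\<^bsub>I\<^esub>)}\<rparr>"

definition cochain_neg ::
    "('h, 'm) rb_monoid_scheme \<Rightarrow> ('i, 'n) rb_monoid_scheme \<Rightarrow> ('h \<Rightarrow> 'i) \<Rightarrow> 'h \<Rightarrow> 'i" where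
  "cochain_neg H I g = (\<lambda>h \<in> carrier H. inv\<^bsub>I\<^esub> (g h))"

definition B2_RBE ::
    "('h, 'm) rb_monoid_scheme \<Rightarrow> ('i, 'n) rb_monoid_scheme \<Rightarrow> ('h \<Rightarrow> 'i \<Rightarrow> 'i) \<Rightarrow>
     (('h \<times> 'h \<Rightarrow> 'i) \<times> ('h \<Rightarrow> 'i)) set" where
  "B2_RBE H I \<mu> =
     (\<lambda>\<theta>. (delta1 H I \<mu> \<theta>, cochain_neg H I (Phi1 H I \<mu> \<theta>))) ` carrier (C1 H I)"

definition H2_RBE ::
    "('h, 'm) rb_monoid_scheme \<Rightarrow> ('i, 'n) rb_monoid_scheme \<Rightarrow> ('h \<Rightarrow> 'i \<Rightarrow> 'i) \<Rightarrow>
     (('h \<times> 'h \<Rightarrow> 'i) \<times> ('h \<Rightarrow> 'i)) set monoid" where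
  "H2_RBE H I \<mu> = Z2_RBE H I \<mu> Mod B2_RBE H I \<mu>"


section \<open>Cohomology classes acting on extension classes\<close>

definition std_ext ::
    "('h, 'm) rb_monoid_scheme \<Rightarrow> ('i, 'n) rb_monoid_scheme \<Rightarrow> ('h \<Rightarrow> 'i \<Rightarrow> 'i) \<Rightarrow>
     ('h \<times> 'h \<Rightarrow> 'i) \<Rightarrow> ('h \<Rightarrow> 'i) \<Rightarrow> ('i, 'h \<times> 'i, 'h) rb_ext" where
  "std_ext H I \<mu> \<tau> g =
     \<lparr>mid = \<lparr>carrier = carrier H \<times> carrier I,
             monoid.mult = (\<lambda>(h1, y1) (h2, y2). (h1 \<otimes>\<^bsub>H\<^esub> h2, \<mu> h2 y1 \<otimes>\<^bsub>I\<^esub> y2 \<otimes>\<^bsub>I\<^esub> \<tau> (h1, h2))),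
             one = (\<one>\<^bsub>H\<^esub>, \<one>\<^bsub>I\<^esub>),
             rb = (\<lambda>(h, y). (rb H h, g h \<otimes>\<^bsub>I\<^esub> rb I (\<mu> (rb H h) y)))\<rparr>,
      incl = (\<lambda>y. (\<one>\<^bsub>H\<^esub>, y)),
      prj = fst\<rparr>"

text \<open>Sign pitfall.  With \<open>R(h, 0) = (R\<^sub>H h, g h)\<close>, the Rota-Baxter identity of \<^const>\<open>std_ext\<close> reads
  \<open>(\<partial>\<^sup>1 g)(h\<^sub>1, h\<^sub>2) - R\<^sub>I(\<mu>(R\<^sub>H h\<^sub>2)(\<mu>(h\<^sub>2)(g h\<^sub>1) - g h\<^sub>1)) + \<Phi>\<^sup>2(\<tau>)(h\<^sub>1, h\<^sub>2) = 0\<close>, and the change of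
  section \<open>s \<mapsto> s \<theta>\<close> replaces \<open>(\<tau>, g)\<close> by \<open>(\<tau> + \<delta>\<^sup>1 \<theta>, g + \<Phi>\<^sup>1 \<theta>)\<close>.  In \<^const>\<open>Z2_RBE\<close> and
  \<^const>\<open>B2_RBE\<close> the signs of \<open>\<Phi>\<^sup>2\<close> and \<open>\<Phi>\<^sup>1\<close> are the opposite ones, so it is \<open>(\<tau>, -g)\<close> that defines
  an extension when \<open>(\<tau>, g)\<close> is a cocycle.\<close>

definition cocycle_ext ::
    "('h, 'm) rb_monoid_scheme \<Rightarrow> ('i, 'n) rb_monoid_scheme \<Rightarrow> ('h \<Rightarrow> 'i \<Rightarrow> 'i) \<Rightarrow>
     ('h \<times> 'h \<Rightarrow> 'i) \<times> ('h \<Rightarrow> 'i) \<Rightarrow> ('i, 'h \<times> 'i, 'h) rb_ext" where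
  "cocycle_ext H I \<mu> z = std_ext H I \<mu> (fst z) (cochain_neg H I (snd z))"

definition ext_translate ::
    "('h, 'm) rb_monoid_scheme \<Rightarrow> ('i, 'n) rb_monoid_scheme \<Rightarrow> ('h \<Rightarrow> 'i \<Rightarrow> 'i) \<Rightarrow>
     ('i, 'h \<times> 'i, 'h) rb_ext set \<Rightarrow> (('h \<times> 'h \<Rightarrow> 'i) \<times> ('h \<Rightarrow> 'i)) set \<Rightarrow>
     ('i, 'h \<times> 'i, 'h) rb_ext set" where
  "ext_translate H I \<mu> K k =
     (\<Union>z \<in> {z \<in> carrier (Z2_RBE H I \<mu>). cocycle_ext H I \<mu> z \<in> K}. \<Union>w \<in> k.
        ext_class H I \<mu> (cocycle_ext H I \<mu> (z \<otimes>\<^bsub>Z2_RBE H I \<mu>\<^esub> w)))"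


section \<open>Compatible pairs\<close>

definition C_mu ::
    "('h, 'm) rb_monoid_scheme \<Rightarrow> ('i, 'n) rb_monoid_scheme \<Rightarrow> ('h \<Rightarrow> 'i \<Rightarrow> 'i) \<Rightarrow>
     (('h \<Rightarrow> 'h) \<times> ('i \<Rightarrow> 'i)) monoid" where
  "C_mu H I \<mu> = (rb_Aut H \<times>\<times> rb_Aut I)
     \<lparr>carrier := {(\<phi>, \<psi>) \<in> carrier (rb_Aut H \<times>\<times> rb_Aut I).
        \<forall>h\<in>carrier H. \<forall>y\<in>carrier I. \<mu> h y = inv_into (carrier I) \<psi> (\<mu> (\<phi> h) (\<psi> y))}\<rparr>"

definition ext_twist ::
    "('h, 'm) rb_monoid_scheme \<Rightarrow> ('i, 'e, 'h) rb_ext \<Rightarrow> ('h \<Rightarrow> 'h) \<times> ('i \<Rightarrow> 'i) \<Rightarrow>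
     ('i, 'e, 'h) rb_ext" where
  "ext_twist H \<E> c =
     \<lparr>mid = mid \<E>, incl = incl \<E> \<circ> snd c, prj = inv_into (carrier H) (fst c) \<circ> prj \<E>\<rparr>"

definition ext_act ::
    "('h, 'm) rb_monoid_scheme \<Rightarrow> ('i, 'n) rb_monoid_scheme \<Rightarrow> ('h \<Rightarrow> 'i \<Rightarrow> 'i) \<Rightarrow>
     ('i, 'h \<times> 'i, 'h) rb_ext set \<Rightarrow> ('h \<Rightarrow> 'h) \<times> ('i \<Rightarrow> 'i) \<Rightarrow> ('i, 'h \<times> 'i, 'h) rb_ext set" where
  "ext_act H I \<mu> K c = (\<Union>\<E> \<in> K. ext_class H I \<mu> (ext_twist H \<E> c))"

definition cochain_act ::
    "('h, 'm) rb_monoid_scheme \<Rightarrow> ('i, 'n) rb_monoid_scheme \<Rightarrow>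
     ('h \<times> 'h \<Rightarrow> 'i) \<times> ('h \<Rightarrow> 'i) \<Rightarrow> ('h \<Rightarrow> 'h) \<times> ('i \<Rightarrow> 'i) \<Rightarrow> ('h \<times> 'h \<Rightarrow> 'i) \<times> ('h \<Rightarrow> 'i)" where
  "cochain_act H I = (\<lambda>(\<tau>, g) (\<phi>, \<psi>).
     ((\<lambda>(h1, h2) \<in> carrier H \<times> carrier H. inv_into (carrier I) \<psi> (\<tau> (\<phi> h1, \<phi> h2))),
      (\<lambda>h \<in> carrier H. inv_into (carrier I) \<psi> (g (\<phi> h)))))"

definition H2_act ::
    "('h, 'm) rb_monoid_scheme \<Rightarrow> ('i, 'n) rb_monoid_scheme \<Rightarrow> ('h \<Rightarrow> 'i \<Rightarrow> 'i) \<Rightarrow>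
     (('h \<times> 'h \<Rightarrow> 'i) \<times> ('h \<Rightarrow> 'i)) set \<Rightarrow> ('h \<Rightarrow> 'h) \<times> ('i \<Rightarrow> 'i) \<Rightarrow>
     (('h \<times> 'h \<Rightarrow> 'i) \<times> ('h \<Rightarrow> 'i)) set" where
  "H2_act H I \<mu> k c = (\<Union>z \<in> k. B2_RBE H I \<mu> #>\<^bsub>Z2_RBE H I \<mu>\<^esub> cochain_act H I z c)"


section \<open>The maps of the sequence\<close>

definition Aut_I ::
    "('i, 'n) rb_monoid_scheme \<Rightarrow> ('i, 'e, 'h) rb_ext \<Rightarrow> ('e \<Rightarrow> 'e) monoid" where
  "Aut_I I \<E> = (rb_Aut (mid \<E>))\<lparr>carrier :=
     {\<gamma> \<in> carrier (rb_Aut (mid \<E>)). \<gamma> ` incl \<E> ` carrier I = incl \<E> ` carrier I}\<rparr>"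

text \<open>For \<open>x = s(h) y\<close> one has \<open>h = \<pi>(x)\<close> and \<open>y = s(h)\<^sup>-\<^sup>1 x\<close>.\<close>

definition shear ::
    "('i, 'e, 'h) rb_ext \<Rightarrow> ('h \<Rightarrow> 'e) \<Rightarrow> ('h \<Rightarrow> 'i) \<Rightarrow> 'e \<Rightarrow> 'e" where
  "shear \<E> s l = (\<lambda>x \<in> carrier (mid \<E>).
     s (prj \<E> x) \<otimes>\<^bsub>mid \<E>\<^esub> incl \<E> (l (prj \<E> x))
       \<otimes>\<^bsub>mid \<E>\<^esub> (inv\<^bsub>mid \<E>\<^esub> (s (prj \<E> x)) \<otimes>\<^bsub>mid \<E>\<^esub> x))"

definition rho ::
    "('h, 'm) rb_monoid_scheme \<Rightarrow> ('i, 'n) rb_monoid_scheme \<Rightarrow> ('i, 'e, 'h) rb_ext \<Rightarrow> ('h \<Rightarrow> 'e) \<Rightarrow>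
     ('e \<Rightarrow> 'e) \<Rightarrow> ('h \<Rightarrow> 'h) \<times> ('i \<Rightarrow> 'i)" where
  "rho H I \<E> s \<gamma> =
     ((\<lambda>h \<in> carrier H. prj \<E> (\<gamma> (s h))),
      (\<lambda>y \<in> carrier I. inv_into (carrier I) (incl \<E>) (\<gamma> (incl \<E> y))))"

definition omega ::
    "('h, 'm) rb_monoid_scheme \<Rightarrow> ('i, 'n) rb_monoid_scheme \<Rightarrow> ('h \<Rightarrow> 'i \<Rightarrow> 'i) \<Rightarrow>
     ('i, 'e, 'h) rb_ext \<Rightarrow> ('h \<Rightarrow> 'h) \<times> ('i \<Rightarrow> 'i) \<Rightarrow> (('h \<times> 'h \<Rightarrow> 'i) \<times> ('h \<Rightarrow> 'i)) set" where
  "omega H I \<mu> \<E> c = (THE k. k \<in> carrier (H2_RBE H I \<mu>) \<and>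
     ext_act H I \<mu> (ext_class H I \<mu> \<E>) c = ext_translate H I \<mu> (ext_class H I \<mu> \<E>) k)"

end

theory Submission
  imports Defs
begin

text \<open>A section \<open>s\<close> of an extension with action \<open>\<mu>\<close> yields functions \<open>(\<tau>, g)\<close> with
  \<open>s(h) s(k) = s(h k) \<tau>(h, k)\<close> and \<open>R(s h) = s(R h) g(h)\<close>, which determine the extension up to
  equivalence; replacing \<open>s\<close> by \<open>s \<theta>\<close> changes them by the coboundary of \<open>\<theta>\<close>.  So classes of extensions
  are a torsor under \<open>H\<^sup>2\<close>, and \<open>\<omega>(c)\<close> is the difference of the class of the extension twisted by \<open>c\<close>
  and the class of the extension itself; the derivation rule is the cocycle rule for this difference.
  An equivalence between the extension and its twist by \<open>(\<phi>, \<psi>)\<close> is the same as an automorphism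
  normalising \<open>I\<close> that induces \<open>(\<phi>, \<psi>)\<close>, which gives exactness at the compatible pairs.  An automorphism
  inducing the identity on both ends has the form \<open>x \<mapsto> x l(\<pi> x)\<close>, and it respects the product and the
  operator exactly when \<open>l\<close> is a 1-cocycle.\<close>

section \<open>Rota-Baxter automorphisms and modules\<close>

text \<open>Wherever possible an extension carries the identity instead of a formula. That
  coboundaries are cocycles, and that a compatible pair sends cocycles to cocycles, is seen by
  exhibiting a section of a suitable extension whose factor set is the cochain in question; that the
  pair respects cohomology classes comes from equivalences of twisted extensions. The central
  computation is \<open>rb_Std_iff\<close>: on pairs (h, y) with the twisted product, the
  Rota-Baxter identity at (h1, y1), (h2, y2) holds or fails independently of y1 and y2, the module
  condition being what removes y1. So one equation for each pair h1, h2 decides whether (\<tau>, g)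
  defines an extension. A second obstacle is one of types. The given middle group has an arbitrary
  type, so classes consist of representatives over one fixed type, and translation and the action of
  pairs are unions over representatives; each use must show that such a union is nonempty and
  constant.\<close>

lemma (in rota_baxter_group) circ_closed [simp]:
  "\<lbrakk>x \<in> carrier G; y \<in> carrier G\<rbrakk> \<Longrightarrow> rb_circ G x y \<in> carrier G"
  by (simp add: rb_circ_def rb_closed)

lemma (in rota_baxter_group) rb_one: "rb G \<one> = \<one>"
proof -
  have "rb G \<one> \<otimes> rb G \<one> = rb G \<one>"
    using rb_mult[of \<one> \<one>] by (simp add: rb_circ_def rb_closed)
  then show ?thesis
    using rb_closed[OF one_closed] l_cancel_one by blast
qed

lemma rb_homD:
  assumes "f \<in> rb_hom G K"
  shows "x \<in> carrier G \<Longrightarrow> f x \<in> carrier K"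
    and "\<lbrakk>x \<in> carrier G; y \<in> carrier G\<rbrakk> \<Longrightarrow> f (x \<otimes>\<^bsub>G\<^esub> y) = f x \<otimes>\<^bsub>K\<^esub> f y"
    and "x \<in> carrier G \<Longrightarrow> f (rb G x) = rb K (f x)"
  using assms by (auto simp: rb_hom_def hom_def)

lemma rb_homI:
  assumes "\<And>x. x \<in> carrier G \<Longrightarrow> f x \<in> carrier K"
    and "\<And>x y. \<lbrakk>x \<in> carrier G; y \<in> carrier G\<rbrakk> \<Longrightarrow> f (x \<otimes>\<^bsub>G\<^esub> y) = f x \<otimes>\<^bsub>K\<^esub> f y"
    and "\<And>x. x \<in> carrier G \<Longrightarrow> f (rb G x) = rb K (f x)"
  shows "f \<in> rb_hom G K"
  using assms by (auto simp: rb_hom_def hom_def)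

lemma rb_hom_comp: "\<lbrakk>f \<in> rb_hom G K; f' \<in> rb_hom K L\<rbrakk> \<Longrightarrow> f' \<circ> f \<in> rb_hom G L"
  by (intro rb_homI) (auto simp: rb_homD)

lemma rb_hom_inv_into:
  assumes G: "rota_baxter_group G" and f: "f \<in> rb_hom G K" "bij_betw f (carrier G) (carrier K)"
  shows "inv_into (carrier G) f \<in> rb_hom K G"
proof -
  interpret rota_baxter_group G by fact
  let ?i = "inv_into (carrier G) f"
  have c: "?i x \<in> carrier G" "f (?i x) = x" if "x \<in> carrier K" for x
    using f(2) that by (auto simp: bij_betw_def inv_into_into f_inv_into_f)
  have d: "?i (f x) = x" if "x \<in> carrier G" for x
    using f(2) that by (auto simp: bij_betw_def)
  show ?thesis
  proof (rule rb_homI)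
    fix x y assume xy: "x \<in> carrier K" "y \<in> carrier K"
    then have "x \<otimes>\<^bsub>K\<^esub> y = f (?i x \<otimes>\<^bsub>G\<^esub> ?i y)" using c rb_homD(2)[OF f(1)] by simp
    then show "?i (x \<otimes>\<^bsub>K\<^esub> y) = ?i x \<otimes>\<^bsub>G\<^esub> ?i y" using c d xy by simp
  next
    fix x assume x: "x \<in> carrier K"
    then have "rb K x = f (rb G (?i x))" using c rb_homD(3)[OF f(1)] by simp
    then show "?i (rb K x) = rb G (?i x)" using c d x by (simp add: rb_closed)
  qed (rule c)
qed

section \<open>The group of Rota-Baxter automorphisms\<close>

lemma carrier_rb_Aut:
  "\<gamma> \<in> carrier (rb_Aut G) \<longleftrightarrow>
     \<gamma> \<in> extensional (carrier G) \<and> bij_betw \<gamma> (carrier G) (carrier G) \<and> \<gamma> \<in> rb_hom G G"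
  by (auto simp: rb_Aut_def auto_def Bij_def rb_hom_def)

lemma mult_rb_Aut:
  assumes "\<beta> \<in> carrier (rb_Aut G)" "\<gamma> \<in> carrier (rb_Aut G)"
  shows "\<beta> \<otimes>\<^bsub>rb_Aut G\<^esub> \<gamma> = compose (carrier G) \<beta> \<gamma>"
  using assms by (auto simp: rb_Aut_def AutoGroup_def BijGroup_def auto_def)

lemma one_rb_Aut: "\<one>\<^bsub>rb_Aut G\<^esub> = (\<lambda>x\<in>carrier G. x)"
  by (simp add: rb_Aut_def AutoGroup_def BijGroup_def)

lemma inv_rb_Aut_mem:
  assumes G: "rota_baxter_group G" and \<gamma>: "\<gamma> \<in> carrier (rb_Aut G)"
  shows "(\<lambda>x\<in>carrier G. inv_into (carrier G) \<gamma> x) \<in> carrier (rb_Aut G)"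
proof -
  interpret rota_baxter_group G by fact
  have b: "bij_betw \<gamma> (carrier G) (carrier G)" and h: "\<gamma> \<in> rb_hom G G"
    using \<gamma> by (auto simp: carrier_rb_Aut)
  note i = rb_homD[OF rb_hom_inv_into[OF G h b]]
  have "restrict (inv_into (carrier G) \<gamma>) (carrier G) \<in> rb_hom G G"
    using i by (intro rb_homI) (simp_all add: rb_closed)
  then show ?thesis
    using bij_betw_inv_into[OF b] by (simp add: carrier_rb_Aut)
qed

lemma group_rb_Aut:
  assumes G: "rota_baxter_group G" shows "group (rb_Aut G)"
proof -
  interpret rota_baxter_group G by fact
  interpret A: group "AutoGroup G" by (rule AutoGroup)
  have sub: "x \<in> auto G" if "x \<in> carrier (rb_Aut G)" for x
    using that by (auto simp: rb_Aut_def)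
  have eq: "rb_Aut G = (AutoGroup G)\<lparr>carrier := carrier (rb_Aut G)\<rparr>"
    by (simp add: rb_Aut_def)
  have "subgroup (carrier (rb_Aut G)) (AutoGroup G)"
  proof (rule A.subgroupI)
    show "carrier (rb_Aut G) \<subseteq> carrier (AutoGroup G)"
      using sub by (auto simp: AutoGroup_def)
    have "(\<lambda>x\<in>carrier G. x) \<in> carrier (rb_Aut G)"
      by (auto simp: carrier_rb_Aut rb_closed bij_betw_def intro!: rb_homI)
    then show "carrier (rb_Aut G) \<noteq> {}" by blast
  next
    fix \<gamma> assume \<gamma>: "\<gamma> \<in> carrier (rb_Aut G)"
    let ?i = "\<lambda>x\<in>carrier G. inv_into (carrier G) \<gamma> x"
    have i: "?i \<in> carrier (rb_Aut G)" using inv_rb_Aut_mem[OF G \<gamma>] .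
    have "?i \<otimes>\<^bsub>AutoGroup G\<^esub> \<gamma> = \<one>\<^bsub>AutoGroup G\<^esub>"
      using sub[OF \<gamma>] sub[OF i]
      by (auto simp: AutoGroup_def BijGroup_def auto_def Bij_compose_restrict_eq)
    then have "inv\<^bsub>AutoGroup G\<^esub> \<gamma> = ?i"
      using sub[OF \<gamma>] sub[OF i] by (intro A.inv_equality) (auto simp: AutoGroup_def)
    then show "inv\<^bsub>AutoGroup G\<^esub> \<gamma> \<in> carrier (rb_Aut G)" using i by simp
  next
    fix \<beta> \<gamma> assume bg: "\<beta> \<in> carrier (rb_Aut G)" "\<gamma> \<in> carrier (rb_Aut G)"
    then have "\<beta> \<otimes>\<^bsub>AutoGroup G\<^esub> \<gamma> = compose (carrier G) \<beta> \<gamma>"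
      using sub by (auto simp: AutoGroup_def BijGroup_def auto_def)
    moreover have "compose (carrier G) \<beta> \<gamma> \<in> carrier (rb_Aut G)"
    proof -
      have "compose (carrier G) \<beta> \<gamma> \<in> rb_hom G G"
        using bg by (intro rb_homI) (auto simp: carrier_rb_Aut compose_def rb_closed rb_homD)
      then show ?thesis
        using bg bij_betw_compose[of \<gamma> "carrier G" "carrier G" \<beta> "carrier G"]
        by (auto simp: carrier_rb_Aut)
    qed
    ultimately show "\<beta> \<otimes>\<^bsub>AutoGroup G\<^esub> \<gamma> \<in> carrier (rb_Aut G)" by simp
  qed
  then show ?thesis by (subst eq) (rule A.subgroup_imp_group)
qed

section \<open>Modules over a Rota-Baxter group\<close>

locale rb_mod = H: rota_baxter_group H + I: rota_baxter_group I + I: comm_group I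
  for H :: "('h, 'm) rb_monoid_scheme" and I :: "('i, 'n) rb_monoid_scheme" (structure) +
  fixes \<mu> :: "'h \<Rightarrow> 'i \<Rightarrow> 'i"
  assumes module: "rb_module H I \<mu>"
begin

lemma mu_auto: "h \<in> carrier H \<Longrightarrow> \<mu> h \<in> auto I"
  using module by (auto simp: rb_module_def anti_action_def AutoGroup_def)

lemma mu_closed [simp]: "\<lbrakk>h \<in> carrier H; y \<in> carrier I\<rbrakk> \<Longrightarrow> \<mu> h y \<in> carrier I"
  using mu_auto by (auto simp: auto_def hom_def)

lemma mu_mult: "\<lbrakk>h \<in> carrier H; y \<in> carrier I; z \<in> carrier I\<rbrakk> \<Longrightarrow> \<mu> h (y \<otimes> z) = \<mu> h y \<otimes> \<mu> h z"
  using mu_auto by (auto simp: auto_def hom_def)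

lemma mu_hom: "h \<in> carrier H \<Longrightarrow> group_hom I I (\<mu> h)"
  using mu_auto by unfold_locales (auto simp: auto_def)

lemma mu_one [simp]: "h \<in> carrier H \<Longrightarrow> \<mu> h \<one> = \<one>"
  by (rule group_hom.hom_one[OF mu_hom])

lemma mu_inv: "\<lbrakk>h \<in> carrier H; y \<in> carrier I\<rbrakk> \<Longrightarrow> \<mu> h (inv y) = inv (\<mu> h y)"
  by (rule group_hom.hom_inv[OF mu_hom])

lemma mu_comp:
  "\<lbrakk>h \<in> carrier H; k \<in> carrier H; y \<in> carrier I\<rbrakk> \<Longrightarrow> \<mu> (h \<otimes>\<^bsub>H\<^esub> k) y = \<mu> k (\<mu> h y)"
  using module mu_auto[of h] mu_auto[of k]
  by (auto simp: rb_module_def anti_action_def AutoGroup_def BijGroup_def auto_def compose_eq)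

text \<open>\<open>anti_action\<close> only asks for multiplicativity, so the unit law has to be
  derived: the automorphism at the unit is idempotent, and an injective idempotent map is the
  identity.\<close>

lemma mu_unit [simp]: assumes "y \<in> carrier I" shows "\<mu> \<one>\<^bsub>H\<^esub> y = y"
proof -
  have "\<mu> \<one>\<^bsub>H\<^esub> (\<mu> \<one>\<^bsub>H\<^esub> y) = \<mu> \<one>\<^bsub>H\<^esub> y" using mu_comp[of "\<one>\<^bsub>H\<^esub>" "\<one>\<^bsub>H\<^esub>" y] assms by simp
  moreover have "inj_on (\<mu> \<one>\<^bsub>H\<^esub>) (carrier I)"
    using mu_auto[of "\<one>\<^bsub>H\<^esub>"] by (auto simp: auto_def Bij_def bij_betw_def)
  ultimately show ?thesis using assms by (simp add: inj_on_eq_iff)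
qed

lemma mu_rb: "\<lbrakk>h \<in> carrier H; z \<in> carrier I\<rbrakk> \<Longrightarrow>
  rb I (\<mu> (h \<otimes>\<^bsub>H\<^esub> rb H h) (z \<otimes> rb I z) \<otimes> inv (\<mu> (rb H h) (rb I z))) = \<mu> (rb H h) (rb I z)"
  using module by (auto simp: rb_module_def)

lemmas H_rb_closed [simp] = H.rb_closed
lemmas I_rb_closed [simp] = I.rb_closed

text \<open>In an abelian group the conjugation inside \<open>rb_circ\<close> disappears, so a
  Rota-Baxter operator is just an endomorphism.\<close>

lemma I_rb_mult: "\<lbrakk>y \<in> carrier I; z \<in> carrier I\<rbrakk> \<Longrightarrow> rb I (y \<otimes> z) = rb I y \<otimes> rb I z"
proof -
  assume yz: "y \<in> carrier I" "z \<in> carrier I"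
  then have "rb_circ I y z = y \<otimes> z \<otimes> (rb I y \<otimes> inv (rb I y))"
    by (simp add: rb_circ_def I.m_ac del: I.r_inv)
  then show ?thesis using yz I.rb_mult by simp
qed

lemma I_rb_hom: "group_hom I I (rb I)"
  by unfold_locales (auto simp: hom_def I_rb_mult)

lemma I_rb_inv: "y \<in> carrier I \<Longrightarrow> rb I (inv y) = inv (rb I y)"
  by (rule group_hom.hom_inv[OF I_rb_hom])

lemmas I_rb_one [simp] = I.rb_one
lemmas H_rb_one [simp] = H.rb_one

lemma H_rb_circ: "\<lbrakk>h \<in> carrier H; k \<in> carrier H\<rbrakk> \<Longrightarrow> rb H (rb_circ H h k) = rb H h \<otimes>\<^bsub>H\<^esub> rb H k"
  using H.rb_mult by simp

end

section \<open>Factor sets and the extensions they define\<close>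

lemma C1D:
  assumes "g \<in> carrier (C1 H I)"
  shows "h \<in> carrier H \<Longrightarrow> g h \<in> carrier I" "g \<one>\<^bsub>H\<^esub> = \<one>\<^bsub>I\<^esub>" "g \<in> extensional (carrier H)"
  using assms by (auto simp: C1_def PiE_def)

lemma C2D:
  assumes "\<tau> \<in> carrier (C2 H I)"
  shows "\<lbrakk>h \<in> carrier H; k \<in> carrier H\<rbrakk> \<Longrightarrow> \<tau> (h, k) \<in> carrier I"
    and "h \<in> carrier H \<Longrightarrow> \<tau> (h, \<one>\<^bsub>H\<^esub>) = \<one>\<^bsub>I\<^esub>"
    and "h \<in> carrier H \<Longrightarrow> \<tau> (\<one>\<^bsub>H\<^esub>, h) = \<one>\<^bsub>I\<^esub>"
    and "\<tau> \<in> extensional (carrier H \<times> carrier H)"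
  using assms by (auto simp: C2_def PiE_def)

context rb_mod
begin

lemma mu_cancel [simp]: "\<lbrakk>k \<in> carrier H; y \<in> carrier I\<rbrakk> \<Longrightarrow> \<mu> k (\<mu> (inv\<^bsub>H\<^esub> k) y) = y"
  using mu_comp[of "inv\<^bsub>H\<^esub> k" k y] by simp

text \<open>The first equation of \<open>Z2_RBE\<close> with the inverses moved across:
  associativity of the product of \<open>std_ext\<close>, read in the fibre coordinate.\<close>

definition cocycle :: "('h \<times> 'h \<Rightarrow> 'i) \<Rightarrow> bool" where
  "cocycle \<tau> \<longleftrightarrow> (\<forall>h1\<in>carrier H. \<forall>h2\<in>carrier H. \<forall>h3\<in>carrier H.
     \<tau> (h1, h2 \<otimes>\<^bsub>H\<^esub> h3) \<otimes> \<tau> (h2, h3) = \<tau> (h1 \<otimes>\<^bsub>H\<^esub> h2, h3) \<otimes> \<mu> h3 (\<tau> (h1, h2)))"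

text \<open>The element to which \<open>Phi2\<close> applies the action and \<open>rb I\<close>. For
  trivial g it is the fibre coordinate of \<open>rb_circ\<close> at (h, \<one>) and (k, \<one>) in
  \<open>std_ext\<close>.\<close>

definition Phi2_arg :: "('h \<times> 'h \<Rightarrow> 'i) \<Rightarrow> 'h \<Rightarrow> 'h \<Rightarrow> 'i" where
  "Phi2_arg \<tau> h k = (let r = rb H h; r' = inv\<^bsub>H\<^esub> r in
     \<tau> (h \<otimes>\<^bsub>H\<^esub> r, k \<otimes>\<^bsub>H\<^esub> r') \<otimes> \<mu> (k \<otimes>\<^bsub>H\<^esub> r') (\<tau> (h, r)) \<otimes> \<tau> (k, r') \<otimes> inv (\<tau> (r, r')))"

text \<open>The fibre coordinate of the Rota-Baxter identity of \<open>std_ext\<close> at the points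
  (h, \<one>) and (k, \<one>).\<close>

definition rb_cocycle :: "('h \<times> 'h \<Rightarrow> 'i) \<Rightarrow> ('h \<Rightarrow> 'i) \<Rightarrow> 'h \<Rightarrow> 'h \<Rightarrow> bool" where
  "rb_cocycle \<tau> g h k \<longleftrightarrow>
     \<mu> (rb H k) (g h) \<otimes> g k \<otimes> \<tau> (rb H h, rb H k) =
     g (rb_circ H h k) \<otimes> rb I (\<mu> (rb H k) (\<mu> k (g h) \<otimes> inv (g h))) \<otimes>
       rb I (\<mu> (rb H (rb_circ H h k)) (Phi2_arg \<tau> h k))"

text \<open>The sign of \<open>g\<close> is the one of \<^const>\<open>std_ext\<close>: it is \<open>(\<tau>, -g)\<close> that belongs to \<^const>\<open>Z2_RBE\<close>.\<close>

definition factor_set :: "('h \<times> 'h \<Rightarrow> 'i) \<Rightarrow> ('h \<Rightarrow> 'i) \<Rightarrow> bool" where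
  "factor_set \<tau> g \<longleftrightarrow> \<tau> \<in> carrier (C2 H I) \<and> g \<in> carrier (C1 H I) \<and> cocycle \<tau> \<and>
     (\<forall>h\<in>carrier H. \<forall>k\<in>carrier H. rb_cocycle \<tau> g h k)"

lemma Phi2_arg_closed [simp]:
  "\<lbrakk>\<tau> \<in> carrier (C2 H I); h \<in> carrier H; k \<in> carrier H\<rbrakk> \<Longrightarrow> Phi2_arg \<tau> h k \<in> carrier I"
  by (simp add: Phi2_arg_def Let_def C2D)

abbreviation Std :: "('h \<times> 'h \<Rightarrow> 'i) \<Rightarrow> ('h \<Rightarrow> 'i) \<Rightarrow> ('h \<times> 'i) rb_monoid" where
  "Std \<tau> g \<equiv> mid (std_ext H I \<mu> \<tau> g)"

lemma std_simps [simp]: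
  "carrier (Std \<tau> g) = carrier H \<times> carrier I"
  "(h1, y1) \<otimes>\<^bsub>Std \<tau> g\<^esub> (h2, y2) = (h1 \<otimes>\<^bsub>H\<^esub> h2, \<mu> h2 y1 \<otimes> y2 \<otimes> \<tau> (h1, h2))"
  "\<one>\<^bsub>Std \<tau> g\<^esub> = (\<one>\<^bsub>H\<^esub>, \<one>)"
  "rb (Std \<tau> g) (h, y) = (rb H h, g h \<otimes> rb I (\<mu> (rb H h) y))"
  "incl (std_ext H I \<mu> \<tau> g) y = (\<one>\<^bsub>H\<^esub>, y)"
  "prj (std_ext H I \<mu> \<tau> g) x = fst x"
  by (simp_all add: std_ext_def)

lemma group_Std:
  assumes \<tau>: "\<tau> \<in> carrier (C2 H I)" and c: "cocycle \<tau>"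
  shows "group (Std \<tau> g)"
proof (rule groupI)
  fix a b d assume "a \<in> carrier (Std \<tau> g)" "b \<in> carrier (Std \<tau> g)" "d \<in> carrier (Std \<tau> g)"
  then obtain h1 y1 h2 y2 h3 y3 where e: "a = (h1, y1)" "b = (h2, y2)" "d = (h3, y3)"
    and m: "h1 \<in> carrier H" "h2 \<in> carrier H" "h3 \<in> carrier H"
      "y1 \<in> carrier I" "y2 \<in> carrier I" "y3 \<in> carrier I" by auto
  let ?A = "\<mu> h3 (\<mu> h2 y1) \<otimes> \<mu> h3 y2 \<otimes> y3"
  have "\<mu> h3 (\<mu> h2 y1 \<otimes> y2 \<otimes> \<tau> (h1, h2)) \<otimes> y3 \<otimes> \<tau> (h1 \<otimes>\<^bsub>H\<^esub> h2, h3) =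
      ?A \<otimes> (\<tau> (h1 \<otimes>\<^bsub>H\<^esub> h2, h3) \<otimes> \<mu> h3 (\<tau> (h1, h2)))"
    using m \<tau> by (simp add: mu_mult C2D I.m_ac)
  also have "\<dots> = ?A \<otimes> (\<tau> (h1, h2 \<otimes>\<^bsub>H\<^esub> h3) \<otimes> \<tau> (h2, h3))"
    using c m by (simp add: cocycle_def)
  also have "\<dots> = \<mu> (h2 \<otimes>\<^bsub>H\<^esub> h3) y1 \<otimes> (\<mu> h3 y2 \<otimes> y3 \<otimes> \<tau> (h2, h3)) \<otimes> \<tau> (h1, h2 \<otimes>\<^bsub>H\<^esub> h3)"
    using m \<tau> by (simp add: mu_comp C2D I.m_ac)
  finally show "a \<otimes>\<^bsub>Std \<tau> g\<^esub> b \<otimes>\<^bsub>Std \<tau> g\<^esub> d = a \<otimes>\<^bsub>Std \<tau> g\<^esub> (b \<otimes>\<^bsub>Std \<tau> g\<^esub> d)"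
    using m by (simp add: e H.m_assoc)
next
  fix a assume "a \<in> carrier (Std \<tau> g)"
  then obtain h y where a: "a = (h, y)" and m: "h \<in> carrier H" "y \<in> carrier I" by auto
  \<comment> \<open>Obtained by solving \<open>?b\<close> times a = \<one> for the fibre coordinate;
    \<open>mu_cancel\<close> removes the action of h. A left inverse is all that
    \<open>groupI\<close> asks for.\<close>
  let ?b = "(inv\<^bsub>H\<^esub> h, \<mu> (inv\<^bsub>H\<^esub> h) (inv y \<otimes> inv (\<tau> (inv\<^bsub>H\<^esub> h, h))))"
  have "inv y \<otimes> inv (\<tau> (inv\<^bsub>H\<^esub> h, h)) \<otimes> y \<otimes> \<tau> (inv\<^bsub>H\<^esub> h, h) = \<one>"
    using m \<tau> by (simp add: C2D I.inv_mult[symmetric] I.m_assoc)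
  then have "?b \<otimes>\<^bsub>Std \<tau> g\<^esub> a = \<one>\<^bsub>Std \<tau> g\<^esub>"
    using m \<tau> by (simp add: a C2D)
  moreover have "?b \<in> carrier (Std \<tau> g)" using m \<tau> by (simp add: C2D)
  ultimately show "\<exists>b\<in>carrier (Std \<tau> g). b \<otimes>\<^bsub>Std \<tau> g\<^esub> a = \<one>\<^bsub>Std \<tau> g\<^esub>" by blast
qed (use \<tau> in \<open>auto simp: C2D\<close>)

text \<open>The same inverse, solved from the right. Now \<tau> is evaluated at k and its inverse,
  in the order in which \<open>Phi2_arg\<close> uses it; the left inverse has the arguments of
  \<tau> the other way round.\<close>

lemma inv_Std:
  assumes \<tau>: "\<tau> \<in> carrier (C2 H I)" and c: "cocycle \<tau>" and m: "k \<in> carrier H" "y \<in> carrier I"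
  shows "inv\<^bsub>Std \<tau> g\<^esub> (k, y) = (inv\<^bsub>H\<^esub> k, inv (\<mu> (inv\<^bsub>H\<^esub> k) y) \<otimes> inv (\<tau> (k, inv\<^bsub>H\<^esub> k)))"
proof -
  interpret S: group "Std \<tau> g" by (rule group_Std[OF \<tau> c])
  let ?b = "(inv\<^bsub>H\<^esub> k, inv (\<mu> (inv\<^bsub>H\<^esub> k) y) \<otimes> inv (\<tau> (k, inv\<^bsub>H\<^esub> k)))"
  have "(k, y) \<otimes>\<^bsub>Std \<tau> g\<^esub> ?b = \<one>\<^bsub>Std \<tau> g\<^esub>"
    using m \<tau> by (simp add: C2D I.m_assoc[symmetric])
  moreover have "?b \<in> carrier (Std \<tau> g)" using m \<tau> by (simp add: C2D)
  ultimately show ?thesis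
    using S.inv_comm[of "(k, y)" ?b] m by (intro S.inv_equality) auto
qed

lemma circ_Std:
  assumes \<tau>: "\<tau> \<in> carrier (C2 H I)" and g: "g \<in> carrier (C1 H I)" and c: "cocycle \<tau>"
    and m: "h1 \<in> carrier H" "h2 \<in> carrier H" "y1 \<in> carrier I" "y2 \<in> carrier I"
  defines "k \<equiv> rb H h1" and "k' \<equiv> inv\<^bsub>H\<^esub> (rb H h1)" and "Y \<equiv> g h1 \<otimes> rb I (\<mu> (rb H h1) y1)"
  shows "rb_circ (Std \<tau> g) (h1, y1) (h2, y2) = (rb_circ H h1 h2,
     Phi2_arg \<tau> h1 h2 \<otimes> \<mu> (h2 \<otimes>\<^bsub>H\<^esub> k') (\<mu> k y1) \<otimes> \<mu> (h2 \<otimes>\<^bsub>H\<^esub> k') Y \<otimes> inv (\<mu> k' Y) \<otimes> \<mu> k' y2)"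
proof -
  interpret S: group "Std \<tau> g" by (rule group_Std[OF \<tau> c])
  have Y: "Y \<in> carrier I" and k: "k \<in> carrier H" "k' \<in> carrier H"
    using m g by (simp_all add: Y_def k_def k'_def C1D)
  have R: "rb (Std \<tau> g) (h1, y1) = (k, Y)"
    by (simp add: k_def Y_def)
  have i: "inv\<^bsub>Std \<tau> g\<^esub> (k, Y) = (k', inv (\<mu> k' Y) \<otimes> inv (\<tau> (k, k')))"
    using inv_Std[OF \<tau> c k(1) Y] by (simp add: k_def k'_def)
  \<comment> \<open>The four factors are bracketed two by two because this evaluates \<tau> at
    precisely the arguments of \<open>Phi2_arg\<close>; another bracketing would give other values,
    to be matched by \<open>cocycle\<close>.\<close>
  have "rb_circ (Std \<tau> g) (h1, y1) (h2, y2) =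
      ((h1, y1) \<otimes>\<^bsub>Std \<tau> g\<^esub> (k, Y)) \<otimes>\<^bsub>Std \<tau> g\<^esub> ((h2, y2) \<otimes>\<^bsub>Std \<tau> g\<^esub> inv\<^bsub>Std \<tau> g\<^esub> (k, Y))"
    unfolding rb_circ_def R
    using m k Y by (intro S.m_assoc S.m_closed S.inv_closed) simp_all
  also have "\<dots> = (rb_circ H h1 h2, Phi2_arg \<tau> h1 h2 \<otimes>
      \<mu> (h2 \<otimes>\<^bsub>H\<^esub> k') (\<mu> k y1) \<otimes> \<mu> (h2 \<otimes>\<^bsub>H\<^esub> k') Y \<otimes> inv (\<mu> k' Y) \<otimes> \<mu> k' y2)"
    unfolding i using m k Y \<tau>
    by (simp add: C2D mu_mult I.m_ac Phi2_arg_def Let_def rb_circ_def k_def k'_def H.m_assoc)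
  finally show ?thesis .
qed

text \<open>Both sides of the identity are the respective side of \<open>rb_cocycle\<close> times
  the same element \<open>q \<otimes> u\<close>, which cancels. Here u carries all of y2 and q all
  of y1; that y1 enters both sides in the same way is the module condition.\<close>

lemma rb_Std_iff:
  assumes \<tau>: "\<tau> \<in> carrier (C2 H I)" and g: "g \<in> carrier (C1 H I)" and c: "cocycle \<tau>"
    and m: "h1 \<in> carrier H" "h2 \<in> carrier H" "y1 \<in> carrier I" "y2 \<in> carrier I"
  shows "rb (Std \<tau> g) (h1, y1) \<otimes>\<^bsub>Std \<tau> g\<^esub> rb (Std \<tau> g) (h2, y2) =
      rb (Std \<tau> g) (rb_circ (Std \<tau> g) (h1, y1) (h2, y2)) \<longleftrightarrow> rb_cocycle \<tau> g h1 h2"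
proof -
  define k r w where "k = rb H h1" and "r = rb H h2" and "w = \<mu> k y1"
  have kr: "k \<in> carrier H" "r \<in> carrier H" "w \<in> carrier I"
    using m by (simp_all add: k_def r_def w_def)
  \<comment> \<open>The homomorphisms \<mu> and \<open>rb I\<close> are pushed inwards until only
    these atoms remain; after that, commutativity in I settles both comparisons.\<close>
  define T where "T = rb I (\<mu> (k \<otimes>\<^bsub>H\<^esub> r) (Phi2_arg \<tau> h1 h2))"
  define a1 where "a1 = rb I (\<mu> r (\<mu> h2 w))"
  define a2 where "a2 = rb I (\<mu> r (\<mu> h2 (rb I w)))"
  define a3 where "a3 = rb I (\<mu> r (rb I w))"
  define b1 where "b1 = rb I (\<mu> r (\<mu> h2 (g h1)))"
  define b2 where "b2 = rb I (\<mu> r (g h1))"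
  define u where "u = rb I (\<mu> r y2)"
  define q where "q = \<mu> r (rb I w)"
  define c0 where "c0 = g (rb_circ H h1 h2)"
  define x where "x = \<mu> r (g h1)"
  have cl: "T \<in> carrier I" "a1 \<in> carrier I" "a2 \<in> carrier I" "a3 \<in> carrier I" "b1 \<in> carrier I"
     "b2 \<in> carrier I" "u \<in> carrier I" "q \<in> carrier I" "c0 \<in> carrier I" "x \<in> carrier I"
    "g h2 \<in> carrier I" "\<tau> (k, r) \<in> carrier I"
    unfolding T_def a1_def a2_def a3_def b1_def b2_def u_def q_def c0_def x_def
    using m kr \<tau> g by (simp_all add: C1D C2D)
  \<comment> \<open>This is the module condition at h2 and w. On the left of the Rota-Baxter
    identity y1 occurs through q, on the right through a1, a2 and a3.\<close>
  have q: "q = a1 \<otimes> a2 \<otimes> inv a3"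
    using mu_rb[of h2 w] m kr
    by (simp add: q_def a1_def a2_def a3_def r_def mu_mult mu_comp I_rb_mult I_rb_inv)
  have R: "rb (Std \<tau> g) (rb_circ (Std \<tau> g) (h1, y1) (h2, y2)) =
      (k \<otimes>\<^bsub>H\<^esub> r, c0 \<otimes> (T \<otimes> a1 \<otimes> (b1 \<otimes> a2) \<otimes> inv (b2 \<otimes> a3) \<otimes> u))"
    using m kr \<tau> g
    by (simp add: circ_Std[OF \<tau> g c m] H_rb_circ k_def[symmetric] r_def[symmetric] w_def[symmetric]
        C1D mu_mult mu_inv I_rb_mult I_rb_inv c0_def T_def u_def mu_comp a1_def a2_def a3_def
        b1_def b2_def)
  have L: "rb (Std \<tau> g) (h1, y1) \<otimes>\<^bsub>Std \<tau> g\<^esub> rb (Std \<tau> g) (h2, y2) =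
      (k \<otimes>\<^bsub>H\<^esub> r, x \<otimes> q \<otimes> (g h2 \<otimes> u) \<otimes> \<tau> (k, r))"
    using m kr g
    by (simp add: k_def[symmetric] r_def[symmetric] w_def[symmetric] C1D mu_mult x_def q_def u_def)
  have C: "rb_cocycle \<tau> g h1 h2 \<longleftrightarrow> x \<otimes> g h2 \<otimes> \<tau> (k, r) = c0 \<otimes> (b1 \<otimes> inv b2) \<otimes> T"
    using m kr g
    by (simp add: rb_cocycle_def H_rb_circ k_def[symmetric] r_def[symmetric] C1D mu_mult mu_inv
        I_rb_mult I_rb_inv x_def c0_def b1_def b2_def T_def)
  have "x \<otimes> q \<otimes> (g h2 \<otimes> u) \<otimes> \<tau> (k, r) = (x \<otimes> g h2 \<otimes> \<tau> (k, r)) \<otimes> (q \<otimes> u)"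
    using cl by (simp add: I.m_ac)
  moreover have "c0 \<otimes> (T \<otimes> a1 \<otimes> (b1 \<otimes> a2) \<otimes> inv (b2 \<otimes> a3) \<otimes> u) =
      (c0 \<otimes> (b1 \<otimes> inv b2) \<otimes> T) \<otimes> (q \<otimes> u)"
    using cl by (simp add: q I.m_ac I.inv_mult)
  ultimately show ?thesis
    unfolding L R C using cl by simp
qed

lemma rota_baxter_Std:
  assumes "factor_set \<tau> g" shows "rota_baxter_group (Std \<tau> g)"
proof -
  have \<tau>: "\<tau> \<in> carrier (C2 H I)" and g: "g \<in> carrier (C1 H I)" and c: "cocycle \<tau>"
    and r: "\<And>h k. \<lbrakk>h \<in> carrier H; k \<in> carrier H\<rbrakk> \<Longrightarrow> rb_cocycle \<tau> g h k"
    using assms by (auto simp: factor_set_def)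
  interpret S: group "Std \<tau> g" by (rule group_Std[OF \<tau> c])
  show ?thesis
  proof unfold_locales
    fix a b assume "a \<in> carrier (Std \<tau> g)" "b \<in> carrier (Std \<tau> g)"
    then show "rb (Std \<tau> g) a \<otimes>\<^bsub>Std \<tau> g\<^esub> rb (Std \<tau> g) b = rb (Std \<tau> g) (rb_circ (Std \<tau> g) a b)"
      using rb_Std_iff[OF \<tau> g c] r by (cases a, cases b) (simp del: std_simps(2,4))
  qed (use g in \<open>auto simp: C1D\<close>)
qed

lemma std_is_extension:
  assumes f: "factor_set \<tau> g"
  shows "is_rb_extension H I (std_ext H I \<mu> \<tau> g)"
proof -
  have \<tau>: "\<tau> \<in> carrier (C2 H I)" and g: "g \<in> carrier (C1 H I)"
    using f by (auto simp: factor_set_def)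
  have "incl (std_ext H I \<mu> \<tau> g) \<in> rb_hom I (Std \<tau> g)"
    using \<tau> g by (intro rb_homI) (auto simp: C1D C2D)
  moreover have "prj (std_ext H I \<mu> \<tau> g) \<in> rb_hom (Std \<tau> g) H"
    by (intro rb_homI) auto
  moreover have "prj (std_ext H I \<mu> \<tau> g) ` carrier (Std \<tau> g) = carrier H"
    by (force simp: image_iff)
  moreover have "incl (std_ext H I \<mu> \<tau> g) ` carrier I =
      kernel (Std \<tau> g) H (prj (std_ext H I \<mu> \<tau> g))"
    by (auto simp: kernel_def)
  ultimately show ?thesis
    using rota_baxter_Std[OF f] by (auto simp: is_rb_extension_def inj_on_def)
qed

end

section \<open>Equivalence of extensions and sections\<close>

lemma rb_ext_equivI:
  assumes "\<gamma> \<in> rb_hom (mid \<E>) (mid Y)" "bij_betw \<gamma> (carrier (mid \<E>)) (carrier (mid Y))"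
    and "\<And>y. y \<in> carrier I \<Longrightarrow> \<gamma> (incl \<E> y) = incl Y y"
    and "\<And>x. x \<in> carrier (mid \<E>) \<Longrightarrow> prj Y (\<gamma> x) = prj \<E> x"
  shows "rb_ext_equiv I \<E> Y"
  unfolding rb_ext_equiv_def using assms by (intro bexI[of _ \<gamma>]) (auto simp: iso_def rb_hom_def)

lemma rb_ext_equivE:
  assumes "rb_ext_equiv I \<E> Y"
  obtains \<gamma> where "\<gamma> \<in> rb_hom (mid \<E>) (mid Y)" "bij_betw \<gamma> (carrier (mid \<E>)) (carrier (mid Y))"
    and "\<And>y. y \<in> carrier I \<Longrightarrow> \<gamma> (incl \<E> y) = incl Y y"
    and "\<And>x. x \<in> carrier (mid \<E>) \<Longrightarrow> prj Y (\<gamma> x) = prj \<E> x"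
  using assms unfolding rb_ext_equiv_def by (auto simp: iso_def)

lemma rb_ext_equiv_sym:
  assumes \<E>: "is_rb_extension H I \<E>" and e: "rb_ext_equiv I \<E> Y"
  shows "rb_ext_equiv I Y \<E>"
  using e
proof (rule rb_ext_equivE)
  fix \<gamma> assume g: "\<gamma> \<in> rb_hom (mid \<E>) (mid Y)" "bij_betw \<gamma> (carrier (mid \<E>)) (carrier (mid Y))"
    and i: "\<And>y. y \<in> carrier I \<Longrightarrow> \<gamma> (incl \<E> y) = incl Y y"
    and p: "\<And>x. x \<in> carrier (mid \<E>) \<Longrightarrow> prj Y (\<gamma> x) = prj \<E> x"
  let ?d = "inv_into (carrier (mid \<E>)) \<gamma>"
  have inj: "inj_on \<gamma> (carrier (mid \<E>))" and sur: "\<gamma> ` carrier (mid \<E>) = carrier (mid Y)"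
    using g(2) by (auto simp: bij_betw_def)
  have ic: "incl \<E> y \<in> carrier (mid \<E>)" if "y \<in> carrier I" for y
    using \<E> that by (auto simp: is_rb_extension_def rb_homD)
  show ?thesis
  proof (rule rb_ext_equivI)
    show "?d \<in> rb_hom (mid Y) (mid \<E>)"
      using \<E> by (intro rb_hom_inv_into g) (simp add: is_rb_extension_def)
    show "bij_betw ?d (carrier (mid Y)) (carrier (mid \<E>))" using g(2) by (rule bij_betw_inv_into)
    show "?d (incl Y y) = incl \<E> y" if "y \<in> carrier I" for y
      using i[OF that] ic[OF that] inj by (metis inv_into_f_f)
    show "prj \<E> (?d x) = prj Y x" if "x \<in> carrier (mid Y)" for x
      using p[of "?d x"] that sur by (simp add: inv_into_into f_inv_into_f)
  qed
qed

lemma rb_ext_equiv_trans: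
  assumes "rb_ext_equiv I \<E> Y" "rb_ext_equiv I Y Z"
  shows "rb_ext_equiv I \<E> Z"
proof -
  obtain \<gamma> where g: "\<gamma> \<in> rb_hom (mid \<E>) (mid Y)" "bij_betw \<gamma> (carrier (mid \<E>)) (carrier (mid Y))"
    "\<And>y. y \<in> carrier I \<Longrightarrow> \<gamma> (incl \<E> y) = incl Y y"
    "\<And>x. x \<in> carrier (mid \<E>) \<Longrightarrow> prj Y (\<gamma> x) = prj \<E> x"
    using rb_ext_equivE[OF assms(1)] by blast
  obtain \<beta> where b: "\<beta> \<in> rb_hom (mid Y) (mid Z)" "bij_betw \<beta> (carrier (mid Y)) (carrier (mid Z))"
    "\<And>y. y \<in> carrier I \<Longrightarrow> \<beta> (incl Y y) = incl Z y"
    "\<And>x. x \<in> carrier (mid Y) \<Longrightarrow> prj Z (\<beta> x) = prj Y x"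
    using rb_ext_equivE[OF assms(2)] by blast
  show ?thesis
    by (rule rb_ext_equivI[of "\<beta> \<circ> \<gamma>"])
      (use g b rb_homD(1)[OF g(1)] in \<open>auto intro: rb_hom_comp bij_betw_trans\<close>)
qed

context rb_mod
begin

text \<open>Membership in \<open>C1\<close> and \<open>C2\<close> makes \<tau> and g extensional as
  well as normalised, so that they are determined by s as HOL functions; \<open>data_unique\<close>
  rests on this.\<close>

definition section_data where
  "section_data \<E> s \<tau> g \<longleftrightarrow> st_section H \<E> s \<and> \<tau> \<in> carrier (C2 H I) \<and> g \<in> carrier (C1 H I) \<and>
     (\<forall>h\<in>carrier H. \<forall>k\<in>carrier H.
        s h \<otimes>\<^bsub>mid \<E>\<^esub> s k = s (h \<otimes>\<^bsub>H\<^esub> k) \<otimes>\<^bsub>mid \<E>\<^esub> incl \<E> (\<tau> (h, k))) \<and>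
     (\<forall>h\<in>carrier H. rb (mid \<E>) (s h) = s (rb H h) \<otimes>\<^bsub>mid \<E>\<^esub> incl \<E> (g h))"

text \<open>\<open>has_action\<close> speaks about every normalised section. The assumption
  \<open>sl\<close> expresses the action without a section, as the rule for moving elements of I
  past an arbitrary element.\<close>

lemma has_actionI:
  assumes E: "is_rb_extension H I \<E>"
    and sl: "\<And>x y. \<lbrakk>x \<in> carrier (mid \<E>); y \<in> carrier I\<rbrakk> \<Longrightarrow>
      incl \<E> y \<otimes>\<^bsub>mid \<E>\<^esub> x = x \<otimes>\<^bsub>mid \<E>\<^esub> incl \<E> (\<mu> (prj \<E> x) y)"
  shows "has_action H I \<mu> \<E>"
  unfolding has_action_def
proof (intro allI impI ballI)
  interpret M: rota_baxter_group "mid \<E>" using E by (simp add: is_rb_extension_def)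
  have c: "incl \<E> y \<in> carrier (mid \<E>)" if "y \<in> carrier I" for y
    using E that by (auto simp: is_rb_extension_def rb_homD)
  fix s h y assume s: "st_section H \<E> s" and m: "h \<in> carrier H" "y \<in> carrier I"
  have x: "s h \<in> carrier (mid \<E>)" "prj \<E> (s h) = h"
    using s m by (auto simp: st_section_def)
  have "inv\<^bsub>mid \<E>\<^esub> (s h) \<otimes>\<^bsub>mid \<E>\<^esub> incl \<E> y \<otimes>\<^bsub>mid \<E>\<^esub> s h =
      inv\<^bsub>mid \<E>\<^esub> (s h) \<otimes>\<^bsub>mid \<E>\<^esub> (s h \<otimes>\<^bsub>mid \<E>\<^esub> incl \<E> (\<mu> h y))"
    using sl[OF x(1) m(2)] x m c by (simp add: M.m_assoc)
  then show "incl \<E> (\<mu> h y) = inv\<^bsub>mid \<E>\<^esub> (s h) \<otimes>\<^bsub>mid \<E>\<^esub> incl \<E> y \<otimes>\<^bsub>mid \<E>\<^esub> s h"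
    using x m c by (simp add: M.m_assoc[symmetric])
qed

end

section \<open>Calculation in the middle group of an extension\<close>

locale rb_extension = rb_mod H I \<mu>
  for H :: "('h, 'm) rb_monoid_scheme" and I :: "('i, 'n) rb_monoid_scheme" (structure)
    and \<mu> :: "'h \<Rightarrow> 'i \<Rightarrow> 'i" +
  fixes \<E> :: "('i, 'e, 'h) rb_ext"
  assumes ext: "is_rb_extension H I \<E>" and act: "has_action H I \<mu> \<E>"
begin

abbreviation (input) "M \<equiv> mid \<E>"
abbreviation (input) "i \<equiv> incl \<E>"
abbreviation (input) "p \<equiv> prj \<E>"

sublocale M: rota_baxter_group "mid \<E>"
  using ext by (simp add: is_rb_extension_def)

lemma i_hom: "i \<in> rb_hom I M" and p_hom: "p \<in> rb_hom M H"
  using ext by (auto simp: is_rb_extension_def)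

lemma i_closed [simp]: "y \<in> carrier I \<Longrightarrow> i y \<in> carrier M"
  and i_mult: "\<lbrakk>y \<in> carrier I; z \<in> carrier I\<rbrakk> \<Longrightarrow> i (y \<otimes> z) = i y \<otimes>\<^bsub>M\<^esub> i z"
  and i_rb: "y \<in> carrier I \<Longrightarrow> rb M (i y) = i (rb I y)"
  and p_closed [simp]: "x \<in> carrier M \<Longrightarrow> p x \<in> carrier H"
  and p_mult [simp]: "\<lbrakk>x \<in> carrier M; x' \<in> carrier M\<rbrakk> \<Longrightarrow> p (x \<otimes>\<^bsub>M\<^esub> x') = p x \<otimes>\<^bsub>H\<^esub> p x'"
  and p_rb [simp]: "x \<in> carrier M \<Longrightarrow> p (rb M x) = rb H (p x)"
  using i_hom p_hom by (auto simp: rb_homD)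

lemmas M_rb_closed [simp] = M.rb_closed

lemma i_eq_iff [simp]: "\<lbrakk>y \<in> carrier I; z \<in> carrier I\<rbrakk> \<Longrightarrow> i y = i z \<longleftrightarrow> y = z"
  using ext by (auto simp: is_rb_extension_def inj_on_eq_iff)

lemma p_i [simp]: "y \<in> carrier I \<Longrightarrow> p (i y) = \<one>\<^bsub>H\<^esub>"
  using ext by (auto simp: is_rb_extension_def kernel_def)

lemma i_one [simp]: "i \<one> = \<one>\<^bsub>M\<^esub>"
proof -
  have "group_hom I M i" using i_hom by unfold_locales (auto simp: rb_hom_def)
  then show ?thesis by (rule group_hom.hom_one)
qed

lemma p_group_hom: "group_hom M H p"
  using p_hom by unfold_locales (auto simp: rb_hom_def)

lemma p_one [simp]: "p \<one>\<^bsub>M\<^esub> = \<one>\<^bsub>H\<^esub>"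
  using p_group_hom by (rule group_hom.hom_one)

lemma p_inv [simp]: "x \<in> carrier M \<Longrightarrow> p (inv\<^bsub>M\<^esub> x) = inv\<^bsub>H\<^esub> (p x)"
  using p_group_hom by (rule group_hom.hom_inv)

text \<open>Exactness at the middle group in the form used below: I acts on each fibre of the
  projection by right multiplication, transitively.\<close>

lemma same_fibre:
  assumes "x \<in> carrier M" "x' \<in> carrier M" "p x = p x'"
  obtains y where "y \<in> carrier I" "x' = x \<otimes>\<^bsub>M\<^esub> i y"
proof -
  have "inv\<^bsub>M\<^esub> x \<otimes>\<^bsub>M\<^esub> x' \<in> kernel M H p" using assms by (simp add: kernel_def)
  then obtain y where y: "y \<in> carrier I" "inv\<^bsub>M\<^esub> x \<otimes>\<^bsub>M\<^esub> x' = i y"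
    using ext by (auto simp: is_rb_extension_def)
  then have "x' = x \<otimes>\<^bsub>M\<^esub> i y" using assms by (simp add: M.inv_solve_left')
  then show thesis using y that by blast
qed

lemma section_exists: "\<exists>s. st_section H \<E> s"
proof -
  \<comment> \<open>The normalisation at the unit is part of the property, so that the function
    obtained by choice already satisfies it.\<close>
  have "\<exists>x\<in>carrier M. p x = h \<and> (h = \<one>\<^bsub>H\<^esub> \<longrightarrow> x = \<one>\<^bsub>M\<^esub>)" if "h \<in> carrier H" for h
  proof (cases "h = \<one>\<^bsub>H\<^esub>")
    case False
    have "h \<in> p ` carrier M" using ext that by (simp add: is_rb_extension_def)
    then show ?thesis using False by blast
  qed (auto intro: bexI[of _ "\<one>\<^bsub>M\<^esub>"])
  then obtain s where "\<And>h. h \<in> carrier H \<Longrightarrow> s h \<in> carrier M \<and> p (s h) = h \<and> (h = \<one>\<^bsub>H\<^esub> \<longrightarrow> s h = \<one>\<^bsub>M\<^esub>)"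
    by metis
  then have "st_section H \<E> s" by (auto simp: st_section_def)
  then show ?thesis by blast
qed

lemma sectionD:
  assumes "st_section H \<E> s"
  shows "h \<in> carrier H \<Longrightarrow> s h \<in> carrier M" "h \<in> carrier H \<Longrightarrow> p (s h) = h" "s \<one>\<^bsub>H\<^esub> = \<one>\<^bsub>M\<^esub>"
  using assms by (auto simp: st_section_def)

text \<open>The action is given by conjugation with values of sections only. A general x is such a
  value times an element of I, and that element commutes with I.\<close>

lemma slide:
  assumes x: "x \<in> carrier M" and y: "y \<in> carrier I"
  shows "i y \<otimes>\<^bsub>M\<^esub> x = x \<otimes>\<^bsub>M\<^esub> i (\<mu> (p x) y)"
proof -
  obtain s where s: "st_section H \<E> s" using section_exists by blast
  let ?h = "p x"
  have sh: "s ?h \<in> carrier M" "p (s ?h) = ?h" using s x by (simp_all add: sectionD)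
  obtain z where z: "z \<in> carrier I" "x = s ?h \<otimes>\<^bsub>M\<^esub> i z"
    using same_fibre[of "s ?h" x] sh x by metis
  have m: "\<mu> ?h y \<in> carrier I" using x y by simp
  have "i (\<mu> ?h y) = inv\<^bsub>M\<^esub> (s ?h) \<otimes>\<^bsub>M\<^esub> i y \<otimes>\<^bsub>M\<^esub> s ?h"
    using act s x y by (simp add: has_action_def)
  then have *: "s ?h \<otimes>\<^bsub>M\<^esub> i (\<mu> ?h y) = i y \<otimes>\<^bsub>M\<^esub> s ?h"
    using sh y by (simp add: M.m_assoc[symmetric])
  have "i y \<otimes>\<^bsub>M\<^esub> x = s ?h \<otimes>\<^bsub>M\<^esub> i (\<mu> ?h y) \<otimes>\<^bsub>M\<^esub> i z"
    using sh y z by (simp add: * M.m_assoc)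
  also have "\<dots> = s ?h \<otimes>\<^bsub>M\<^esub> i z \<otimes>\<^bsub>M\<^esub> i (\<mu> ?h y)"
    using sh m z(1) by (simp add: M.m_assoc i_mult[symmetric] I.m_comm)
  also have "\<dots> = x \<otimes>\<^bsub>M\<^esub> i (\<mu> ?h y)" using z(2) by simp
  finally show ?thesis .
qed

lemma mult_i:
  assumes "x \<in> carrier M" "x' \<in> carrier M" "y \<in> carrier I" "y' \<in> carrier I"
  shows "(x \<otimes>\<^bsub>M\<^esub> i y) \<otimes>\<^bsub>M\<^esub> (x' \<otimes>\<^bsub>M\<^esub> i y') = x \<otimes>\<^bsub>M\<^esub> x' \<otimes>\<^bsub>M\<^esub> i (\<mu> (p x') y \<otimes> y')"
proof -
  have "(x \<otimes>\<^bsub>M\<^esub> i y) \<otimes>\<^bsub>M\<^esub> (x' \<otimes>\<^bsub>M\<^esub> i y') = x \<otimes>\<^bsub>M\<^esub> (i y \<otimes>\<^bsub>M\<^esub> x') \<otimes>\<^bsub>M\<^esub> i y'"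
    using assms by (simp add: M.m_assoc)
  then show ?thesis using assms by (simp add: slide[of x' y] i_mult M.m_assoc)
qed

text \<open>With u = \<mu>(R(p x)) y, sliding past R x gives R x u (R x)^-1 = y, hence x y is
  \<open>rb_circ\<close> of x and u. The Rota-Baxter identity then splits the operator at
  once.\<close>

lemma rb_i:
  assumes x: "x \<in> carrier M" and y: "y \<in> carrier I"
  shows "rb M (x \<otimes>\<^bsub>M\<^esub> i y) = rb M x \<otimes>\<^bsub>M\<^esub> i (rb I (\<mu> (rb H (p x)) y))"
proof -
  let ?u = "\<mu> (rb H (p x)) y"
  have u: "?u \<in> carrier I" using x y by simp
  have "rb M x \<otimes>\<^bsub>M\<^esub> i ?u = i y \<otimes>\<^bsub>M\<^esub> rb M x" using slide[of "rb M x" y] x y by simp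
  then have "rb M x \<otimes>\<^bsub>M\<^esub> i ?u \<otimes>\<^bsub>M\<^esub> inv\<^bsub>M\<^esub> (rb M x) = i y" using x y u by (simp add: M.m_assoc)
  then have "rb_circ M x (i ?u) = x \<otimes>\<^bsub>M\<^esub> i y" using x y u by (simp add: rb_circ_def M.m_assoc)
  then show ?thesis using M.rb_mult[of x "i ?u"] x u by (simp add: i_rb)
qed

section \<open>The factor set of a section\<close>

lemma data_exists:
  assumes s: "st_section H \<E> s"
  obtains \<tau> g where "section_data \<E> s \<tau> g"
proof -
  note sD [simp] = sectionD[OF s]
  have "\<exists>y\<in>carrier I. s h \<otimes>\<^bsub>M\<^esub> s k = s (h \<otimes>\<^bsub>H\<^esub> k) \<otimes>\<^bsub>M\<^esub> i y"
    if "h \<in> carrier H" "k \<in> carrier H" for h k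
    using same_fibre[of "s (h \<otimes>\<^bsub>H\<^esub> k)" "s h \<otimes>\<^bsub>M\<^esub> s k"] that by auto
  then obtain t where t: "\<And>h k. \<lbrakk>h \<in> carrier H; k \<in> carrier H\<rbrakk> \<Longrightarrow>
      t h k \<in> carrier I \<and> s h \<otimes>\<^bsub>M\<^esub> s k = s (h \<otimes>\<^bsub>H\<^esub> k) \<otimes>\<^bsub>M\<^esub> i (t h k)"
    by metis
  have "\<exists>y\<in>carrier I. rb M (s h) = s (rb H h) \<otimes>\<^bsub>M\<^esub> i y" if "h \<in> carrier H" for h
    using same_fibre[of "s (rb H h)" "rb M (s h)"] that by auto
  then obtain f where f: "\<And>h. h \<in> carrier H \<Longrightarrow> f h \<in> carrier I \<and> rb M (s h) = s (rb H h) \<otimes>\<^bsub>M\<^esub> i (f h)"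
    by metis
  \<comment> \<open>Correction terms are unique, so at degenerate arguments, where none is needed,
    the chosen ones must be trivial.\<close>
  have one: "y = \<one>" if "x \<in> carrier M" "y \<in> carrier I" "x = x \<otimes>\<^bsub>M\<^esub> i y" for x y
    using that M.r_cancel_one'[of "i y" x] i_eq_iff[of y \<one>] by simp
  have "t h \<one>\<^bsub>H\<^esub> = \<one>" "t \<one>\<^bsub>H\<^esub> h = \<one>" if "h \<in> carrier H" for h
    using t[of h "\<one>\<^bsub>H\<^esub>"] t[of "\<one>\<^bsub>H\<^esub>" h] that by (auto intro!: one[of "s h"])
  moreover have "f \<one>\<^bsub>H\<^esub> = \<one>"
    using f[of "\<one>\<^bsub>H\<^esub>"] by (auto intro!: one[of "\<one>\<^bsub>M\<^esub>"] simp: M.rb_one)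
  ultimately have "section_data \<E> s (\<lambda>(h,k)\<in>carrier H \<times> carrier H. t h k) (\<lambda>h\<in>carrier H. f h)"
    using s t f by (auto simp: section_data_def C1_def C2_def)
  then show thesis by (rule that)
qed

context
  fixes s \<tau> g assumes d: "section_data \<E> s \<tau> g"
begin

lemma section_dataD:
  shows "h \<in> carrier H \<Longrightarrow> s h \<in> carrier M" "h \<in> carrier H \<Longrightarrow> p (s h) = h" "s \<one>\<^bsub>H\<^esub> = \<one>\<^bsub>M\<^esub>"
    and "\<lbrakk>h \<in> carrier H; k \<in> carrier H\<rbrakk> \<Longrightarrow> \<tau> (h, k) \<in> carrier I"
    and "h \<in> carrier H \<Longrightarrow> g h \<in> carrier I"
    and "\<lbrakk>h \<in> carrier H; k \<in> carrier H\<rbrakk> \<Longrightarrow> s h \<otimes>\<^bsub>M\<^esub> s k = s (h \<otimes>\<^bsub>H\<^esub> k) \<otimes>\<^bsub>M\<^esub> i (\<tau> (h, k))"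
    and "h \<in> carrier H \<Longrightarrow> rb M (s h) = s (rb H h) \<otimes>\<^bsub>M\<^esub> i (g h)"
    and "\<tau> \<in> carrier (C2 H I)" "g \<in> carrier (C1 H I)"
  using d by (auto simp: section_data_def sectionD C1D C2D)

text \<open>The two bracketings of s h1 s h2 s h3, each written as the value of s at the product
  times a correction in I, must have the same correction.\<close>

lemma data_cocycle: "cocycle \<tau>"
  unfolding cocycle_def
proof (intro ballI)
  fix h1 h2 h3 assume m [simp]: "h1 \<in> carrier H" "h2 \<in> carrier H" "h3 \<in> carrier H"
  note [simp] = section_dataD(1-5)
  let ?s = "s (h1 \<otimes>\<^bsub>H\<^esub> h2 \<otimes>\<^bsub>H\<^esub> h3)"
  have "s h1 \<otimes>\<^bsub>M\<^esub> s h2 \<otimes>\<^bsub>M\<^esub> s h3 = s (h1 \<otimes>\<^bsub>H\<^esub> h2) \<otimes>\<^bsub>M\<^esub> (i (\<tau> (h1, h2)) \<otimes>\<^bsub>M\<^esub> s h3)"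
    by (simp add: section_dataD(6) M.m_assoc)
  also have "\<dots> = s (h1 \<otimes>\<^bsub>H\<^esub> h2) \<otimes>\<^bsub>M\<^esub> s h3 \<otimes>\<^bsub>M\<^esub> i (\<mu> h3 (\<tau> (h1, h2)))"
    by (simp add: slide[of "s h3"] M.m_assoc)
  also have "\<dots> = ?s \<otimes>\<^bsub>M\<^esub> i (\<tau> (h1 \<otimes>\<^bsub>H\<^esub> h2, h3) \<otimes> \<mu> h3 (\<tau> (h1, h2)))"
    by (simp add: section_dataD(6) i_mult M.m_assoc)
  finally have 1: "s h1 \<otimes>\<^bsub>M\<^esub> s h2 \<otimes>\<^bsub>M\<^esub> s h3 = \<dots>" .
  have "s h1 \<otimes>\<^bsub>M\<^esub> s h2 \<otimes>\<^bsub>M\<^esub> s h3 = s h1 \<otimes>\<^bsub>M\<^esub> s (h2 \<otimes>\<^bsub>H\<^esub> h3) \<otimes>\<^bsub>M\<^esub> i (\<tau> (h2, h3))"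
    by (simp add: M.m_assoc section_dataD(6)[of h2 h3])
  also have "\<dots> = ?s \<otimes>\<^bsub>M\<^esub> i (\<tau> (h1, h2 \<otimes>\<^bsub>H\<^esub> h3) \<otimes> \<tau> (h2, h3))"
    by (simp add: section_dataD(6)[of h1] i_mult M.m_assoc H.m_assoc)
  finally show "\<tau> (h1, h2 \<otimes>\<^bsub>H\<^esub> h3) \<otimes> \<tau> (h2, h3) = \<tau> (h1 \<otimes>\<^bsub>H\<^esub> h2, h3) \<otimes> \<mu> h3 (\<tau> (h1, h2))"
    using 1 by simp
qed

text \<open>Coordinates on the middle group relative to s. That they respect product and operator is
  proved before \<open>Std\<close> is known to be a Rota-Baxter group, and serves to prove
  it.\<close>

definition realise where "realise x = s (fst x) \<otimes>\<^bsub>M\<^esub> i (snd x)"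

lemma realise_bij: "bij_betw realise (carrier (Std \<tau> g)) (carrier M)"
  unfolding bij_betw_def
proof
  note [simp] = section_dataD(1-5)
  show "inj_on realise (carrier (Std \<tau> g))"
  proof (rule inj_onI, clarsimp simp: realise_def)
    fix h y k z assume m: "h \<in> carrier H" "y \<in> carrier I" "k \<in> carrier H" "z \<in> carrier I"
      and e: "s h \<otimes>\<^bsub>M\<^esub> i y = s k \<otimes>\<^bsub>M\<^esub> i z"
    from arg_cong[OF e, of p] m have "h = k" by simp
    with e m show "h = k \<and> y = z" by simp
  qed
  show "realise ` carrier (Std \<tau> g) = carrier M"
  proof safe
    fix x assume x: "x \<in> carrier M"
    obtain y where "y \<in> carrier I" "x = s (p x) \<otimes>\<^bsub>M\<^esub> i y"
      using same_fibre[of "s (p x)" x] x by auto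
    then show "x \<in> realise ` carrier (Std \<tau> g)"
      using x by (intro image_eqI[of _ _ "(p x, y)"]) (auto simp: realise_def)
  qed (auto simp: realise_def)
qed

lemma realise_hom: "realise \<in> rb_hom (Std \<tau> g) M"
proof (rule rb_homI)
  note [simp] = section_dataD(1-5)
  fix a b assume "a \<in> carrier (Std \<tau> g)" "b \<in> carrier (Std \<tau> g)"
  then obtain h y k z where e: "a = (h, y)" "b = (k, z)"
    and [simp]: "h \<in> carrier H" "y \<in> carrier I" "k \<in> carrier H" "z \<in> carrier I" by auto
  have "realise a \<otimes>\<^bsub>M\<^esub> realise b = s h \<otimes>\<^bsub>M\<^esub> s k \<otimes>\<^bsub>M\<^esub> i (\<mu> k y \<otimes> z)"
    by (simp add: e realise_def mult_i)
  also have "\<dots> = s (h \<otimes>\<^bsub>H\<^esub> k) \<otimes>\<^bsub>M\<^esub> (i (\<tau> (h, k)) \<otimes>\<^bsub>M\<^esub> i (\<mu> k y \<otimes> z))"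
    by (simp add: section_dataD(6) M.m_assoc)
  finally show "realise (a \<otimes>\<^bsub>Std \<tau> g\<^esub> b) = realise a \<otimes>\<^bsub>M\<^esub> realise b"
    by (simp add: e realise_def i_mult[symmetric] I.m_ac)
next
  note [simp] = section_dataD(1-5)
  fix a assume "a \<in> carrier (Std \<tau> g)"
  then show "realise (rb (Std \<tau> g) a) = rb M (realise a)"
    by (auto simp: realise_def rb_i section_dataD(7) i_mult M.m_assoc)
qed (auto simp: realise_def section_dataD)

text \<open>No expansion of the operator equation is needed: the Rota-Baxter identity of the middle
  group is pulled back along the injective map \<open>realise\<close> to (h, \<one>) and (k,
  \<one>), where \<open>rb_Std_iff\<close> turns it into \<open>rb_cocycle\<close>.\<close>

lemma data_factor_set: "factor_set \<tau> g"
  unfolding factor_set_def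
proof (intro conjI ballI)
  show t: "\<tau> \<in> carrier (C2 H I)" "g \<in> carrier (C1 H I)" "cocycle \<tau>"
    using section_dataD data_cocycle by auto
  interpret S: group "Std \<tau> g" using t by (intro group_Std)
  interpret r: group_hom "Std \<tau> g" M realise
    using realise_hom by unfold_locales (simp add: rb_hom_def)
  fix h k assume m: "h \<in> carrier H" "k \<in> carrier H"
  let ?a = "(h, \<one>)" and ?b = "(k, \<one>)"
  have ab: "?a \<in> carrier (Std \<tau> g)" "?b \<in> carrier (Std \<tau> g)" using m by auto
  have rc: "rb (Std \<tau> g) ?a \<in> carrier (Std \<tau> g)" "rb (Std \<tau> g) ?b \<in> carrier (Std \<tau> g)"
    using m by (simp_all add: section_dataD)
  have cc: "rb_circ (Std \<tau> g) ?a ?b \<in> carrier (Std \<tau> g)"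
    unfolding rb_circ_def using ab rc by (intro S.m_closed S.inv_closed)
  have "realise (rb (Std \<tau> g) ?a \<otimes>\<^bsub>Std \<tau> g\<^esub> rb (Std \<tau> g) ?b) = rb M (realise ?a) \<otimes>\<^bsub>M\<^esub> rb M (realise ?b)"
    using ab rc r.hom_mult rb_homD(3)[OF realise_hom] by (simp del: std_simps)
  also have "\<dots> = rb M (rb_circ M (realise ?a) (realise ?b))"
    using ab r.hom_closed by (intro M.rb_mult) (simp_all del: std_simps)
  also have "rb_circ M (realise ?a) (realise ?b) = realise (rb_circ (Std \<tau> g) ?a ?b)"
    unfolding rb_circ_def using ab rc
    by (simp del: std_simps add: rb_homD(3)[OF realise_hom, symmetric])
  also have "rb M \<dots> = realise (rb (Std \<tau> g) (rb_circ (Std \<tau> g) ?a ?b))"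
    using rb_homD(3)[OF realise_hom cc] by simp
  finally have "rb (Std \<tau> g) ?a \<otimes>\<^bsub>Std \<tau> g\<^esub> rb (Std \<tau> g) ?b = rb (Std \<tau> g) (rb_circ (Std \<tau> g) ?a ?b)"
  proof (rule inj_onD[OF bij_betw_imp_inj_on[OF realise_bij]])
    show "rb (Std \<tau> g) (rb_circ (Std \<tau> g) ?a ?b) \<in> carrier (Std \<tau> g)"
      using cc by (cases "rb_circ (Std \<tau> g) ?a ?b") (simp add: section_dataD)
  qed (use rc in \<open>blast intro: S.m_closed\<close>)
  then show "rb_cocycle \<tau> g h k" using rb_Std_iff[OF t m] by simp
qed

lemma data_equiv: "rb_ext_equiv I (std_ext H I \<mu> \<tau> g) \<E>"
  by (rule rb_ext_equivI[OF realise_hom realise_bij]) (auto simp: realise_def section_dataD)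

end

end

lemma (in comm_group) mult_div_cancel:
  assumes "a \<in> carrier G" "b \<in> carrier G"
  shows "a \<otimes> (b \<otimes> inv a) = b"
  using assms by (metis inv_closed inv_solve_right m_assoc m_closed m_comm)

context rb_extension
begin

lemma data_unique:
  assumes d: "section_data \<E> s \<tau> g" and d': "section_data \<E> s' \<tau>' g'"
    and eq: "\<And>h. h \<in> carrier H \<Longrightarrow> s h = s' h"
  shows "\<tau> = \<tau>'" "g = g'"
proof -
  note D = section_dataD[OF d] and D' = section_dataD[OF d']
  have "\<tau> (h, k) = \<tau>' (h, k)" if "h \<in> carrier H" "k \<in> carrier H" for h k
    using that D(6)[of h k] D'(6)[of h k] D(1,4) D'(1,4) by (simp add: eq)
  then show "\<tau> = \<tau>'"
    using C2D(4)[OF D(8)] C2D(4)[OF D'(8)] by (intro extensionalityI) auto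
  have "g h = g' h" if "h \<in> carrier H" for h
    using that D(7)[of h] D'(7)[of h] D(1,5) D'(1,5) by (simp add: eq)
  then show "g = g'"
    using C1D(3)[OF D(9)] C1D(3)[OF D'(9)] by (intro extensionalityI) auto
qed

end

section \<open>The groups of normalised cochains\<close>

lemma mult_C1: "g \<otimes>\<^bsub>C1 H I\<^esub> g' = (\<lambda>h\<in>carrier H. g h \<otimes>\<^bsub>I\<^esub> g' h)"
  and one_C1: "\<one>\<^bsub>C1 H I\<^esub> = (\<lambda>h\<in>carrier H. \<one>\<^bsub>I\<^esub>)"
  by (simp_all add: C1_def)

lemma mult_C2: "\<tau> \<otimes>\<^bsub>C2 H I\<^esub> \<tau>' = (\<lambda>x\<in>carrier H \<times> carrier H. \<tau> x \<otimes>\<^bsub>I\<^esub> \<tau>' x)"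
  and one_C2: "\<one>\<^bsub>C2 H I\<^esub> = (\<lambda>x\<in>carrier H \<times> carrier H. \<one>\<^bsub>I\<^esub>)"
  by (simp_all add: C2_def)

lemma C1I: "\<lbrakk>\<And>h. h \<in> carrier H \<Longrightarrow> f h \<in> carrier I; \<one>\<^bsub>H\<^esub> \<in> carrier H; f \<one>\<^bsub>H\<^esub> = \<one>\<^bsub>I\<^esub>\<rbrakk> \<Longrightarrow>
    (\<lambda>h\<in>carrier H. f h) \<in> carrier (C1 H I)"
  by (auto simp: C1_def)

lemma C1_eqI: "\<lbrakk>f \<in> carrier (C1 H I); g \<in> carrier (C1 H I); \<And>h. h \<in> carrier H \<Longrightarrow> f h = g h\<rbrakk> \<Longrightarrow> f = g"
  by (metis C1D(3) extensionalityI)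

context rb_mod
begin

lemma delta1_closed: "\<theta> \<in> carrier (C1 H I) \<Longrightarrow> delta1 H I \<mu> \<theta> \<in> carrier (C2 H I)"
  by (auto simp: delta1_def C2_def C1D)

lemma Phi1_closed: "\<theta> \<in> carrier (C1 H I) \<Longrightarrow> Phi1 H I \<mu> \<theta> \<in> carrier (C1 H I)"
  by (auto simp: Phi1_def C1D intro!: C1I)

lemma neg_closed: "g \<in> carrier (C1 H I) \<Longrightarrow> cochain_neg H I g \<in> carrier (C1 H I)"
  by (auto simp: cochain_neg_def C1D intro!: C1I)

lemma neg_neg: "g \<in> carrier (C1 H I) \<Longrightarrow> cochain_neg H I (cochain_neg H I g) = g"
  by (intro C1_eqI[of _ H I] neg_closed) (auto simp: cochain_neg_def C1D)

lemma C1_comm_group: "comm_group (C1 H I)"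
proof (rule comm_groupI)
  fix x assume x: "x \<in> carrier (C1 H I)"
  then have "cochain_neg H I x \<otimes>\<^bsub>C1 H I\<^esub> x = \<one>\<^bsub>C1 H I\<^esub>"
    by (auto simp: mult_C1 one_C1 cochain_neg_def C1D)
  then show "\<exists>y\<in>carrier (C1 H I). y \<otimes>\<^bsub>C1 H I\<^esub> x = \<one>\<^bsub>C1 H I\<^esub>" using x neg_closed by blast
  have "\<one>\<^bsub>C1 H I\<^esub> \<otimes>\<^bsub>C1 H I\<^esub> x = (\<lambda>h\<in>carrier H. x h)"
    using x by (auto simp: mult_C1 one_C1 C1D)
  then show "\<one>\<^bsub>C1 H I\<^esub> \<otimes>\<^bsub>C1 H I\<^esub> x = x" using x by (simp add: C1D extensional_restrict)
qed (auto simp: mult_C1 one_C1 C1D I.m_assoc intro!: C1I restrict_ext intro: I.m_comm)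

lemma C2I: "\<lbrakk>\<And>h k. h \<in> carrier H \<Longrightarrow> k \<in> carrier H \<Longrightarrow> f (h, k) \<in> carrier I;
    \<And>h. h \<in> carrier H \<Longrightarrow> f (h, \<one>\<^bsub>H\<^esub>) = \<one>; \<And>h. h \<in> carrier H \<Longrightarrow> f (\<one>\<^bsub>H\<^esub>, h) = \<one>\<rbrakk> \<Longrightarrow>
    (\<lambda>x\<in>carrier H \<times> carrier H. f x) \<in> carrier (C2 H I)"
  by (auto simp: C2_def)

lemma C2_comm_group: "comm_group (C2 H I)"
proof (rule comm_groupI)
  fix x assume x: "x \<in> carrier (C2 H I)"
  let ?y = "\<lambda>a\<in>carrier H \<times> carrier H. inv (x a)"
  have "?y \<in> carrier (C2 H I)" using x by (auto simp: C2D intro!: C2I)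
  moreover have "?y \<otimes>\<^bsub>C2 H I\<^esub> x = \<one>\<^bsub>C2 H I\<^esub>"
    using x by (auto simp: mult_C2 one_C2 C2D)
  ultimately show "\<exists>y\<in>carrier (C2 H I). y \<otimes>\<^bsub>C2 H I\<^esub> x = \<one>\<^bsub>C2 H I\<^esub>" by blast
  have "\<one>\<^bsub>C2 H I\<^esub> \<otimes>\<^bsub>C2 H I\<^esub> x = (\<lambda>h\<in>carrier H \<times> carrier H. x h)"
    using x by (auto simp: mult_C2 one_C2 C2D)
  then show "\<one>\<^bsub>C2 H I\<^esub> \<otimes>\<^bsub>C2 H I\<^esub> x = x" using x by (simp add: C2D extensional_restrict)
qed (auto simp: mult_C2 one_C2 C2D I.m_assoc intro!: C2I restrict_ext intro: I.m_comm)

sublocale C1: comm_group "C1 H I" by (rule C1_comm_group)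
sublocale C2: comm_group "C2 H I" by (rule C2_comm_group)

lemma extension_std: "factor_set \<tau> g \<Longrightarrow> rb_extension H I \<mu> (std_ext H I \<mu> \<tau> g)"
proof -
  assume f: "factor_set \<tau> g"
  note e = std_is_extension[OF f]
  have "\<tau> \<in> carrier (C2 H I)" using f by (simp add: factor_set_def)
  then have "has_action H I \<mu> (std_ext H I \<mu> \<tau> g)"
    by (intro has_actionI[OF e]) (auto simp: C2D I.m_comm)
  then show ?thesis using e by unfold_locales
qed

lemma data_std:
  assumes "factor_set \<tau> g" shows "section_data (std_ext H I \<mu> \<tau> g) (\<lambda>h. (h, \<one>)) \<tau> g"
  using assms by (auto simp: section_data_def factor_set_def st_section_def C1D C2D)

end

section \<open>Change of section, and comparison of extensions by their factor sets\<close>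

context rb_extension
begin

lemma data_change:
  assumes d: "section_data \<E> s \<tau> g" and \<theta>: "\<theta> \<in> carrier (C1 H I)"
  shows "section_data \<E> (\<lambda>h. s h \<otimes>\<^bsub>M\<^esub> i (\<theta> h)) (\<tau> \<otimes>\<^bsub>C2 H I\<^esub> delta1 H I \<mu> \<theta>) (g \<otimes>\<^bsub>C1 H I\<^esub> Phi1 H I \<mu> \<theta>)"
proof -
  note D = section_dataD[OF d] and t = C1D(1,2)[OF \<theta>]
  note [simp] = D(1-5) t
  have 1: "s h \<otimes>\<^bsub>M\<^esub> i (\<theta> h) \<otimes>\<^bsub>M\<^esub> (s k \<otimes>\<^bsub>M\<^esub> i (\<theta> k)) = s (h \<otimes>\<^bsub>H\<^esub> k) \<otimes>\<^bsub>M\<^esub> i (\<theta> (h \<otimes>\<^bsub>H\<^esub> k)) \<otimes>\<^bsub>M\<^esub>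
      i ((\<tau> \<otimes>\<^bsub>C2 H I\<^esub> delta1 H I \<mu> \<theta>) (h, k))" if m: "h \<in> carrier H" "k \<in> carrier H" for h k
  proof -
    note [simp] = m
    have "s h \<otimes>\<^bsub>M\<^esub> i (\<theta> h) \<otimes>\<^bsub>M\<^esub> (s k \<otimes>\<^bsub>M\<^esub> i (\<theta> k)) = s h \<otimes>\<^bsub>M\<^esub> s k \<otimes>\<^bsub>M\<^esub> i (\<mu> k (\<theta> h) \<otimes> \<theta> k)"
      by (simp add: mult_i)
    also have "\<dots> = s (h \<otimes>\<^bsub>H\<^esub> k) \<otimes>\<^bsub>M\<^esub> i (\<tau> (h, k) \<otimes> (\<mu> k (\<theta> h) \<otimes> \<theta> k))"
      by (simp add: D(6) M.m_assoc i_mult)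
    \<comment> \<open>The value of \<theta> at the product is inserted together with its inverse:
      the first belongs to the new section at the product, the second completes
      \<open>delta1\<close>.\<close>
    also have "\<tau> (h, k) \<otimes> (\<mu> k (\<theta> h) \<otimes> \<theta> k) = \<theta> (h \<otimes>\<^bsub>H\<^esub> k) \<otimes>
        (\<tau> (h, k) \<otimes> (\<theta> k \<otimes> inv (\<theta> (h \<otimes>\<^bsub>H\<^esub> k)) \<otimes> \<mu> k (\<theta> h)))"
      using I.mult_div_cancel[of "\<theta> (h \<otimes>\<^bsub>H\<^esub> k)" "\<tau> (h, k) \<otimes> (\<mu> k (\<theta> h) \<otimes> \<theta> k)"]
      by (simp add: I.m_ac)
    finally show ?thesis by (simp add: mult_C2 delta1_def i_mult M.m_assoc)
  qed
  have 2: "rb M (s h \<otimes>\<^bsub>M\<^esub> i (\<theta> h)) = s (rb H h) \<otimes>\<^bsub>M\<^esub> i (\<theta> (rb H h)) \<otimes>\<^bsub>M\<^esub>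
      i ((g \<otimes>\<^bsub>C1 H I\<^esub> Phi1 H I \<mu> \<theta>) h)" if m: "h \<in> carrier H" for h
  proof -
    note [simp] = m
    have "rb M (s h \<otimes>\<^bsub>M\<^esub> i (\<theta> h)) = s (rb H h) \<otimes>\<^bsub>M\<^esub> i (g h \<otimes> rb I (\<mu> (rb H h) (\<theta> h)))"
      by (simp add: rb_i D(7) M.m_assoc i_mult)
    \<comment> \<open>The same insertion with \<theta> at R h: one factor goes to the new section at
      R h, its inverse completes \<open>Phi1\<close>.\<close>
    also have "g h \<otimes> rb I (\<mu> (rb H h) (\<theta> h)) =
        \<theta> (rb H h) \<otimes> (g h \<otimes> (rb I (\<mu> (rb H h) (\<theta> h)) \<otimes> inv (\<theta> (rb H h))))"
      using I.mult_div_cancel[of "\<theta> (rb H h)" "g h \<otimes> rb I (\<mu> (rb H h) (\<theta> h))"]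
      by (simp add: I.m_assoc)
    finally show ?thesis by (simp add: mult_C1 Phi1_def i_mult M.m_assoc)
  qed
  have "st_section H \<E> (\<lambda>h. s h \<otimes>\<^bsub>M\<^esub> i (\<theta> h))"
    by (auto simp: st_section_def D(3))
  then show ?thesis
    unfolding section_data_def
    using 1 2 C2.m_closed[OF D(8) delta1_closed[OF \<theta>]] C1.m_closed[OF D(9) Phi1_closed[OF \<theta>]] by blast
qed

text \<open>The cochain \<theta> is the quotient of the two sections. \<open>data_change\<close>
  computes a factor set for s \<theta>, and uniqueness identifies it with the given one.\<close>

lemma data_compare:
  assumes d: "section_data \<E> s \<tau> g" and d': "section_data \<E> s' \<tau>' g'"
  obtains \<theta> where "\<theta> \<in> carrier (C1 H I)" "\<tau>' = \<tau> \<otimes>\<^bsub>C2 H I\<^esub> delta1 H I \<mu> \<theta>"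
    "g' = g \<otimes>\<^bsub>C1 H I\<^esub> Phi1 H I \<mu> \<theta>"
proof -
  note D = section_dataD[OF d] and D' = section_dataD[OF d']
  have "\<exists>y\<in>carrier I. s' h = s h \<otimes>\<^bsub>M\<^esub> i y" if "h \<in> carrier H" for h
    using same_fibre[of "s h" "s' h"] D(1,2) D'(1,2) that by metis
  then obtain t where t: "\<And>h. h \<in> carrier H \<Longrightarrow> t h \<in> carrier I \<and> s' h = s h \<otimes>\<^bsub>M\<^esub> i (t h)"
    by metis
  have "i (t \<one>\<^bsub>H\<^esub>) = i \<one>" using t[of "\<one>\<^bsub>H\<^esub>"] D(3) D'(3) by (metis H.one_closed M.l_one i_closed i_one)
  then have "t \<one>\<^bsub>H\<^esub> = \<one>" using t[of "\<one>\<^bsub>H\<^esub>"] i_eq_iff[of "t \<one>\<^bsub>H\<^esub>" \<one>] by simp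
  then have \<theta>: "restrict t (carrier H) \<in> carrier (C1 H I)" using t by (intro C1I) auto
  show thesis
    using data_unique[OF d' data_change[OF d \<theta>]] t \<theta> by (intro that[of "restrict t (carrier H)"]) auto
qed

text \<open>An equivalence fixes I, so it carries a section to a section with unchanged correction
  terms.\<close>

lemma data_transport:
  assumes d: "section_data \<E> s \<tau> g" and e: "rb_ext_equiv I \<E> Y" and Y: "is_rb_extension H I Y"
  obtains s' where "section_data Y s' \<tau> g"
proof -
  obtain \<gamma> where a: "\<gamma> \<in> rb_hom M (mid Y)" "bij_betw \<gamma> (carrier M) (carrier (mid Y))"
    and b: "\<And>y. y \<in> carrier I \<Longrightarrow> \<gamma> (i y) = incl Y y"
    and c: "\<And>x. x \<in> carrier M \<Longrightarrow> prj Y (\<gamma> x) = p x"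
    using rb_ext_equivE[OF e] by blast
  note D = section_dataD[OF d] and h = rb_homD[OF a(1)]
  note [simp] = D(1-5)
  interpret Y: rota_baxter_group "mid Y" using Y by (simp add: is_rb_extension_def)
  have "group_hom M (mid Y) \<gamma>" using a(1) by unfold_locales (simp add: rb_hom_def)
  then have "\<gamma> \<one>\<^bsub>M\<^esub> = \<one>\<^bsub>mid Y\<^esub>" by (rule group_hom.hom_one)
  then have "st_section H Y (\<gamma> \<circ> s)" by (auto simp: st_section_def h c D(3))
  moreover have "\<gamma> (s x) \<otimes>\<^bsub>mid Y\<^esub> \<gamma> (s k) = \<gamma> (s (x \<otimes>\<^bsub>H\<^esub> k)) \<otimes>\<^bsub>mid Y\<^esub> incl Y (\<tau> (x, k))"
    if "x \<in> carrier H" "k \<in> carrier H" for x k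
    using that by (simp add: b[symmetric] h(2)[symmetric] D(6))
  moreover have "rb (mid Y) (\<gamma> (s x)) = \<gamma> (s (rb H x)) \<otimes>\<^bsub>mid Y\<^esub> incl Y (g x)" if "x \<in> carrier H" for x
    using that by (simp add: b[symmetric] h(2,3)[symmetric] D(7))
  ultimately have "section_data Y (\<gamma> \<circ> s) \<tau> g" using D(8,9) by (simp add: section_data_def)
  then show thesis by (rule that)
qed

end

context rb_mod
begin

text \<open>Forwards, the canonical section of the first extension is transported into the second
  and compared with the canonical one there. Backwards, shifting the canonical section of the first
  by \<theta> gives it the factor set of the second, and \<open>data_equiv\<close> applies.\<close>

lemma std_equiv_iff:
  assumes f: "factor_set \<tau> g" and f': "factor_set \<tau>' g'"
  shows "rb_ext_equiv I (std_ext H I \<mu> \<tau> g) (std_ext H I \<mu> \<tau>' g') \<longleftrightarrow>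
    (\<exists>\<theta>\<in>carrier (C1 H I). \<tau>' = \<tau> \<otimes>\<^bsub>C2 H I\<^esub> delta1 H I \<mu> \<theta> \<and> g' = g \<otimes>\<^bsub>C1 H I\<^esub> Phi1 H I \<mu> \<theta>)"
proof -
  interpret E: rb_extension H I \<mu> "std_ext H I \<mu> \<tau> g" using f by (rule extension_std)
  interpret E': rb_extension H I \<mu> "std_ext H I \<mu> \<tau>' g'" using f' by (rule extension_std)
  show ?thesis
  proof (intro iffI; (elim bexE conjE)?)
    assume "rb_ext_equiv I (std_ext H I \<mu> \<tau> g) (std_ext H I \<mu> \<tau>' g')"
    from E.data_transport[OF data_std[OF f] this E'.ext] obtain s'
      where s': "section_data (std_ext H I \<mu> \<tau>' g') s' \<tau> g" .
    from E'.data_compare[OF this data_std[OF f']]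
    show "\<exists>\<theta>\<in>carrier (C1 H I). \<tau>' = \<tau> \<otimes>\<^bsub>C2 H I\<^esub> delta1 H I \<mu> \<theta> \<and> g' = g \<otimes>\<^bsub>C1 H I\<^esub> Phi1 H I \<mu> \<theta>"
      by metis
  next
    fix \<theta> assume "\<theta> \<in> carrier (C1 H I)" "\<tau>' = \<tau> \<otimes>\<^bsub>C2 H I\<^esub> delta1 H I \<mu> \<theta>" "g' = g \<otimes>\<^bsub>C1 H I\<^esub> Phi1 H I \<mu> \<theta>"
    with E.data_change[OF data_std[OF f], of \<theta>]
    have "rb_ext_equiv I (std_ext H I \<mu> \<tau>' g') (std_ext H I \<mu> \<tau> g)"
      using E.data_equiv by simp
    then show "rb_ext_equiv I (std_ext H I \<mu> \<tau> g) (std_ext H I \<mu> \<tau>' g')"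
      by (rule rb_ext_equiv_sym[OF E'.ext])
  qed
qed

end

section \<open>Cocycles, coboundaries and cohomology classes\<close>

lemma (in comm_group) div_eq_one_iff:
  "\<lbrakk>x \<in> carrier G; y \<in> carrier G\<rbrakk> \<Longrightarrow> x \<otimes> inv y = \<one> \<longleftrightarrow> x = y"
  using inv_solve_right'[of \<one> x y] by simp

context rb_mod
begin

lemma neg_mult: "\<lbrakk>g \<in> carrier (C1 H I); g' \<in> carrier (C1 H I)\<rbrakk> \<Longrightarrow>
    cochain_neg H I (g \<otimes>\<^bsub>C1 H I\<^esub> g') = cochain_neg H I g \<otimes>\<^bsub>C1 H I\<^esub> cochain_neg H I g'"
  by (auto simp: cochain_neg_def mult_C1 C1D I.inv_mult)

lemma neg_one: "cochain_neg H I \<one>\<^bsub>C1 H I\<^esub> = \<one>\<^bsub>C1 H I\<^esub>"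
  by (auto simp: cochain_neg_def one_C1)

text \<open>Oddness of the operator term in g, which lets the sign change made by
  \<open>cochain_neg\<close> pass through it.\<close>

lemma neg_Phi2_term:
  assumes "h \<in> carrier H" "k \<in> carrier H" "y \<in> carrier I"
  shows "rb I (\<mu> (rb H k) (\<mu> k (inv y) \<otimes> inv (inv y))) = inv (rb I (\<mu> (rb H k) (\<mu> k y \<otimes> inv y)))"
  using assms by (simp add: mu_mult mu_inv I_rb_mult I_rb_inv I.inv_mult)

text \<open>The bridge between the two sign conventions: below it, cocycles are handled as factor
  sets with g inverted.\<close>

lemma Z2_iff:
  "(\<tau>, g) \<in> carrier (Z2_RBE H I \<mu>) \<longleftrightarrow> g \<in> carrier (C1 H I) \<and> factor_set \<tau> (cochain_neg H I g)"
proof (cases "\<tau> \<in> carrier (C2 H I) \<and> g \<in> carrier (C1 H I)")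
  case True
  then have \<tau>: "\<tau> \<in> carrier (C2 H I)" and g: "g \<in> carrier (C1 H I)" by auto
  have 1: "\<tau> (h1, h2 \<otimes>\<^bsub>H\<^esub> h3) \<otimes> \<tau> (h2, h3) \<otimes> inv (\<tau> (h1 \<otimes>\<^bsub>H\<^esub> h2, h3)) \<otimes> inv (\<mu> h3 (\<tau> (h1, h2))) = \<one>
      \<longleftrightarrow> \<tau> (h1, h2 \<otimes>\<^bsub>H\<^esub> h3) \<otimes> \<tau> (h2, h3) = \<tau> (h1 \<otimes>\<^bsub>H\<^esub> h2, h3) \<otimes> \<mu> h3 (\<tau> (h1, h2))"
    if "h1 \<in> carrier H" "h2 \<in> carrier H" "h3 \<in> carrier H" for h1 h2 h3
    using that \<tau> I.div_eq_one_iff[of "\<tau> (h1, h2 \<otimes>\<^bsub>H\<^esub> h3) \<otimes> \<tau> (h2, h3)"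
      "\<tau> (h1 \<otimes>\<^bsub>H\<^esub> h2, h3) \<otimes> \<mu> h3 (\<tau> (h1, h2))"]
    by (simp add: C2D I.inv_mult I.m_assoc)
  have 2: "partial1 H I \<mu> g (h, k) \<otimes> inv (rb I (\<mu> (rb H k) (\<mu> k (g h) \<otimes> inv (g h))))
          \<otimes> inv (Phi2 H I \<mu> \<tau> (h, k)) = \<one> \<longleftrightarrow> rb_cocycle \<tau> (cochain_neg H I g) h k"
    if m: "h \<in> carrier H" "k \<in> carrier H" for h k
  proof -
    define u where "u = rb I (\<mu> (rb H k) (\<mu> k (g h) \<otimes> inv (g h)))"
    define T where "T = rb I (\<mu> (rb H (rb_circ H h k)) (Phi2_arg \<tau> h k))"
    define m' where "m' = \<mu> (rb H k) (g h)"
    define t where "t = \<tau> (rb H h, rb H k)"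
    define c where "c = g (rb_circ H h k)"
    have cl: "u \<in> carrier I" "T \<in> carrier I" "m' \<in> carrier I" "t \<in> carrier I" "c \<in> carrier I"
      "g k \<in> carrier I"
      unfolding u_def T_def m'_def t_def c_def using m \<tau> g by (simp_all add: C1D C2D)
    have "partial1 H I \<mu> g (h, k) = g k \<otimes> inv c \<otimes> m'"
      using m by (simp add: partial1_def c_def m'_def)
    moreover have "Phi2 H I \<mu> \<tau> (h, k) = t \<otimes> inv T"
      using m by (simp add: Phi2_def t_def T_def Phi2_arg_def Let_def)
    moreover have "rb_cocycle \<tau> (cochain_neg H I g) h k \<longleftrightarrow> inv m' \<otimes> inv (g k) \<otimes> t = inv c \<otimes> inv u \<otimes> T"
      using m g neg_Phi2_term[of h k "g h"]
      by (simp add: rb_cocycle_def cochain_neg_def C1D mu_inv m'_def t_def c_def u_def T_def)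
    \<comment> \<open>The expression required to vanish in \<open>Z2_RBE\<close> is the right side
      of \<open>rb_cocycle\<close> for the inverted g divided by its left side.\<close>
    moreover have "g k \<otimes> inv c \<otimes> m' \<otimes> inv u \<otimes> inv (t \<otimes> inv T) =
        (inv c \<otimes> inv u \<otimes> T) \<otimes> inv (inv m' \<otimes> inv (g k) \<otimes> t)"
      using cl by (simp add: I.inv_mult I.m_ac)
    ultimately show ?thesis
      using cl I.div_eq_one_iff[of "inv c \<otimes> inv u \<otimes> T" "inv m' \<otimes> inv (g k) \<otimes> t"]
      by (auto simp: u_def[symmetric])
  qed
  show ?thesis
    using \<tau> g by (simp add: Z2_RBE_def factor_set_def neg_closed cocycle_def 1 2)
qed (auto simp: Z2_RBE_def factor_set_def)

lemma Phi2_arg_mult: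
  assumes "\<tau> \<in> carrier (C2 H I)" "\<tau>' \<in> carrier (C2 H I)" "h \<in> carrier H" "k \<in> carrier H"
  shows "Phi2_arg (\<tau> \<otimes>\<^bsub>C2 H I\<^esub> \<tau>') h k = Phi2_arg \<tau> h k \<otimes> Phi2_arg \<tau>' h k"
  using assms by (simp add: Phi2_arg_def Let_def mult_C2 C2D mu_mult I.inv_mult I.m_ac)

text \<open>Both sides of the condition are multiplicative in (\<tau>, g), so a factor that
  satisfies it cancels. As an equivalence this yields closure under inverses as well as under
  products.\<close>

lemma rb_cocycle_mult:
  assumes \<tau>: "\<tau> \<in> carrier (C2 H I)" "\<tau>' \<in> carrier (C2 H I)"
    and g: "g \<in> carrier (C1 H I)" "g' \<in> carrier (C1 H I)" and m: "h \<in> carrier H" "k \<in> carrier H"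
    and c: "rb_cocycle \<tau> g h k"
  shows "rb_cocycle (\<tau> \<otimes>\<^bsub>C2 H I\<^esub> \<tau>') (g \<otimes>\<^bsub>C1 H I\<^esub> g') h k \<longleftrightarrow> rb_cocycle \<tau>' g' h k"
proof -
  let ?L = "\<lambda>\<tau> g. \<mu> (rb H k) (g h) \<otimes> g k \<otimes> \<tau> (rb H h, rb H k)"
  let ?R = "\<lambda>\<tau> g. g (rb_circ H h k) \<otimes> rb I (\<mu> (rb H k) (\<mu> k (g h) \<otimes> inv (g h))) \<otimes>
       rb I (\<mu> (rb H (rb_circ H h k)) (Phi2_arg \<tau> h k))"
  have cl: "?L \<tau> g \<in> carrier I" "?R \<tau> g \<in> carrier I" "?L \<tau>' g' \<in> carrier I" "?R \<tau>' g' \<in> carrier I"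
    using \<tau> g m by (simp_all add: C1D C2D)
  have L: "?L (\<tau> \<otimes>\<^bsub>C2 H I\<^esub> \<tau>') (g \<otimes>\<^bsub>C1 H I\<^esub> g') = ?L \<tau> g \<otimes> ?L \<tau>' g'"
    using \<tau> g m by (simp add: mult_C1 mult_C2 C1D C2D mu_mult I.m_ac)
  have R: "?R (\<tau> \<otimes>\<^bsub>C2 H I\<^esub> \<tau>') (g \<otimes>\<^bsub>C1 H I\<^esub> g') = ?R \<tau> g \<otimes> ?R \<tau>' g'"
    using \<tau> g m
    by (simp add: Phi2_arg_mult mult_C1 C1D C2D mu_mult mu_inv I_rb_mult I_rb_inv I.inv_mult I.m_ac)
  have "?L \<tau> g = ?R \<tau> g" using c by (simp add: rb_cocycle_def)
  then show ?thesis
    unfolding rb_cocycle_def L R using cl by simp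
qed

lemma cocycle_mult:
  assumes \<tau>: "\<tau> \<in> carrier (C2 H I)" "\<tau>' \<in> carrier (C2 H I)" and c: "cocycle \<tau>"
  shows "cocycle (\<tau> \<otimes>\<^bsub>C2 H I\<^esub> \<tau>') \<longleftrightarrow> cocycle \<tau>'"
  unfolding cocycle_def
proof (intro ball_cong refl)
  fix h1 h2 h3 assume m: "h1 \<in> carrier H" "h2 \<in> carrier H" "h3 \<in> carrier H"
  let ?L = "\<lambda>\<tau>. \<tau> (h1, h2 \<otimes>\<^bsub>H\<^esub> h3) \<otimes> \<tau> (h2, h3)"
  let ?R = "\<lambda>\<tau>. \<tau> (h1 \<otimes>\<^bsub>H\<^esub> h2, h3) \<otimes> \<mu> h3 (\<tau> (h1, h2))"
  have cl: "?L \<tau> \<in> carrier I" "?R \<tau> \<in> carrier I" "?L \<tau>' \<in> carrier I" "?R \<tau>' \<in> carrier I"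
    using \<tau> m by (simp_all add: C2D)
  have L: "?L (\<tau> \<otimes>\<^bsub>C2 H I\<^esub> \<tau>') = ?L \<tau> \<otimes> ?L \<tau>'"
    using \<tau> m by (simp add: mult_C2 C2D I.m_ac)
  have R: "?R (\<tau> \<otimes>\<^bsub>C2 H I\<^esub> \<tau>') = ?R \<tau> \<otimes> ?R \<tau>'"
    using \<tau> m by (simp add: mult_C2 C2D mu_mult I.m_ac)
  have "?L \<tau> = ?R \<tau>" using c m by (simp add: cocycle_def)
  then show "(?L (\<tau> \<otimes>\<^bsub>C2 H I\<^esub> \<tau>') = ?R (\<tau> \<otimes>\<^bsub>C2 H I\<^esub> \<tau>')) = (?L \<tau>' = ?R \<tau>')"
    unfolding L R using cl by simp
qed

lemma factor_set_mult:
  assumes "factor_set \<tau> g" "\<tau>' \<in> carrier (C2 H I)" "g' \<in> carrier (C1 H I)"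
  shows "factor_set (\<tau> \<otimes>\<^bsub>C2 H I\<^esub> \<tau>') (g \<otimes>\<^bsub>C1 H I\<^esub> g') \<longleftrightarrow> factor_set \<tau>' g'"
  using assms by (auto simp: factor_set_def rb_cocycle_mult cocycle_mult)

lemma factor_set_one: "factor_set \<one>\<^bsub>C2 H I\<^esub> \<one>\<^bsub>C1 H I\<^esub>"
  by (auto simp: factor_set_def cocycle_def rb_cocycle_def one_C1 one_C2 Phi2_arg_def Let_def C1_def C2_def)

lemma Z2_comm_group: "comm_group (Z2_RBE H I \<mu>)"
proof -
  let ?K = "C2 H I \<times>\<times> C1 H I" and ?Z = "carrier (Z2_RBE H I \<mu>)"
  interpret K: group ?K by (rule DirProd_group) unfold_locales
  have eq: "Z2_RBE H I \<mu> = ?K\<lparr>carrier := ?Z\<rparr>"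
    by (simp add: Z2_RBE_def)
  have sub: "?Z \<subseteq> carrier ?K" by (auto simp: Z2_RBE_def)
  have "subgroup ?Z ?K"
  proof (rule K.subgroupI[OF sub])
    show "?Z \<noteq> {}" using factor_set_one Z2_iff[of "\<one>\<^bsub>C2 H I\<^esub>" "\<one>\<^bsub>C1 H I\<^esub>"] by (auto simp: neg_one)
  next
    fix z assume z: "z \<in> ?Z"
    obtain \<tau> g where e: "z = (\<tau>, g)" by force
    have m: "\<tau> \<in> carrier (C2 H I)" "g \<in> carrier (C1 H I)" "factor_set \<tau> (cochain_neg H I g)"
      using z by (auto simp: e Z2_iff factor_set_def)
    have "cochain_neg H I g \<otimes>\<^bsub>C1 H I\<^esub> cochain_neg H I (inv\<^bsub>C1 H I\<^esub> g) = \<one>\<^bsub>C1 H I\<^esub>"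
      using m by (simp add: neg_mult[symmetric] neg_one)
    \<comment> \<open>The product of the given factor set and this pair is the trivial factor set,
      so \<open>factor_set_mult\<close>, read from left to right, applies.\<close>
    then have "factor_set (inv\<^bsub>C2 H I\<^esub> \<tau>) (cochain_neg H I (inv\<^bsub>C1 H I\<^esub> g))"
      using factor_set_mult[OF m(3), of "inv\<^bsub>C2 H I\<^esub> \<tau>" "cochain_neg H I (inv\<^bsub>C1 H I\<^esub> g)"] m factor_set_one
      by (simp add: neg_closed)
    then show "inv\<^bsub>?K\<^esub> z \<in> ?Z"
      using m by (simp add: e Z2_iff inv_DirProd[OF C2.is_group C1.is_group])
  next
    fix z w assume z: "z \<in> ?Z" and w: "w \<in> ?Z"
    then show "z \<otimes>\<^bsub>?K\<^esub> w \<in> ?Z"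
    proof (cases z, cases w)
      fix \<tau> g \<tau>' g' assume e: "z = (\<tau>, g)" "w = (\<tau>', g')"
      then have f: "factor_set \<tau> (cochain_neg H I g)" "factor_set \<tau>' (cochain_neg H I g')"
        and g: "g \<in> carrier (C1 H I)" "g' \<in> carrier (C1 H I)"
        using z w by (auto simp: Z2_iff)
      moreover have "\<tau>' \<in> carrier (C2 H I)" using f(2) by (simp add: factor_set_def)
      ultimately show ?thesis by (simp add: e Z2_iff neg_mult factor_set_mult neg_closed)
    qed
  qed
  then have "group (Z2_RBE H I \<mu>)" by (subst eq) (rule K.subgroup_imp_group)
  moreover have "x \<otimes>\<^bsub>Z2_RBE H I \<mu>\<^esub> y = y \<otimes>\<^bsub>Z2_RBE H I \<mu>\<^esub> x" if "x \<in> ?Z" "y \<in> ?Z" for x y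
    using that sub by (cases x, cases y) (auto simp: Z2_RBE_def C1.m_comm C2.m_comm)
  ultimately show ?thesis by (rule group.group_comm_groupI)
qed

section \<open>Coboundaries and the quotient group\<close>

sublocale Z2: comm_group "Z2_RBE H I \<mu>" by (rule Z2_comm_group)

abbreviation (input) "Z \<equiv> Z2_RBE H I \<mu>"
abbreviation (input) "B \<equiv> B2_RBE H I \<mu>"

lemma Z2D: "z \<in> carrier Z \<Longrightarrow> fst z \<in> carrier (C2 H I)"
    "z \<in> carrier Z \<Longrightarrow> snd z \<in> carrier (C1 H I)"
    "z \<in> carrier Z \<Longrightarrow> factor_set (fst z) (cochain_neg H I (snd z))"
  by (cases z; auto simp: Z2_iff factor_set_def)+

lemma Z2_mult: "z \<otimes>\<^bsub>Z\<^esub> w = (fst z \<otimes>\<^bsub>C2 H I\<^esub> fst w, snd z \<otimes>\<^bsub>C1 H I\<^esub> snd w)"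
  by (cases z, cases w) (simp add: Z2_RBE_def)

lemma delta1_mult: "\<lbrakk>\<theta> \<in> carrier (C1 H I); \<theta>' \<in> carrier (C1 H I)\<rbrakk> \<Longrightarrow>
    delta1 H I \<mu> (\<theta> \<otimes>\<^bsub>C1 H I\<^esub> \<theta>') = delta1 H I \<mu> \<theta> \<otimes>\<^bsub>C2 H I\<^esub> delta1 H I \<mu> \<theta>'"
  by (auto simp: delta1_def mult_C1 mult_C2 C1D mu_mult I.inv_mult I.m_ac)

lemma Phi1_mult: "\<lbrakk>\<theta> \<in> carrier (C1 H I); \<theta>' \<in> carrier (C1 H I)\<rbrakk> \<Longrightarrow>
    Phi1 H I \<mu> (\<theta> \<otimes>\<^bsub>C1 H I\<^esub> \<theta>') = Phi1 H I \<mu> \<theta> \<otimes>\<^bsub>C1 H I\<^esub> Phi1 H I \<mu> \<theta>'"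
  by (auto simp: Phi1_def mult_C1 C1D mu_mult I_rb_mult I.inv_mult I.m_ac)

definition cob where "cob \<theta> = (delta1 H I \<mu> \<theta>, cochain_neg H I (Phi1 H I \<mu> \<theta>))"

lemma B2_eq: "B = cob ` carrier (C1 H I)"
  by (simp add: B2_RBE_def cob_def)

text \<open>In the split extension, with trivial \<tau> and g, the section h \<mapsto> (h, \<theta>
  h) has factor set (\<open>delta1\<close>, \<open>Phi1\<close>) of \<theta>; factor sets of
  sections satisfy the cocycle equations.\<close>

lemma cob_closed: assumes \<theta>: "\<theta> \<in> carrier (C1 H I)" shows "cob \<theta> \<in> carrier Z"
proof -
  interpret E: rb_extension H I \<mu> "std_ext H I \<mu> \<one>\<^bsub>C2 H I\<^esub> \<one>\<^bsub>C1 H I\<^esub>"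
    by (rule extension_std[OF factor_set_one])
  show ?thesis
    using E.data_factor_set[OF E.data_change[OF data_std[OF factor_set_one] \<theta>]] \<theta>
    by (simp add: cob_def Z2_iff neg_neg neg_closed Phi1_closed delta1_closed)
qed

lemma cob_mult: "\<lbrakk>\<theta> \<in> carrier (C1 H I); \<theta>' \<in> carrier (C1 H I)\<rbrakk> \<Longrightarrow>
    cob (\<theta> \<otimes>\<^bsub>C1 H I\<^esub> \<theta>') = cob \<theta> \<otimes>\<^bsub>Z\<^esub> cob \<theta>'"
  by (simp add: cob_def Z2_mult delta1_mult Phi1_mult neg_mult Phi1_closed)

lemma B2_subgroup: "subgroup B Z"
proof -
  interpret group_hom "C1 H I" Z cob
    by unfold_locales (auto simp: hom_def cob_closed cob_mult)
  show ?thesis unfolding B2_eq by (rule img_is_subgroup)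
qed

sublocale B2: normal B Z
  by (rule Z2.subgroup_imp_normal[OF B2_subgroup])

lemma H2_comm_group: "comm_group (H2_RBE H I \<mu>)"
  unfolding H2_RBE_def by (rule Z2.abelian_FactGroup[OF B2_subgroup])

sublocale H2: comm_group "H2_RBE H I \<mu>" by (rule H2_comm_group)

definition cls where "cls z = B #>\<^bsub>Z\<^esub> z"

lemma cls_mem: "z \<in> carrier Z \<Longrightarrow> cls z \<in> carrier (H2_RBE H I \<mu>)"
  by (auto simp: cls_def H2_RBE_def FactGroup_def RCOSETS_def)

lemma cls_cases:
  assumes "k \<in> carrier (H2_RBE H I \<mu>)" obtains z where "z \<in> carrier Z" "k = cls z"
  using assms by (auto simp: cls_def H2_RBE_def FactGroup_def RCOSETS_def)

lemma cls_mult: "\<lbrakk>z \<in> carrier Z; w \<in> carrier Z\<rbrakk> \<Longrightarrow> cls (z \<otimes>\<^bsub>Z\<^esub> w) = cls z \<otimes>\<^bsub>H2_RBE H I \<mu>\<^esub> cls w"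
  by (simp add: cls_def H2_RBE_def FactGroup_def B2.rcos_sum)

lemma cls_inv: "z \<in> carrier Z \<Longrightarrow> cls (inv\<^bsub>Z\<^esub> z) = inv\<^bsub>H2_RBE H I \<mu>\<^esub> (cls z)"
proof -
  assume z: "z \<in> carrier Z"
  have "group_hom Z (H2_RBE H I \<mu>) cls"
    by unfold_locales (auto simp: hom_def cls_mem cls_mult)
  then show ?thesis using z by (rule group_hom.hom_inv)
qed

lemma cls_self: "z \<in> carrier Z \<Longrightarrow> z \<in> cls z"
  unfolding cls_def by (rule Z2.rcos_self[OF _ B2_subgroup])

lemma cls_subset: "z \<in> carrier Z \<Longrightarrow> w \<in> cls z \<Longrightarrow> w \<in> carrier Z \<and> cls w = cls z"
  unfolding cls_def
  using Z2.repr_independence[OF _ _ B2_subgroup] B2.elemrcos_carrier[OF Z2.is_group] by blast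

lemma cls_eq_iff:
  assumes "z \<in> carrier Z" "w \<in> carrier Z"
  shows "cls z = cls w \<longleftrightarrow> (\<exists>\<theta>\<in>carrier (C1 H I). w = z \<otimes>\<^bsub>Z\<^esub> cob \<theta>)"
proof -
  have "cls z = cls w \<longleftrightarrow> w \<in> cls z" using cls_self cls_subset assms by metis
  also have "\<dots> \<longleftrightarrow> (\<exists>\<theta>\<in>carrier (C1 H I). w = cob \<theta> \<otimes>\<^bsub>Z\<^esub> z)"
    by (auto simp: cls_def r_coset_def B2_eq)
  finally show ?thesis using assms cob_closed Z2.m_comm by metis
qed

lemma cocycle_extension: "z \<in> carrier Z \<Longrightarrow> rb_extension H I \<mu> (cocycle_ext H I \<mu> z)"
  unfolding cocycle_ext_def by (intro extension_std Z2D)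

text \<open>A change of section adds \<open>Phi1\<close> to the operator cochain of the extension;
  after the sign change this is the second component of \<open>cob\<close>, so equivalence becomes
  equality of cosets.\<close>

lemma cocycle_ext_equiv_iff:
  assumes "z \<in> carrier Z" "w \<in> carrier Z"
  shows "rb_ext_equiv I (cocycle_ext H I \<mu> z) (cocycle_ext H I \<mu> w) \<longleftrightarrow> cls z = cls w"
proof -
  have "cochain_neg H I (snd w) = cochain_neg H I (snd z) \<otimes>\<^bsub>C1 H I\<^esub> Phi1 H I \<mu> \<theta> \<longleftrightarrow>
      snd w = snd z \<otimes>\<^bsub>C1 H I\<^esub> cochain_neg H I (Phi1 H I \<mu> \<theta>)" if t: "\<theta> \<in> carrier (C1 H I)" for \<theta>
  proof -
    have "cochain_neg H I (snd z) \<otimes>\<^bsub>C1 H I\<^esub> Phi1 H I \<mu> \<theta> =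
        cochain_neg H I (snd z \<otimes>\<^bsub>C1 H I\<^esub> cochain_neg H I (Phi1 H I \<mu> \<theta>))"
      using t assms by (simp add: neg_mult neg_neg Z2D Phi1_closed neg_closed)
    then show ?thesis
      using t assms neg_neg by (metis C1.m_closed Phi1_closed Z2D(2) neg_closed)
  qed
  then show ?thesis
    unfolding cocycle_ext_def std_equiv_iff[OF Z2D(3)[OF assms(1)] Z2D(3)[OF assms(2)]]
    by (auto simp: cls_eq_iff[OF assms] cob_def Z2_mult prod_eq_iff)
qed

end

section \<open>Compatible pairs and the derivation\<close>

lemma inv_rb_Aut:
  assumes G: "rota_baxter_group G" and \<gamma>: "\<gamma> \<in> carrier (rb_Aut G)"
  shows "inv\<^bsub>rb_Aut G\<^esub> \<gamma> = (\<lambda>x\<in>carrier G. inv_into (carrier G) \<gamma> x)"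
proof -
  interpret A: group "rb_Aut G" by (rule group_rb_Aut[OF G])
  note i = inv_rb_Aut_mem[OF G \<gamma>]
  have "(\<lambda>x\<in>carrier G. inv_into (carrier G) \<gamma> x) \<otimes>\<^bsub>rb_Aut G\<^esub> \<gamma> = \<one>\<^bsub>rb_Aut G\<^esub>"
    using \<gamma> unfolding mult_rb_Aut[OF i \<gamma>] one_rb_Aut
    by (intro Bij_compose_restrict_eq) (simp add: carrier_rb_Aut Bij_def)
  then show ?thesis using i \<gamma> by (intro A.inv_equality)
qed

lemma rb_AutD:
  assumes "\<gamma> \<in> carrier (rb_Aut G)"
  shows "x \<in> carrier G \<Longrightarrow> \<gamma> x \<in> carrier G"
    and "\<lbrakk>x \<in> carrier G; y \<in> carrier G\<rbrakk> \<Longrightarrow> \<gamma> (x \<otimes>\<^bsub>G\<^esub> y) = \<gamma> x \<otimes>\<^bsub>G\<^esub> \<gamma> y"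
    and "x \<in> carrier G \<Longrightarrow> \<gamma> (rb G x) = rb G (\<gamma> x)"
    and "\<lbrakk>x \<in> carrier G; y \<in> carrier G\<rbrakk> \<Longrightarrow> \<gamma> x = \<gamma> y \<longleftrightarrow> x = y"
    and "x \<in> carrier G \<Longrightarrow> inv_into (carrier G) \<gamma> x \<in> carrier G"
    and "x \<in> carrier G \<Longrightarrow> \<gamma> (inv_into (carrier G) \<gamma> x) = x"
    and "x \<in> carrier G \<Longrightarrow> inv_into (carrier G) \<gamma> (\<gamma> x) = x"
    and "\<gamma> ` carrier G = carrier G"
    and "\<gamma> \<in> rb_hom G G" "bij_betw \<gamma> (carrier G) (carrier G)" "\<gamma> \<in> extensional (carrier G)"
  using assms by (auto simp: carrier_rb_Aut rb_homD bij_betw_def inj_on_eq_iff inv_into_into f_inv_into_f)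

lemma (in rota_baxter_group) rb_Aut_one: "\<gamma> \<in> carrier (rb_Aut G) \<Longrightarrow> \<gamma> \<one> = \<one>"
proof -
  assume g: "\<gamma> \<in> carrier (rb_Aut G)"
  have "group_hom G G \<gamma>" using rb_AutD(9)[OF g] by unfold_locales (simp add: rb_hom_def)
  then show ?thesis by (rule group_hom.hom_one)
qed

context rb_mod
begin

lemma C_mu_iff: "(\<phi>, \<psi>) \<in> carrier (C_mu H I \<mu>) \<longleftrightarrow>
   \<phi> \<in> carrier (rb_Aut H) \<and> \<psi> \<in> carrier (rb_Aut I) \<and>
   (\<forall>h\<in>carrier H. \<forall>y\<in>carrier I. \<psi> (\<mu> h y) = \<mu> (\<phi> h) (\<psi> y))"
proof (cases "\<phi> \<in> carrier (rb_Aut H) \<and> \<psi> \<in> carrier (rb_Aut I)")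
  case True
  have "\<mu> h y = inv_into (carrier I) \<psi> (\<mu> (\<phi> h) (\<psi> y)) \<longleftrightarrow> \<psi> (\<mu> h y) = \<mu> (\<phi> h) (\<psi> y)"
    if "h \<in> carrier H" "y \<in> carrier I" for h y
    using True that rb_AutD[of \<phi> H] rb_AutD[of \<psi> I] by (metis mu_closed)
  then show ?thesis using True by (auto simp: C_mu_def)
qed (auto simp: C_mu_def)

lemma C_muD:
  assumes "c \<in> carrier (C_mu H I \<mu>)"
  shows "fst c \<in> carrier (rb_Aut H)" "snd c \<in> carrier (rb_Aut I)"
    and "\<lbrakk>h \<in> carrier H; y \<in> carrier I\<rbrakk> \<Longrightarrow> snd c (\<mu> h y) = \<mu> (fst c h) (snd c y)"
  using assms C_mu_iff[of "fst c" "snd c"] by simp_all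

lemma C_mu_mult:
  assumes "c \<in> carrier (C_mu H I \<mu>)" "d \<in> carrier (C_mu H I \<mu>)"
  shows "c \<otimes>\<^bsub>C_mu H I \<mu>\<^esub> d = (compose (carrier H) (fst c) (fst d), compose (carrier I) (snd c) (snd d))"
  using C_muD(1,2)[OF assms(1)] C_muD(1,2)[OF assms(2)]
  by (cases c, cases d) (simp add: C_mu_def mult_rb_Aut)

lemma C_mu_one: "\<one>\<^bsub>C_mu H I \<mu>\<^esub> = ((\<lambda>h\<in>carrier H. h), (\<lambda>y\<in>carrier I. y))"
  by (simp add: C_mu_def one_rb_Aut)

lemma H_rb_group: "rota_baxter_group H" and I_rb_group: "rota_baxter_group I"
  by unfold_locales

lemma group_C_mu: "group (C_mu H I \<mu>)"
proof -
  let ?K = "rb_Aut H \<times>\<times> rb_Aut I" and ?C = "carrier (C_mu H I \<mu>)"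
  interpret AH: group "rb_Aut H" by (rule group_rb_Aut[OF H_rb_group])
  interpret AI: group "rb_Aut I" by (rule group_rb_Aut[OF I_rb_group])
  interpret K: group ?K by (rule DirProd_group) unfold_locales
  have eq: "C_mu H I \<mu> = ?K\<lparr>carrier := ?C\<rparr>" by (simp add: C_mu_def)
  have "subgroup ?C ?K"
  proof (rule K.subgroupI)
    show "?C \<subseteq> carrier ?K" by (auto simp: C_mu_def)
    have "(\<one>\<^bsub>rb_Aut H\<^esub>, \<one>\<^bsub>rb_Aut I\<^esub>) \<in> ?C"
      unfolding C_mu_iff using AH.one_closed AI.one_closed by (simp add: one_rb_Aut)
    then show "?C \<noteq> {}" by blast
  next
    fix c assume c: "c \<in> ?C"
    obtain \<phi> \<psi> where e: "c = (\<phi>, \<psi>)" by force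
    have m: "\<phi> \<in> carrier (rb_Aut H)" "\<psi> \<in> carrier (rb_Aut I)"
      and k: "\<And>h y. \<lbrakk>h \<in> carrier H; y \<in> carrier I\<rbrakk> \<Longrightarrow> \<psi> (\<mu> h y) = \<mu> (\<phi> h) (\<psi> y)"
      using c by (auto simp: e C_mu_iff)
    note P = rb_AutD[OF m(1)] and Q = rb_AutD[OF m(2)]
    let ?p = "inv_into (carrier H) \<phi>" and ?q = "inv_into (carrier I) \<psi>"
    have "?q (\<mu> h y) = \<mu> (?p h) (?q y)" if "h \<in> carrier H" "y \<in> carrier I" for h y
    proof -
      have "\<psi> (\<mu> (?p h) (?q y)) = \<mu> h y" using that k P Q by simp
      then show ?thesis using that P(5) Q(5,7) by (metis mu_closed)
    qed
    then have "(inv\<^bsub>rb_Aut H\<^esub> \<phi>, inv\<^bsub>rb_Aut I\<^esub> \<psi>) \<in> ?C"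
      unfolding C_mu_iff using m AH.inv_closed[OF m(1)] AI.inv_closed[OF m(2)] P Q
      by (simp add: inv_rb_Aut H_rb_group I_rb_group)
    then show "inv\<^bsub>?K\<^esub> c \<in> ?C"
      using m by (simp add: e inv_DirProd[OF AH.is_group AI.is_group])
  next
    fix c d assume c: "c \<in> ?C" and d: "d \<in> ?C"
    note cm = C_muD[OF c] and dm = C_muD[OF d]
    have "(fst c \<otimes>\<^bsub>rb_Aut H\<^esub> fst d, snd c \<otimes>\<^bsub>rb_Aut I\<^esub> snd d) \<in> ?C"
      unfolding C_mu_iff using AH.m_closed[OF cm(1) dm(1)] AI.m_closed[OF cm(2) dm(2)] cm dm
      by (auto simp: mult_rb_Aut compose_eq rb_AutD)
    then show "c \<otimes>\<^bsub>?K\<^esub> d \<in> ?C" by (cases c, cases d) simp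
  qed
  then show ?thesis by (subst eq) (rule K.subgroup_imp_group)
qed

text \<open>The two middle groups may have different types; this is how the given extension is
  replaced by a representative built from a cocycle.\<close>

lemma ext_class_eq:
  assumes "is_rb_extension H I \<E>" "rb_ext_equiv I \<E> Y"
  shows "ext_class H I \<mu> \<E> = ext_class H I \<mu> Y"
proof -
  have "rb_ext_equiv I \<E> K \<longleftrightarrow> rb_ext_equiv I Y K" for K :: "('i, 'h \<times> 'i, 'h) rb_ext"
    using rb_ext_equiv_trans[OF assms(2)] rb_ext_equiv_trans[OF rb_ext_equiv_sym[OF assms]] by blast
  then show ?thesis by (simp add: ext_class_def)
qed

lemma cochain_act_mult:
  assumes c: "c \<in> carrier (C_mu H I \<mu>)" and z: "z \<in> carrier Z" "w \<in> carrier Z"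
  shows "cochain_act H I (z \<otimes>\<^bsub>Z\<^esub> w) c =
    (fst (cochain_act H I z c) \<otimes>\<^bsub>C2 H I\<^esub> fst (cochain_act H I w c),
     snd (cochain_act H I z c) \<otimes>\<^bsub>C1 H I\<^esub> snd (cochain_act H I w c))"
proof -
  note P = rb_AutD[OF C_muD(1)[OF c]] and Q = rb_AutD[OF C_muD(2)[OF c]]
  have q: "inv_into (carrier I) (snd c) (x \<otimes> y) = inv_into (carrier I) (snd c) x \<otimes> inv_into (carrier I) (snd c) y"
    if "x \<in> carrier I" "y \<in> carrier I" for x y
    using rb_homD(2)[OF rb_hom_inv_into[OF I_rb_group Q(9,10)]] that by blast
  show ?thesis
    using z by (auto simp: cochain_act_def split_beta Z2_mult mult_C1 mult_C2 P q C1D[OF Z2D(2)] C2D[OF Z2D(1)])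
qed

end

section \<open>Twisting an extension by a compatible pair\<close>

context rb_extension
begin

lemma twist_extension:
  assumes c: "c \<in> carrier (C_mu H I \<mu>)"
  shows "rb_extension H I \<mu> (ext_twist H \<E> c)"
proof -
  note P = rb_AutD[OF C_muD(1)[OF c]] and Q = rb_AutD[OF C_muD(2)[OF c]]
  let ?p = "inv_into (carrier H) (fst c)"
  have ph: "?p \<in> rb_hom H H" by (rule rb_hom_inv_into[OF H_rb_group P(9,10)])
  \<comment> \<open>Composing the projection with \<phi>^-1 does not change its kernel, and \<psi>
    does not change the image of I, so exactness survives the twist.\<close>
  have pk: "?p h = \<one>\<^bsub>H\<^esub> \<longleftrightarrow> h = \<one>\<^bsub>H\<^esub>" if "h \<in> carrier H" for h
    using that P(6,7)[of h] P(7)[of "\<one>\<^bsub>H\<^esub>"] H.rb_Aut_one[OF C_muD(1)[OF c]] by (metis H.one_closed)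
  have "?p ` carrier H = carrier H" using bij_betw_inv_into[OF P(10)] by (simp add: bij_betw_def)
  moreover have "p ` carrier M = carrier H" using ext by (simp add: is_rb_extension_def)
  ultimately have sur: "(?p \<circ> p) ` carrier M = carrier H" by (metis image_comp)
  have "(i \<circ> snd c) ` carrier I = i ` carrier I" using Q(8) by (metis image_comp)
  also have "\<dots> = kernel M H p" using ext by (simp add: is_rb_extension_def)
  also have "\<dots> = kernel M H (?p \<circ> p)" by (auto simp: kernel_def pk)
  finally have ker: "(i \<circ> snd c) ` carrier I = kernel M H (?p \<circ> p)" .
  have e: "is_rb_extension H I (ext_twist H \<E> c)"
    unfolding is_rb_extension_def ext_twist_def
    using sur ker rb_hom_comp[OF Q(9) i_hom] rb_hom_comp[OF p_hom ph]
    by (auto simp: inj_on_def Q intro: M.rota_baxter_group_axioms)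
  moreover have "has_action H I \<mu> (ext_twist H \<E> c)"
  proof (rule has_actionI[OF e])
    fix x y assume x: "x \<in> carrier (mid (ext_twist H \<E> c))" and y: "y \<in> carrier I"
    then have x': "x \<in> carrier M" by (simp add: ext_twist_def)
    \<comment> \<open>Compatibility at \<phi>^-1(p x): it turns the sliding rule of the original
      extension into that of the twist with the same action \<mu>.\<close>
    have "snd c (\<mu> (?p (p x)) y) = \<mu> (p x) (snd c y)" using C_muD(3)[OF c] x' y P by simp
    then show "incl (ext_twist H \<E> c) y \<otimes>\<^bsub>mid (ext_twist H \<E> c)\<^esub> x =
        x \<otimes>\<^bsub>mid (ext_twist H \<E> c)\<^esub> incl (ext_twist H \<E> c) (\<mu> (prj (ext_twist H \<E> c) x) y)"
      using x' y slide[OF x'] Q by (simp add: ext_twist_def)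
  qed
  ultimately show ?thesis by unfold_locales
qed

lemma twist_equiv:
  assumes c: "c \<in> carrier (C_mu H I \<mu>)" and e: "rb_ext_equiv I \<E> Y"
  shows "rb_ext_equiv I (ext_twist H \<E> c) (ext_twist H Y c)"
proof -
  obtain \<gamma> where a: "\<gamma> \<in> rb_hom M (mid Y)" "bij_betw \<gamma> (carrier M) (carrier (mid Y))"
    and b: "\<And>y. y \<in> carrier I \<Longrightarrow> \<gamma> (i y) = incl Y y"
    and d: "\<And>x. x \<in> carrier M \<Longrightarrow> prj Y (\<gamma> x) = p x"
    using rb_ext_equivE[OF e] by blast
  show ?thesis
    by (rule rb_ext_equivI[of \<gamma>]) (use a b d rb_AutD[OF C_muD(2)[OF c]] in \<open>simp_all add: ext_twist_def\<close>)
qed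

text \<open>Cocycles reach every class of extensions, whatever the type of the middle group. The
  factor set of any section serves, with g inverted for \<open>Z2_RBE\<close>.\<close>

lemma equiv_cocycle_exists:
  obtains z where "z \<in> carrier Z" "rb_ext_equiv I (cocycle_ext H I \<mu> z) \<E>"
proof -
  obtain s where "st_section H \<E> s" using section_exists by blast
  then obtain \<tau> g where d: "section_data \<E> s \<tau> g" using data_exists by blast
  have g: "g \<in> carrier (C1 H I)" using section_dataD[OF d] by simp
  show thesis
    using data_equiv[OF d] data_factor_set[OF d] g
    by (intro that[of "(\<tau>, cochain_neg H I g)"]) (simp_all add: Z2_iff neg_neg neg_closed cocycle_ext_def)
qed

lemma ext_class_cocycle:
  assumes "z \<in> carrier Z" "rb_ext_equiv I (cocycle_ext H I \<mu> z) \<E>"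
  shows "ext_class H I \<mu> \<E> = ext_class H I \<mu> (cocycle_ext H I \<mu> z)"
    and "cocycle_ext H I \<mu> z \<in> ext_class H I \<mu> \<E>"
proof -
  interpret E: rb_extension H I \<mu> "cocycle_ext H I \<mu> z" using assms cocycle_extension by blast
  show "ext_class H I \<mu> \<E> = ext_class H I \<mu> (cocycle_ext H I \<mu> z)"
    using ext_class_eq[OF E.ext assms(2)] by simp
  show "cocycle_ext H I \<mu> z \<in> ext_class H I \<mu> \<E>"
    using E.ext E.act rb_ext_equiv_sym[OF E.ext assms(2)] by (simp add: ext_class_def)
qed

lemma ext_class_in_Ext: "ext_class H I \<mu> \<E> \<in> Ext H I \<mu>"
proof -
  obtain z where z: "z \<in> carrier Z" "rb_ext_equiv I (cocycle_ext H I \<mu> z) \<E>"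
    using equiv_cocycle_exists .
  interpret E: rb_extension H I \<mu> "cocycle_ext H I \<mu> z" using z cocycle_extension by blast
  show ?thesis
    unfolding Ext_def ext_class_cocycle(1)[OF z] using E.ext E.act by blast
qed

end

context rb_mod
begin

lemma ext_class_cocycle_eq_iff:
  assumes "z \<in> carrier Z" "w \<in> carrier Z"
  shows "ext_class H I \<mu> (cocycle_ext H I \<mu> z) = ext_class H I \<mu> (cocycle_ext H I \<mu> w) \<longleftrightarrow> cls z = cls w"
proof -
  interpret E: rb_extension H I \<mu> "cocycle_ext H I \<mu> z" using assms cocycle_extension by blast
  interpret E': rb_extension H I \<mu> "cocycle_ext H I \<mu> w" using assms cocycle_extension by blast
  have "rb_ext_equiv I (cocycle_ext H I \<mu> w) (cocycle_ext H I \<mu> w)"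
    using assms cocycle_ext_equiv_iff by blast
  then have "cocycle_ext H I \<mu> w \<in> ext_class H I \<mu> (cocycle_ext H I \<mu> w)"
    using E'.ext E'.act by (simp add: ext_class_def)
  then show ?thesis
    using ext_class_eq[OF E.ext] cocycle_ext_equiv_iff[OF assms] by (auto simp: ext_class_def)
qed

text \<open>In the twist the projection is \<phi>^-1 after the old one, so h \<mapsto> (\<phi> h,
  \<one>) is a section. Its corrections are the old ones at \<phi>-values, seen through the
  inclusion precomposed with \<psi>, which is where \<psi>^-1 comes from.\<close>

lemma cochain_act_data:
  assumes c: "c \<in> carrier (C_mu H I \<mu>)" and z: "z \<in> carrier Z"
  shows "section_data (ext_twist H (cocycle_ext H I \<mu> z) c) (\<lambda>h. (fst c h, \<one>))
    (fst (cochain_act H I z c)) (cochain_neg H I (snd (cochain_act H I z c)))"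
    and "snd (cochain_act H I z c) \<in> carrier (C1 H I)"
proof -
  note P = rb_AutD[OF C_muD(1)[OF c]] and Q = rb_AutD[OF C_muD(2)[OF c]]
  note [simp] = P(1-7) Q(1,4-7) H.rb_Aut_one[OF C_muD(1)[OF c]]
  note t [simp] = C2D(1-3)[OF Z2D(1)[OF z]] and g [simp] = C1D(1,2)[OF Z2D(2)[OF z]]
  have q1 [simp]: "inv_into (carrier I) (snd c) \<one> = \<one>"
    using Q(7)[of \<one>] I.rb_Aut_one[OF C_muD(2)[OF c]] by simp
  have qinv: "snd c (inv y) = inv (snd c y)" if "y \<in> carrier I" for y
  proof -
    have "group_hom I I (snd c)" using Q(9) by unfold_locales (simp add: rb_hom_def)
    then show ?thesis using that by (rule group_hom.hom_inv)
  qed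
  show c1: "snd (cochain_act H I z c) \<in> carrier (C1 H I)"
    by (auto simp: cochain_act_def split_beta intro!: C1I)
  have "fst (cochain_act H I z c) \<in> carrier (C2 H I)"
    by (auto simp: cochain_act_def split_beta C2_def)
  then show "section_data (ext_twist H (cocycle_ext H I \<mu> z) c) (\<lambda>h. (fst c h, \<one>))
    (fst (cochain_act H I z c)) (cochain_neg H I (snd (cochain_act H I z c)))"
    using neg_closed[OF c1]
    by (auto simp: section_data_def st_section_def ext_twist_def cocycle_ext_def cochain_act_def
        split_beta cochain_neg_def qinv)
qed

lemma cochain_act_closed:
  assumes c: "c \<in> carrier (C_mu H I \<mu>)" and z: "z \<in> carrier Z"
  shows "cochain_act H I z c \<in> carrier Z"
    and "rb_ext_equiv I (cocycle_ext H I \<mu> (cochain_act H I z c)) (ext_twist H (cocycle_ext H I \<mu> z) c)"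
proof -
  interpret E: rb_extension H I \<mu> "cocycle_ext H I \<mu> z" using z by (rule cocycle_extension)
  interpret T: rb_extension H I \<mu> "ext_twist H (cocycle_ext H I \<mu> z) c" by (rule E.twist_extension[OF c])
  note d = cochain_act_data[OF c z]
  show "cochain_act H I z c \<in> carrier Z"
    using Z2_iff[of "fst (cochain_act H I z c)" "snd (cochain_act H I z c)"] T.data_factor_set[OF d(1)] d(2)
    by simp
  show "rb_ext_equiv I (cocycle_ext H I \<mu> (cochain_act H I z c)) (ext_twist H (cocycle_ext H I \<mu> z) c)"
    using T.data_equiv[OF d(1)] by (simp add: cocycle_ext_def)
qed

text \<open>Well-definedness on classes: cohomologous cocycles give equivalent extensions,
  equivalent extensions have equivalent twists, and the twists realise the transformed
  cocycles.\<close>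

lemma cls_cochain_act:
  assumes c: "c \<in> carrier (C_mu H I \<mu>)" and z: "z \<in> carrier Z" "w \<in> carrier Z" and e: "cls z = cls w"
  shows "cls (cochain_act H I z c) = cls (cochain_act H I w c)"
proof -
  interpret E: rb_extension H I \<mu> "cocycle_ext H I \<mu> z" using z(1) by (rule cocycle_extension)
  interpret E': rb_extension H I \<mu> "cocycle_ext H I \<mu> (cochain_act H I w c)"
    using cochain_act_closed(1)[OF c z(2)] by (rule cocycle_extension)
  have "rb_ext_equiv I (ext_twist H (cocycle_ext H I \<mu> z) c) (ext_twist H (cocycle_ext H I \<mu> w) c)"
    using cocycle_ext_equiv_iff[OF z] e E.twist_equiv[OF c] by blast
  from rb_ext_equiv_trans[OF cochain_act_closed(2)[OF c z(1)] rb_ext_equiv_trans[OF this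
      rb_ext_equiv_sym[OF E'.ext cochain_act_closed(2)[OF c z(2)]]]]
  show ?thesis
    using cocycle_ext_equiv_iff cochain_act_closed(1)[OF c] z by simp
qed

text \<open>\<open>H2_act\<close> is a union over all representatives of the class; by the preceding
  lemma the family is constant.\<close>

lemma H2_act_cls:
  assumes c: "c \<in> carrier (C_mu H I \<mu>)" and z: "z \<in> carrier Z"
  shows "H2_act H I \<mu> (cls z) c = cls (cochain_act H I z c)"
proof -
  have "cls (cochain_act H I w c) = cls (cochain_act H I z c)" if "w \<in> cls z" for w
    using cls_subset[OF z that] z cls_cochain_act[OF c] by blast
  then show ?thesis
    unfolding H2_act_def cls_def[symmetric, of "cochain_act H I _ c"]
    by (intro UN_constant_eq[OF cls_self[OF z]]) simp
qed

lemma cls_cochain_act_mult: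
  assumes c: "c \<in> carrier (C_mu H I \<mu>)" and z: "z \<in> carrier Z" "w \<in> carrier Z"
  shows "cls (cochain_act H I (z \<otimes>\<^bsub>Z\<^esub> w) c) =
    cls (cochain_act H I z c) \<otimes>\<^bsub>H2_RBE H I \<mu>\<^esub> cls (cochain_act H I w c)"
  using cls_mult[OF cochain_act_closed(1)[OF c z(1)] cochain_act_closed(1)[OF c z(2)]]
  unfolding cochain_act_mult[OF c z] by (simp add: Z2_mult)

end

section \<open>The difference class and its derivation rule\<close>

context rb_extension
begin

text \<open>Independence of both representatives, of the extension class and of the cohomology
  class: replacing either leaves the product class unchanged, so the double union collapses.\<close>

lemma ext_translate_cls:
  assumes z: "z \<in> carrier Z" "rb_ext_equiv I (cocycle_ext H I \<mu> z) \<E>" and w: "w \<in> carrier Z"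
  shows "ext_translate H I \<mu> (ext_class H I \<mu> \<E>) (cls w) = ext_class H I \<mu> (cocycle_ext H I \<mu> (z \<otimes>\<^bsub>Z\<^esub> w))"
proof -
  have "ext_class H I \<mu> (cocycle_ext H I \<mu> (z' \<otimes>\<^bsub>Z\<^esub> w')) = ext_class H I \<mu> (cocycle_ext H I \<mu> (z \<otimes>\<^bsub>Z\<^esub> w))"
    if a: "z' \<in> carrier Z" "cocycle_ext H I \<mu> z' \<in> ext_class H I \<mu> \<E>" "w' \<in> cls w" for z' w'
  proof -
    have "rb_ext_equiv I (cocycle_ext H I \<mu> z) (cocycle_ext H I \<mu> z')"
      using a(2) z(2) rb_ext_equiv_trans by (auto simp: ext_class_def)
    then have "cls z' = cls z" using cocycle_ext_equiv_iff z(1) a(1) by metis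
    moreover have "cls w' = cls w" "w' \<in> carrier Z" using cls_subset[OF w a(3)] by auto
    ultimately show ?thesis
      using z(1) w a(1) by (simp add: ext_class_cocycle_eq_iff cls_mult)
  qed
  then show ?thesis
    unfolding ext_translate_def using ext_class_cocycle(2)[OF z] z(1)
    by (intro UN_constant_eq[of z] ballI UN_constant_eq[OF cls_self[OF w]]) auto
qed

lemma ext_act_class:
  assumes c: "c \<in> carrier (C_mu H I \<mu>)"
  shows "ext_act H I \<mu> (ext_class H I \<mu> \<E>) c = ext_class H I \<mu> (ext_twist H \<E> c)"
proof -
  interpret T: rb_extension H I \<mu> "ext_twist H \<E> c" by (rule twist_extension[OF c])
  obtain z where "z \<in> carrier Z" "rb_ext_equiv I (cocycle_ext H I \<mu> z) \<E>"
    using equiv_cocycle_exists .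
  \<comment> \<open>Without this the union defining \<open>ext_act\<close> could be empty; a
    representative over the fixed type comes from a cocycle.\<close>
  then have "ext_class H I \<mu> \<E> \<noteq> {}" using ext_class_cocycle(2) by blast
  moreover have "ext_class H I \<mu> (ext_twist H Y c) = ext_class H I \<mu> (ext_twist H \<E> c)"
    if "Y \<in> ext_class H I \<mu> \<E>" for Y
    using that twist_equiv[OF c, of Y] ext_class_eq[OF T.ext] by (auto simp: ext_class_def)
  ultimately show ?thesis unfolding ext_act_def by blast
qed

text \<open>An equation between sets of extensions becomes one in the group \<open>H2_RBE\<close>:
  [w] = [z] k, with one solution. Existence, uniqueness and value of \<open>omega\<close> are all
  read off from it.\<close>

lemma translate_iff:
  assumes z: "z \<in> carrier Z" "rb_ext_equiv I (cocycle_ext H I \<mu> z) \<E>"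
    and c: "c \<in> carrier (C_mu H I \<mu>)"
    and w: "w \<in> carrier Z" "rb_ext_equiv I (cocycle_ext H I \<mu> w) (ext_twist H \<E> c)"
    and k: "k \<in> carrier (H2_RBE H I \<mu>)"
  shows "ext_act H I \<mu> (ext_class H I \<mu> \<E>) c = ext_translate H I \<mu> (ext_class H I \<mu> \<E>) k \<longleftrightarrow>
    k = inv\<^bsub>H2_RBE H I \<mu>\<^esub> (cls z) \<otimes>\<^bsub>H2_RBE H I \<mu>\<^esub> cls w"
proof -
  interpret T: rb_extension H I \<mu> "ext_twist H \<E> c" by (rule twist_extension[OF c])
  obtain v where v: "v \<in> carrier Z" "k = cls v" using k by (rule cls_cases)
  have "ext_act H I \<mu> (ext_class H I \<mu> \<E>) c = ext_translate H I \<mu> (ext_class H I \<mu> \<E>) k \<longleftrightarrow>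
      cls w = cls z \<otimes>\<^bsub>H2_RBE H I \<mu>\<^esub> k"
    using z w v
    by (simp add: ext_act_class[OF c] T.ext_class_cocycle(1)[OF w] ext_translate_cls[OF z]
        ext_class_cocycle_eq_iff cls_mult)
  then show ?thesis
    using H2.inv_solve_left[of k "cls z" "cls w"] k z(1) w(1) by (simp add: cls_mem)
qed

lemma omega_unique:
  assumes c: "c \<in> carrier (C_mu H I \<mu>)"
  shows "\<exists>!k. k \<in> carrier (H2_RBE H I \<mu>) \<and>
         ext_act H I \<mu> (ext_class H I \<mu> \<E>) c = ext_translate H I \<mu> (ext_class H I \<mu> \<E>) k"
proof -
  interpret T: rb_extension H I \<mu> "ext_twist H \<E> c" by (rule twist_extension[OF c])
  obtain z where z: "z \<in> carrier Z" "rb_ext_equiv I (cocycle_ext H I \<mu> z) \<E>"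
    using equiv_cocycle_exists .
  obtain w where w: "w \<in> carrier Z" "rb_ext_equiv I (cocycle_ext H I \<mu> w) (ext_twist H \<E> c)"
    using T.equiv_cocycle_exists .
  show ?thesis
    using translate_iff[OF z c w] z w
    by (intro ex1I[of _ "inv\<^bsub>H2_RBE H I \<mu>\<^esub> (cls z) \<otimes>\<^bsub>H2_RBE H I \<mu>\<^esub> cls w"]) (auto simp: cls_mem)
qed

lemma omega_eq:
  assumes z: "z \<in> carrier Z" "rb_ext_equiv I (cocycle_ext H I \<mu> z) \<E>"
    and c: "c \<in> carrier (C_mu H I \<mu>)"
    and w: "w \<in> carrier Z" "rb_ext_equiv I (cocycle_ext H I \<mu> w) (ext_twist H \<E> c)"
  shows "omega H I \<mu> \<E> c = inv\<^bsub>H2_RBE H I \<mu>\<^esub> (cls z) \<otimes>\<^bsub>H2_RBE H I \<mu>\<^esub> cls w"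
  unfolding omega_def
  using translate_iff[OF z c w] z w by (intro the1_equality omega_unique[OF c]) (auto simp: cls_mem)

lemma omega_closed: "omega H I \<mu> \<E> \<in> carrier (C_mu H I \<mu>) \<rightarrow> carrier (H2_RBE H I \<mu>)"
  using theI'[OF omega_unique] by (auto simp: omega_def)

text \<open>Both conditions say [z] = [w]. The first describes the stabiliser of the class; the
  second supplies an actual isomorphism of the middle group, from which an automorphism can be
  made.\<close>

lemma omega_one_iff:
  assumes c: "c \<in> carrier (C_mu H I \<mu>)"
  shows "omega H I \<mu> \<E> c = \<one>\<^bsub>H2_RBE H I \<mu>\<^esub> \<longleftrightarrow> ext_act H I \<mu> (ext_class H I \<mu> \<E>) c = ext_class H I \<mu> \<E>"
    and "omega H I \<mu> \<E> c = \<one>\<^bsub>H2_RBE H I \<mu>\<^esub> \<longleftrightarrow> rb_ext_equiv I (ext_twist H \<E> c) \<E>"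
proof -
  interpret T: rb_extension H I \<mu> "ext_twist H \<E> c" by (rule twist_extension[OF c])
  obtain z where z: "z \<in> carrier Z" "rb_ext_equiv I (cocycle_ext H I \<mu> z) \<E>"
    using equiv_cocycle_exists .
  obtain w where w: "w \<in> carrier Z" "rb_ext_equiv I (cocycle_ext H I \<mu> w) (ext_twist H \<E> c)"
    using T.equiv_cocycle_exists .
  interpret Z: rb_extension H I \<mu> "cocycle_ext H I \<mu> z" using z(1) by (rule cocycle_extension)
  interpret W: rb_extension H I \<mu> "cocycle_ext H I \<mu> w" using w(1) by (rule cocycle_extension)
  have o: "omega H I \<mu> \<E> c = \<one>\<^bsub>H2_RBE H I \<mu>\<^esub> \<longleftrightarrow> cls z = cls w"
    unfolding omega_eq[OF z c w]
    using H2.inv_solve_left'[of "\<one>\<^bsub>H2_RBE H I \<mu>\<^esub>" "cls z" "cls w"] z(1) w(1) by (auto simp: cls_mem)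
  show "omega H I \<mu> \<E> c = \<one>\<^bsub>H2_RBE H I \<mu>\<^esub> \<longleftrightarrow> ext_act H I \<mu> (ext_class H I \<mu> \<E>) c = ext_class H I \<mu> \<E>"
    unfolding o ext_act_class[OF c]
    unfolding T.ext_class_cocycle(1)[OF w] ext_class_cocycle(1)[OF z] ext_class_cocycle_eq_iff[OF w(1) z(1)]
    by (rule eq_commute)
  have "cls z = cls w \<longleftrightarrow> rb_ext_equiv I (cocycle_ext H I \<mu> w) (cocycle_ext H I \<mu> z)"
    using cocycle_ext_equiv_iff[OF w(1) z(1)] by (simp add: eq_commute)
  also have "\<dots> \<longleftrightarrow> rb_ext_equiv I (ext_twist H \<E> c) \<E>"
  proof
    assume "rb_ext_equiv I (cocycle_ext H I \<mu> w) (cocycle_ext H I \<mu> z)"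
    then show "rb_ext_equiv I (ext_twist H \<E> c) \<E>"
      by (intro rb_ext_equiv_trans[OF rb_ext_equiv_sym[OF W.ext w(2)]] rb_ext_equiv_trans[OF _ z(2)])
  next
    assume "rb_ext_equiv I (ext_twist H \<E> c) \<E>"
    then show "rb_ext_equiv I (cocycle_ext H I \<mu> w) (cocycle_ext H I \<mu> z)"
      by (intro rb_ext_equiv_trans[OF w(2)] rb_ext_equiv_trans[OF _ rb_ext_equiv_sym[OF Z.ext z(2)]])
  qed
  finally show "omega H I \<mu> \<E> c = \<one>\<^bsub>H2_RBE H I \<mu>\<^esub> \<longleftrightarrow> rb_ext_equiv I (ext_twist H \<E> c) \<E>"
    unfolding o .
qed

text \<open>Twisting is a right action: inclusions compose to i after \<psi> of c after \<psi> of d,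
  and inverting reverses the order of the \<phi>s to match. The identity map is the
  equivalence.\<close>

lemma twist_mult:
  assumes c: "c \<in> carrier (C_mu H I \<mu>)" "d \<in> carrier (C_mu H I \<mu>)"
  shows "rb_ext_equiv I (ext_twist H (ext_twist H \<E> c) d) (ext_twist H \<E> (c \<otimes>\<^bsub>C_mu H I \<mu>\<^esub> d))"
proof -
  note P = rb_AutD[OF C_muD(1)[OF c(1)]] and Q = rb_AutD[OF C_muD(2)[OF c(1)]]
    and P' = rb_AutD[OF C_muD(1)[OF c(2)]] and Q' = rb_AutD[OF C_muD(2)[OF c(2)]]
  interpret C: group "C_mu H I \<mu>" by (rule group_C_mu)
  note PP = rb_AutD[OF C_muD(1)[OF C.m_closed[OF c]]]
  let ?f = "compose (carrier H) (fst c) (fst d)"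
  have "inv_into (carrier H) ?f h = inv_into (carrier H) (fst d) (inv_into (carrier H) (fst c) h)"
    if h: "h \<in> carrier H" for h
  proof -
    let ?k = "inv_into (carrier H) (fst d) (inv_into (carrier H) (fst c) h)"
    have "?k \<in> carrier H" "?f ?k = h" using h P P' by (simp_all add: compose_eq)
    then show ?thesis using PP(7)[of ?k] by (simp add: C_mu_mult[OF c])
  qed
  moreover have "mid (ext_twist H \<E> x) = M" for x by (simp add: ext_twist_def)
  ultimately show ?thesis
    by (intro rb_ext_equivI[of id])
      (auto simp: ext_twist_def C_mu_mult[OF c] compose_eq Q Q' rb_hom_def hom_def bij_betw_def)
qed

text \<open>If z represents the extension and w its twist by c, then \<open>?z\<close> represents
  the twist by d and \<open>?w\<close> the twist by cd. The difference of \<open>?w\<close> and z is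
  split at \<open>?z\<close>.\<close>

lemma omega_derivation:
  assumes c: "c \<in> carrier (C_mu H I \<mu>)" "d \<in> carrier (C_mu H I \<mu>)"
  shows "omega H I \<mu> \<E> (c \<otimes>\<^bsub>C_mu H I \<mu>\<^esub> d) =
    H2_act H I \<mu> (omega H I \<mu> \<E> c) d \<otimes>\<^bsub>H2_RBE H I \<mu>\<^esub> omega H I \<mu> \<E> d"
proof -
  interpret C: group "C_mu H I \<mu>" by (rule group_C_mu)
  interpret T: rb_extension H I \<mu> "ext_twist H \<E> c" by (rule twist_extension[OF c(1)])
  obtain z where z: "z \<in> carrier Z" "rb_ext_equiv I (cocycle_ext H I \<mu> z) \<E>"
    using equiv_cocycle_exists .
  obtain w where w: "w \<in> carrier Z" "rb_ext_equiv I (cocycle_ext H I \<mu> w) (ext_twist H \<E> c)"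
    using T.equiv_cocycle_exists .
  interpret Z: rb_extension H I \<mu> "cocycle_ext H I \<mu> z" using z(1) by (rule cocycle_extension)
  interpret W: rb_extension H I \<mu> "cocycle_ext H I \<mu> w" using w(1) by (rule cocycle_extension)
  let ?z = "cochain_act H I z d" and ?w = "cochain_act H I w d"
  have z': "?z \<in> carrier Z" "rb_ext_equiv I (cocycle_ext H I \<mu> ?z) (ext_twist H \<E> d)"
    by (rule cochain_act_closed(1)[OF c(2) z(1)],
        rule rb_ext_equiv_trans[OF cochain_act_closed(2)[OF c(2) z(1)] Z.twist_equiv[OF c(2) z(2)]])
  have w': "?w \<in> carrier Z" "rb_ext_equiv I (cocycle_ext H I \<mu> ?w) (ext_twist H \<E> (c \<otimes>\<^bsub>C_mu H I \<mu>\<^esub> d))"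
    by (rule cochain_act_closed(1)[OF c(2) w(1)],
        rule rb_ext_equiv_trans[OF cochain_act_closed(2)[OF c(2) w(1)]
          rb_ext_equiv_trans[OF W.twist_equiv[OF c(2) w(2)] twist_mult[OF c]]])
  let ?K = "H2_RBE H I \<mu>"
  \<comment> \<open>Additivity of the action of d, applied to w as z times the difference; this
    shows that d carries the difference of w and z to that of \<open>?w\<close> and
    \<open>?z\<close>.\<close>
  have "cls ?z \<otimes>\<^bsub>?K\<^esub> cls (cochain_act H I (inv\<^bsub>Z\<^esub> z \<otimes>\<^bsub>Z\<^esub> w) d) = cls ?w"
    using cls_cochain_act_mult[OF c(2) z(1), of "inv\<^bsub>Z\<^esub> z \<otimes>\<^bsub>Z\<^esub> w"] z(1) w(1)
    by (simp add: Z2.m_assoc[symmetric])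
  then have *: "H2_act H I \<mu> (omega H I \<mu> \<E> c) d = inv\<^bsub>?K\<^esub> (cls ?z) \<otimes>\<^bsub>?K\<^esub> cls ?w"
    using z(1) w(1) z'(1) w'(1) cochain_act_closed(1)[OF c(2), of "inv\<^bsub>Z\<^esub> z \<otimes>\<^bsub>Z\<^esub> w"]
    by (simp add: omega_eq[OF z c(1) w] cls_inv[symmetric] cls_mult[symmetric] H2_act_cls[OF c(2)])
      (simp add: cls_inv cls_mult cls_mem H2.inv_solve_left)
  have cl: "cls z \<in> carrier ?K" "cls ?z \<in> carrier ?K" "cls ?w \<in> carrier ?K"
    using z(1) z'(1) w'(1) by (simp_all add: cls_mem)
  have "inv\<^bsub>?K\<^esub> (cls ?z) \<otimes>\<^bsub>?K\<^esub> cls ?w \<otimes>\<^bsub>?K\<^esub> (inv\<^bsub>?K\<^esub> (cls z) \<otimes>\<^bsub>?K\<^esub> cls ?z) =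
      cls ?z \<otimes>\<^bsub>?K\<^esub> (inv\<^bsub>?K\<^esub> (cls z) \<otimes>\<^bsub>?K\<^esub> cls ?w \<otimes>\<^bsub>?K\<^esub> inv\<^bsub>?K\<^esub> (cls ?z))"
    using cl by (simp add: H2.m_ac)
  also have "\<dots> = inv\<^bsub>?K\<^esub> (cls z) \<otimes>\<^bsub>?K\<^esub> cls ?w"
    using cl by (intro H2.mult_div_cancel) simp_all
  finally show ?thesis
    unfolding omega_eq[OF z C.m_closed[OF c] w'] omega_eq[OF z c(2) z'] * by simp
qed

end

section \<open>Exactness at the automorphism group and at the compatible pairs\<close>

context rb_mod
begin

lemma Z1_iff: "l \<in> carrier (Z1_RBE H I \<mu>) \<longleftrightarrow> l \<in> carrier (C1 H I) \<and>
     (\<forall>h\<in>carrier H. \<forall>k\<in>carrier H. l (h \<otimes>\<^bsub>H\<^esub> k) = l k \<otimes> \<mu> k (l h)) \<and>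
     (\<forall>h\<in>carrier H. l (rb H h) = rb I (\<mu> (rb H h) (l h)))"
  by (auto simp: Z1_RBE_def)

lemma Z1_mult: "l \<otimes>\<^bsub>Z1_RBE H I \<mu>\<^esub> l' = (\<lambda>h\<in>carrier H. l h \<otimes> l' h)"
  by (simp add: Z1_RBE_def mult_C1)

lemma group_Z1: "group (Z1_RBE H I \<mu>)"
proof -
  let ?Z = "carrier (Z1_RBE H I \<mu>)"
  have eq: "Z1_RBE H I \<mu> = (C1 H I)\<lparr>carrier := ?Z\<rparr>" by (simp add: Z1_RBE_def)
  have "subgroup ?Z (C1 H I)"
  proof (rule C1.subgroupI)
    show "?Z \<subseteq> carrier (C1 H I)" by (auto simp: Z1_iff)
    have "\<one>\<^bsub>C1 H I\<^esub> \<in> ?Z" unfolding Z1_iff using C1.one_closed by (simp add: one_C1)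
    then show "?Z \<noteq> {}" by blast
  next
    fix l assume l: "l \<in> ?Z"
    then have c: "l \<in> carrier (C1 H I)" by (simp add: Z1_iff)
    have "cochain_neg H I l \<otimes>\<^bsub>C1 H I\<^esub> l = \<one>\<^bsub>C1 H I\<^esub>"
      using c by (auto simp: mult_C1 one_C1 cochain_neg_def C1D)
    then have "inv\<^bsub>C1 H I\<^esub> l = cochain_neg H I l" using c neg_closed by (intro C1.inv_equality)
    moreover have "cochain_neg H I l \<in> ?Z"
      unfolding Z1_iff using l neg_closed[OF c]
      by (simp add: cochain_neg_def Z1_iff C1D(1)[OF c] C1D(2)[OF c] mu_inv I_rb_inv I.inv_mult)
    ultimately show "inv\<^bsub>C1 H I\<^esub> l \<in> ?Z" by simp
  next
    fix l l' assume l: "l \<in> ?Z" "l' \<in> ?Z"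
    then have c: "l \<in> carrier (C1 H I)" "l' \<in> carrier (C1 H I)" by (auto simp: Z1_iff)
    then have "l \<otimes>\<^bsub>C1 H I\<^esub> l' \<in> carrier (C1 H I)" by simp
    then show "l \<otimes>\<^bsub>C1 H I\<^esub> l' \<in> ?Z"
      using l by (simp add: Z1_iff mult_C1 C1D(1)[OF c(1)] C1D(1)[OF c(2)] mu_mult I_rb_mult I.m_ac)
  qed
  then show ?thesis by (subst eq) (rule C1.subgroup_imp_group)
qed

end

section \<open>Automorphisms normalising I, shears and induced pairs\<close>

context rb_extension
begin

lemma Aut_I_iff: "\<gamma> \<in> carrier (Aut_I I \<E>) \<longleftrightarrow> \<gamma> \<in> carrier (rb_Aut M) \<and> \<gamma> ` i ` carrier I = i ` carrier I"
  by (auto simp: Aut_I_def)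

lemma Aut_I_mult: "\<lbrakk>\<beta> \<in> carrier (Aut_I I \<E>); \<gamma> \<in> carrier (Aut_I I \<E>)\<rbrakk> \<Longrightarrow>
    \<beta> \<otimes>\<^bsub>Aut_I I \<E>\<^esub> \<gamma> = compose (carrier M) \<beta> \<gamma>"
  by (simp add: Aut_I_iff mult_rb_Aut[symmetric]) (simp add: Aut_I_def)

lemma group_Aut_I: "group (Aut_I I \<E>)"
proof -
  let ?A = "carrier (Aut_I I \<E>)"
  interpret A: group "rb_Aut M" by (rule group_rb_Aut[OF M.rota_baxter_group_axioms])
  have eq: "Aut_I I \<E> = (rb_Aut M)\<lparr>carrier := ?A\<rparr>" by (simp add: Aut_I_def)
  have iI: "i ` carrier I \<subseteq> carrier M" by auto
  have "subgroup ?A (rb_Aut M)"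
  proof (rule A.subgroupI)
    show "?A \<subseteq> carrier (rb_Aut M)" by (auto simp: Aut_I_iff)
    have "\<one>\<^bsub>rb_Aut M\<^esub> \<in> ?A" unfolding Aut_I_iff using A.one_closed by (auto simp: one_rb_Aut image_iff)
    then show "?A \<noteq> {}" by blast
  next
    fix \<gamma> assume g: "\<gamma> \<in> ?A"
    then have m: "\<gamma> \<in> carrier (rb_Aut M)" and im: "\<gamma> ` i ` carrier I = i ` carrier I"
      by (auto simp: Aut_I_iff)
    \<comment> \<open>Since \<gamma> maps I onto I, I may be rewritten as its own image before the
      inverse is applied.\<close>
    have "(inv\<^bsub>rb_Aut M\<^esub> \<gamma>) ` i ` carrier I = (inv\<^bsub>rb_Aut M\<^esub> \<gamma>) ` \<gamma> ` i ` carrier I" by (simp add: im)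
    also have "\<dots> = (\<lambda>x. x) ` i ` carrier I"
      unfolding image_comp using iI rb_AutD[OF m]
      by (intro image_cong) (auto simp: inv_rb_Aut[OF M.rota_baxter_group_axioms m])
    finally show "inv\<^bsub>rb_Aut M\<^esub> \<gamma> \<in> ?A" using m by (simp add: Aut_I_iff)
  next
    fix \<beta> \<gamma> assume g: "\<beta> \<in> ?A" "\<gamma> \<in> ?A"
    then have "(\<beta> \<otimes>\<^bsub>rb_Aut M\<^esub> \<gamma>) ` i ` carrier I = \<beta> ` \<gamma> ` i ` carrier I"
      unfolding image_comp using iI by (intro image_cong) (auto simp: Aut_I_iff mult_rb_Aut compose_eq)
    then show "\<beta> \<otimes>\<^bsub>rb_Aut M\<^esub> \<gamma> \<in> ?A" using g by (simp add: Aut_I_iff)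
  qed
  then show ?thesis by (subst eq) (rule A.subgroup_imp_group)
qed

context
  fixes s assumes s: "st_section H \<E> s"
begin

text \<open>The section drops out because I is abelian: s(h) l(h) y = s(h) y l(h). Everything below
  uses this form.\<close>

lemma shear_eq:
  assumes l: "l \<in> carrier (C1 H I)" and x: "x \<in> carrier M"
  shows "shear \<E> s l x = x \<otimes>\<^bsub>M\<^esub> i (l (p x))"
proof -
  note [simp] = sectionD[OF s] C1D(1)[OF l]
  obtain y where y: "y \<in> carrier I" "x = s (p x) \<otimes>\<^bsub>M\<^esub> i y"
    using same_fibre[of "s (p x)" x] x by auto
  have "inv\<^bsub>M\<^esub> (s (p x)) \<otimes>\<^bsub>M\<^esub> x = i y" using x y(1) by (subst y(2)) (simp add: M.m_assoc[symmetric])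
  then have "shear \<E> s l x = s (p x) \<otimes>\<^bsub>M\<^esub> i (l (p x) \<otimes> y)"
    using x y(1) by (simp add: shear_def i_mult M.m_assoc)
  also have "\<dots> = s (p x) \<otimes>\<^bsub>M\<^esub> i y \<otimes>\<^bsub>M\<^esub> i (l (p x))"
    using x y(1) by (simp add: I.m_comm[of "l (p x)"] i_mult M.m_assoc)
  finally show ?thesis using y(2) by simp
qed

lemma shear_Aut_I:
  assumes l: "l \<in> carrier (Z1_RBE H I \<mu>)"
  shows "shear \<E> s l \<in> carrier (Aut_I I \<E>)"
proof -
  have lc: "l \<in> carrier (C1 H I)" and l1: "\<And>h k. \<lbrakk>h \<in> carrier H; k \<in> carrier H\<rbrakk> \<Longrightarrow> l (h \<otimes>\<^bsub>H\<^esub> k) = l k \<otimes> \<mu> k (l h)"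
    and l2: "\<And>h. h \<in> carrier H \<Longrightarrow> l (rb H h) = rb I (\<mu> (rb H h) (l h))"
    using l by (auto simp: Z1_iff)
  note [simp] = C1D(1,2)[OF lc] shear_eq[OF lc]
  have "shear \<E> s l \<in> rb_hom M M"
    by (intro rb_homI) (simp_all add: mult_i l1 I.m_comm rb_i l2)
  moreover have "bij_betw (shear \<E> s l) (carrier M) (carrier M)"
    unfolding bij_betw_def
  proof
    show "inj_on (shear \<E> s l) (carrier M)"
    proof (rule inj_onI)
      fix x x' assume x: "x \<in> carrier M" "x' \<in> carrier M" and e: "shear \<E> s l x = shear \<E> s l x'"
      then have "p (x \<otimes>\<^bsub>M\<^esub> i (l (p x))) = p (x' \<otimes>\<^bsub>M\<^esub> i (l (p x')))" by simp
      then have "p x = p x'" using x by simp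
      then show "x = x'" using e x by simp
    qed
    show "shear \<E> s l ` carrier M = carrier M"
    proof safe
      fix x assume x: "x \<in> carrier M"
      \<comment> \<open>A shear moves points only inside their fibre, so l takes the same value at
        the preimage and cancels.\<close>
      then have "x = shear \<E> s l (x \<otimes>\<^bsub>M\<^esub> i (inv (l (p x))))"
        by (simp add: M.m_assoc i_mult[symmetric])
      then show "x \<in> shear \<E> s l ` carrier M" by (rule image_eqI) (use x in simp)
    qed simp
  qed
  moreover have "shear \<E> s l ` i ` carrier I = i ` carrier I"
    unfolding image_comp by (intro image_cong) simp_all
  ultimately show ?thesis by (simp add: Aut_I_iff carrier_rb_Aut shear_def)
qed

lemma shear_hom: "shear \<E> s \<in> hom (Z1_RBE H I \<mu>) (Aut_I I \<E>)"
proof (rule homI)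
  fix l l' assume l: "l \<in> carrier (Z1_RBE H I \<mu>)" "l' \<in> carrier (Z1_RBE H I \<mu>)"
  interpret Z1: group "Z1_RBE H I \<mu>" by (rule group_Z1)
  have c: "l \<in> carrier (C1 H I)" "l' \<in> carrier (C1 H I)" "l \<otimes>\<^bsub>Z1_RBE H I \<mu>\<^esub> l' \<in> carrier (C1 H I)"
    using l Z1.m_closed[OF l] by (auto simp: Z1_iff)
  have "shear \<E> s (l \<otimes>\<^bsub>Z1_RBE H I \<mu>\<^esub> l') x = shear \<E> s l (shear \<E> s l' x)" if x: "x \<in> carrier M" for x
  proof -
    have "i (l (p x) \<otimes> l' (p x)) = i (l' (p x)) \<otimes>\<^bsub>M\<^esub> i (l (p x))"
      using x c by (simp add: I.m_comm[of "l (p x)"] C1D i_mult)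
    then show ?thesis using x c by (simp add: shear_eq Z1_mult C1D M.m_assoc)
  qed
  then have "shear \<E> s (l \<otimes>\<^bsub>Z1_RBE H I \<mu>\<^esub> l') = compose (carrier M) (shear \<E> s l) (shear \<E> s l')"
    by (intro extensionalityI[of _ "carrier M"]) (auto simp: compose_eq shear_def[of \<E> s "_ \<otimes>\<^bsub>_\<^esub> _"])
  then show "shear \<E> s (l \<otimes>\<^bsub>Z1_RBE H I \<mu>\<^esub> l') = shear \<E> s l \<otimes>\<^bsub>Aut_I I \<E>\<^esub> shear \<E> s l'"
    by (simp add: Aut_I_mult shear_Aut_I l)
qed (rule shear_Aut_I)

lemma shear_inj: "inj_on (shear \<E> s) (carrier (Z1_RBE H I \<mu>))"
proof (rule inj_onI)
  fix l l' assume "l \<in> carrier (Z1_RBE H I \<mu>)" "l' \<in> carrier (Z1_RBE H I \<mu>)" and e: "shear \<E> s l = shear \<E> s l'"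
  then have c: "l \<in> carrier (C1 H I)" "l' \<in> carrier (C1 H I)" by (auto simp: Z1_iff)
  have "l h = l' h" if h: "h \<in> carrier H" for h
    using fun_cong[OF e, of "s h"] h c sectionD[OF s] by (simp add: shear_eq C1D)
  then show "l = l'" by (rule C1_eqI[OF c])
qed

context
  fixes \<gamma> assumes \<gamma>: "\<gamma> \<in> carrier (Aut_I I \<E>)"
begin

lemma gamma_Aut: "\<gamma> \<in> carrier (rb_Aut M)" using \<gamma> by (simp add: Aut_I_iff)

lemma rho_incl:
  assumes "y \<in> carrier I"
  shows "snd (rho H I \<E> s \<gamma>) y \<in> carrier I" "i (snd (rho H I \<E> s \<gamma>) y) = \<gamma> (i y)"
proof -
  have "\<gamma> (i y) \<in> i ` carrier I" using assms \<gamma> by (auto simp: Aut_I_iff)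
  then show "snd (rho H I \<E> s \<gamma>) y \<in> carrier I" "i (snd (rho H I \<E> s \<gamma>) y) = \<gamma> (i y)"
    using assms by (auto simp: rho_def inv_into_into f_inv_into_f)
qed

text \<open>The induced map on H commutes with the projection at every point, not only on the
  section, because \<gamma> sends the fibre part into I. This shows independence of s.\<close>

lemma rho_prj:
  assumes x: "x \<in> carrier M" shows "fst (rho H I \<E> s \<gamma>) (p x) = p (\<gamma> x)"
proof -
  note [simp] = sectionD[OF s] rb_AutD(1,2)[OF gamma_Aut]
  obtain y where y: "y \<in> carrier I" "x = s (p x) \<otimes>\<^bsub>M\<^esub> i y"
    using same_fibre[of "s (p x)" x] x by auto
  have "p (\<gamma> (i y)) = \<one>\<^bsub>H\<^esub>" using rho_incl[OF y(1)] p_i by metis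
  then have "p (\<gamma> (s (p x) \<otimes>\<^bsub>M\<^esub> i y)) = p (\<gamma> (s (p x)))" using x y(1) by simp
  then show ?thesis using x y(2) by (simp add: rho_def)
qed

lemma rho_C_mu: "rho H I \<E> s \<gamma> \<in> carrier (C_mu H I \<mu>)"
proof -
  let ?f = "fst (rho H I \<E> s \<gamma>)" and ?g = "snd (rho H I \<E> s \<gamma>)"
  note [simp] = sectionD(1,2)[OF s]
  note G = rb_AutD[OF gamma_Aut]
  note [simp] = G(1)
  have fs: "?f h = p (\<gamma> (s h))" if "h \<in> carrier H" for h
    using rho_prj[of "s h"] that by simp
  have fh: "?f \<in> rb_hom H H"
  proof (rule rb_homI)
    fix h k assume m: "h \<in> carrier H" "k \<in> carrier H"
    have "?f (p (s h \<otimes>\<^bsub>M\<^esub> s k)) = p (\<gamma> (s h \<otimes>\<^bsub>M\<^esub> s k))" using m by (intro rho_prj) simp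
    then show "?f (h \<otimes>\<^bsub>H\<^esub> k) = ?f h \<otimes>\<^bsub>H\<^esub> ?f k" using m by (simp add: fs G(2))
  next
    fix h assume m: "h \<in> carrier H"
    have "?f (p (rb M (s h))) = p (\<gamma> (rb M (s h)))" using m by (intro rho_prj) simp
    then show "?f (rb H h) = rb H (?f h)" using m by (simp add: fs G(3))
  qed (simp add: fs)
  have fb: "bij_betw ?f (carrier H) (carrier H)"
    unfolding bij_betw_def
  proof
    show "inj_on ?f (carrier H)"
    proof (rule inj_onI)
      fix h k assume m: "h \<in> carrier H" "k \<in> carrier H" and e: "?f h = ?f k"
      then have "p (\<gamma> (s h)) = p (\<gamma> (s k))" by (simp add: fs)
      then obtain y where y: "y \<in> carrier I" "\<gamma> (s k) = \<gamma> (s h) \<otimes>\<^bsub>M\<^esub> i y"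
        using same_fibre[of "\<gamma> (s h)" "\<gamma> (s k)"] m by auto
      \<comment> \<open>Here surjectivity of \<gamma> on I enters: a difference lying in I after
        applying \<gamma> already came from I.\<close>
      have "i y \<in> \<gamma> ` i ` carrier I" using \<gamma> y by (simp add: Aut_I_iff)
      then obtain z where z: "z \<in> carrier I" "i y = \<gamma> (i z)" by auto
      have "s k = s h \<otimes>\<^bsub>M\<^esub> i z"
        using y z m G(4)[of "s k" "s h \<otimes>\<^bsub>M\<^esub> i z"] by (simp add: G(2))
      then have "p (s k) = p (s h \<otimes>\<^bsub>M\<^esub> i z)" by simp
      then show "h = k" using m z by simp
    qed
    show "?f ` carrier H = carrier H"
    proof safe
      fix h assume h: "h \<in> carrier H"
      have "?f (p (inv_into (carrier M) \<gamma> (s h))) = h" using h by (simp add: rho_prj G)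
      then show "h \<in> ?f ` carrier H"
        using h by (intro image_eqI[of _ _ "p (inv_into (carrier M) \<gamma> (s h))"]) (simp_all add: G)
    qed (simp add: fs)
  qed
  have f: "?f \<in> carrier (rb_Aut H)"
    using fh fb by (simp add: carrier_rb_Aut rho_def)
  note [simp] = rho_incl
  have gh: "?g \<in> rb_hom I I"
  proof (rule rb_homI)
    fix y z assume m: "y \<in> carrier I" "z \<in> carrier I"
    then have "i (?g (y \<otimes> z)) = i (?g y \<otimes> ?g z)" by (simp add: i_mult G(2))
    then show "?g (y \<otimes> z) = ?g y \<otimes> ?g z" using m i_eq_iff[of "?g (y \<otimes> z)" "?g y \<otimes> ?g z"] by simp
  next
    fix y assume m: "y \<in> carrier I"
    then have "i (?g (rb I y)) = i (rb I (?g y))" by (simp add: i_rb[symmetric] G(3))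
    then show "?g (rb I y) = rb I (?g y)" using m i_eq_iff[of "?g (rb I y)" "rb I (?g y)"] by simp
  qed simp
  have gb: "bij_betw ?g (carrier I) (carrier I)"
    unfolding bij_betw_def
  proof
    show "inj_on ?g (carrier I)"
    proof (rule inj_onI)
      fix y z assume m: "y \<in> carrier I" "z \<in> carrier I" and "?g y = ?g z"
      then have "\<gamma> (i y) = \<gamma> (i z)" using rho_incl(2) by metis
      then show "y = z" using m by (simp add: G)
    qed
    show "?g ` carrier I = carrier I"
    proof safe
      fix y assume y: "y \<in> carrier I"
      then have "i y \<in> \<gamma> ` i ` carrier I" using \<gamma> by (simp add: Aut_I_iff)
      then obtain z where z: "z \<in> carrier I" "i y = i (?g z)" by auto
      then have "y = ?g z" using y i_eq_iff[of y "?g z"] by simp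
      then show "y \<in> ?g ` carrier I" using z by blast
    qed simp
  qed
  have g: "?g \<in> carrier (rb_Aut I)"
    using gh gb by (simp add: carrier_rb_Aut rho_def)
  have "?g (\<mu> h y) = \<mu> (?f h) (?g y)" if m: "h \<in> carrier H" "y \<in> carrier I" for h y
  proof -
    \<comment> \<open>Compatibility results from applying \<gamma> to the sliding rule at s h and
      comparing with the sliding rule at \<gamma>(s h).\<close>
    have "\<gamma> (s h) \<otimes>\<^bsub>M\<^esub> i (?g (\<mu> h y)) = \<gamma> (s h \<otimes>\<^bsub>M\<^esub> i (\<mu> h y))" using m by (simp add: G(2))
    also have "\<dots> = i (?g y) \<otimes>\<^bsub>M\<^esub> \<gamma> (s h)" using m slide[of "s h" y] by (simp add: G(2)[symmetric])
    also have "\<dots> = \<gamma> (s h) \<otimes>\<^bsub>M\<^esub> i (\<mu> (?f h) (?g y))"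
      using m slide[of "\<gamma> (s h)" "?g y"] by (simp add: fs)
    finally have "i (?g (\<mu> h y)) = i (\<mu> (?f h) (?g y))"
      using m by (simp add: fs del: rho_incl(2))
    then show ?thesis
      using m i_eq_iff[of "?g (\<mu> h y)" "\<mu> (?f h) (?g y)"] by (simp add: fs)
  qed
  then show ?thesis using f g C_mu_iff[of ?f ?g] by simp
qed

text \<open>The two squares with the projection and the inclusion characterise the induced pair, so
  \<open>rho\<close> can be computed without its section.\<close>

lemma rho_eqI:
  assumes c: "c \<in> carrier (C_mu H I \<mu>)"
    and f: "\<And>x. x \<in> carrier M \<Longrightarrow> fst c (p x) = p (\<gamma> x)"
    and g: "\<And>y. y \<in> carrier I \<Longrightarrow> i (snd c y) = \<gamma> (i y)"
  shows "rho H I \<E> s \<gamma> = c"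
proof (rule prod_eqI)
  note R = C_muD(1,2)[OF rho_C_mu] and C = C_muD(1,2)[OF c]
  show "fst (rho H I \<E> s \<gamma>) = fst c"
  proof (rule extensionalityI[OF rb_AutD(11)[OF R(1)] rb_AutD(11)[OF C(1)]])
    fix h assume "h \<in> carrier H"
    then show "fst (rho H I \<E> s \<gamma>) h = fst c h"
      using f[of "s h"] rho_prj[of "s h"] sectionD[OF s] by simp
  qed
  show "snd (rho H I \<E> s \<gamma>) = snd c"
  proof (rule extensionalityI[OF rb_AutD(11)[OF R(2)] rb_AutD(11)[OF C(2)]])
    fix y assume y: "y \<in> carrier I"
    then have "i (snd (rho H I \<E> s \<gamma>) y) = i (snd c y)" using g rho_incl by simp
    then show "snd (rho H I \<E> s \<gamma>) y = snd c y"
      using y rho_incl(1) rb_AutD(1)[OF C(2)] by simp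
  qed
qed

text \<open>The automorphism \<gamma> itself is the equivalence: \<gamma> after i is i after \<psi>,
  and \<phi>^-1 after p after \<gamma> is p.\<close>

lemma rho_equiv: "rb_ext_equiv I (ext_twist H \<E> (rho H I \<E> s \<gamma>)) \<E>"
proof (rule rb_ext_equiv_sym[OF ext])
  note P = rb_AutD[OF C_muD(1)[OF rho_C_mu]]
  show "rb_ext_equiv I \<E> (ext_twist H \<E> (rho H I \<E> s \<gamma>))"
    by (rule rb_ext_equivI[of \<gamma>])
      (use rb_AutD[OF gamma_Aut] P in \<open>auto simp: ext_twist_def rho_incl rho_prj[symmetric]\<close>)
qed

end

lemma rho_hom: "rho H I \<E> s \<in> hom (Aut_I I \<E>) (C_mu H I \<mu>)"
proof (rule homI)
  fix \<beta> \<gamma> assume b: "\<beta> \<in> carrier (Aut_I I \<E>)" and g: "\<gamma> \<in> carrier (Aut_I I \<E>)"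
  interpret A: group "Aut_I I \<E>" by (rule group_Aut_I)
  interpret C: group "C_mu H I \<mu>" by (rule group_C_mu)
  note [simp] = rb_AutD(1)[OF gamma_Aut[OF g]]
  have m: "\<beta> \<otimes>\<^bsub>Aut_I I \<E>\<^esub> \<gamma> = compose (carrier M) \<beta> \<gamma>" by (rule Aut_I_mult[OF b g])
  show "rho H I \<E> s (\<beta> \<otimes>\<^bsub>Aut_I I \<E>\<^esub> \<gamma>) = rho H I \<E> s \<beta> \<otimes>\<^bsub>C_mu H I \<mu>\<^esub> rho H I \<E> s \<gamma>"
    by (rule rho_eqI[OF A.m_closed[OF b g] C.m_closed[OF rho_C_mu[OF b] rho_C_mu[OF g]]])
      (simp_all add: m C_mu_mult[OF rho_C_mu[OF b] rho_C_mu[OF g]] compose_eq rho_prj[OF b] rho_prj[OF g]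
        rho_incl[OF b] rho_incl[OF g])
qed (rule rho_C_mu)

lemma rho_one_iff:
  assumes \<gamma>: "\<gamma> \<in> carrier (Aut_I I \<E>)"
  shows "rho H I \<E> s \<gamma> = \<one>\<^bsub>C_mu H I \<mu>\<^esub> \<longleftrightarrow>
    (\<forall>x\<in>carrier M. p (\<gamma> x) = p x) \<and> (\<forall>y\<in>carrier I. \<gamma> (i y) = i y)"
proof
  assume e: "rho H I \<E> s \<gamma> = \<one>\<^bsub>C_mu H I \<mu>\<^esub>"
  show "(\<forall>x\<in>carrier M. p (\<gamma> x) = p x) \<and> (\<forall>y\<in>carrier I. \<gamma> (i y) = i y)"
    using rho_prj[OF \<gamma>] rho_incl(2)[OF \<gamma>] unfolding e by (simp add: C_mu_one)
next
  assume a: "(\<forall>x\<in>carrier M. p (\<gamma> x) = p x) \<and> (\<forall>y\<in>carrier I. \<gamma> (i y) = i y)"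
  interpret C: group "C_mu H I \<mu>" by (rule group_C_mu)
  show "rho H I \<E> s \<gamma> = \<one>\<^bsub>C_mu H I \<mu>\<^esub>"
    using a by (intro rho_eqI[OF \<gamma> C.one_closed]) (simp_all add: C_mu_one)
qed

lemma exact_at_Aut_I:
  "shear \<E> s ` carrier (Z1_RBE H I \<mu>) = kernel (Aut_I I \<E>) (C_mu H I \<mu>) (rho H I \<E> s)"
proof (intro equalityI subsetI)
  fix \<gamma> assume "\<gamma> \<in> shear \<E> s ` carrier (Z1_RBE H I \<mu>)"
  then obtain l where l: "l \<in> carrier (Z1_RBE H I \<mu>)" "\<gamma> = shear \<E> s l" by blast
  then have c: "l \<in> carrier (C1 H I)" by (simp add: Z1_iff)
  then have "rho H I \<E> s \<gamma> = \<one>\<^bsub>C_mu H I \<mu>\<^esub>"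
    using l shear_Aut_I by (subst rho_one_iff) (auto simp: shear_eq C1D)
  then show "\<gamma> \<in> kernel (Aut_I I \<E>) (C_mu H I \<mu>) (rho H I \<E> s)"
    using l shear_Aut_I by (simp add: kernel_def)
next
  fix \<gamma> assume "\<gamma> \<in> kernel (Aut_I I \<E>) (C_mu H I \<mu>) (rho H I \<E> s)"
  then have \<gamma>: "\<gamma> \<in> carrier (Aut_I I \<E>)" and "rho H I \<E> s \<gamma> = \<one>\<^bsub>C_mu H I \<mu>\<^esub>"
    by (auto simp: kernel_def)
  then have gp: "\<And>x. x \<in> carrier M \<Longrightarrow> p (\<gamma> x) = p x" and gi: "\<And>y. y \<in> carrier I \<Longrightarrow> \<gamma> (i y) = i y"
    using rho_one_iff by auto
  note G = rb_AutD[OF gamma_Aut[OF \<gamma>]]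
  note [simp] = sectionD[OF s] G(1) gp gi
  have "\<exists>y\<in>carrier I. \<gamma> (s h) = s h \<otimes>\<^bsub>M\<^esub> i y" if "h \<in> carrier H" for h
    using same_fibre[of "s h" "\<gamma> (s h)"] that by auto
  then obtain f where f: "\<And>h. h \<in> carrier H \<Longrightarrow> f h \<in> carrier I \<and> \<gamma> (s h) = s h \<otimes>\<^bsub>M\<^esub> i (f h)"
    by metis
  \<comment> \<open>The restriction makes the chosen function extensional, as \<open>C1\<close>
    requires.\<close>
  define l where "l = restrict f (carrier H)"
  have lI [simp]: "l h \<in> carrier I" if "h \<in> carrier H" for h using f that by (simp add: l_def)
  have gx: "\<gamma> x = x \<otimes>\<^bsub>M\<^esub> i (l (p x))" if x: "x \<in> carrier M" for x
  proof -
    obtain y where y: "y \<in> carrier I" "x = s (p x) \<otimes>\<^bsub>M\<^esub> i y"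
      using same_fibre[of "s (p x)" x] x by auto
    have "\<gamma> (s (p x) \<otimes>\<^bsub>M\<^esub> i y) = s (p x) \<otimes>\<^bsub>M\<^esub> i (l (p x) \<otimes> y)"
      using x y(1) f[of "p x"] by (simp add: G(2) l_def i_mult M.m_assoc)
    also have "\<dots> = s (p x) \<otimes>\<^bsub>M\<^esub> i y \<otimes>\<^bsub>M\<^esub> i (l (p x))"
      using x y(1) by (simp add: I.m_comm[of "l (p x)"] i_mult M.m_assoc)
    finally show ?thesis using y(2) by simp
  qed
  have unique: "y = z" if "x \<in> carrier M" "y \<in> carrier I" "z \<in> carrier I" "x \<otimes>\<^bsub>M\<^esub> i y = x \<otimes>\<^bsub>M\<^esub> i z" for x y z
    using that by simp
  have "l \<in> carrier (Z1_RBE H I \<mu>)"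
    unfolding Z1_iff
  proof (intro conjI ballI)
    have "l \<one>\<^bsub>H\<^esub> = \<one>"
      using gi[of \<one>] gx[of "\<one>\<^bsub>M\<^esub>"] by (intro unique[of "\<one>\<^bsub>M\<^esub>"]) simp_all
    then show "l \<in> carrier (C1 H I)" using f unfolding l_def by (intro C1I) (auto simp: l_def)
  next
    fix h k assume m: "h \<in> carrier H" "k \<in> carrier H"
    \<comment> \<open>Both sides are \<gamma>(s h s k): \<open>gx\<close> is applied once to the
      product and once to each factor. The operator equation is found in the same way from
      \<gamma>(R(s h)).\<close>
    have "s h \<otimes>\<^bsub>M\<^esub> s k \<otimes>\<^bsub>M\<^esub> i (l (h \<otimes>\<^bsub>H\<^esub> k)) = s h \<otimes>\<^bsub>M\<^esub> s k \<otimes>\<^bsub>M\<^esub> i (\<mu> k (l h) \<otimes> l k)"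
      using m gx[of "s h \<otimes>\<^bsub>M\<^esub> s k"] gx[of "s h"] gx[of "s k"] mult_i[of "s h" "s k" "l h" "l k"] by (simp add: G(2))
    then show "l (h \<otimes>\<^bsub>H\<^esub> k) = l k \<otimes> \<mu> k (l h)"
      using m unique[of "s h \<otimes>\<^bsub>M\<^esub> s k"] by (simp add: I.m_comm)
  next
    fix h assume m: "h \<in> carrier H"
    have "rb M (s h) \<otimes>\<^bsub>M\<^esub> i (l (rb H h)) = rb M (s h) \<otimes>\<^bsub>M\<^esub> i (rb I (\<mu> (rb H h) (l h)))"
      using m gx[of "rb M (s h)"] gx[of "s h"] rb_i[of "s h" "l h"] by (simp add: G(3))
    then show "l (rb H h) = rb I (\<mu> (rb H h) (l h))"
      using m by (intro unique[of "rb M (s h)"]) simp_all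
  qed
  moreover from this have "\<gamma> = shear \<E> s l"
    using gx G(11) by (intro extensionalityI[of _ "carrier M"]) (auto simp: shear_eq Z1_iff, simp add: shear_def)
  ultimately show "\<gamma> \<in> shear \<E> s ` carrier (Z1_RBE H I \<mu>)" by blast
qed

lemma rho_image:
  "rho H I \<E> s ` carrier (Aut_I I \<E>) = {c \<in> carrier (C_mu H I \<mu>). rb_ext_equiv I (ext_twist H \<E> c) \<E>}"
proof (intro equalityI subsetI)
  fix c assume "c \<in> {c \<in> carrier (C_mu H I \<mu>). rb_ext_equiv I (ext_twist H \<E> c) \<E>}"
  then have c: "c \<in> carrier (C_mu H I \<mu>)" and e: "rb_ext_equiv I (ext_twist H \<E> c) \<E>" by auto
  note P = rb_AutD[OF C_muD(1)[OF c]] and Q = rb_AutD[OF C_muD(2)[OF c]]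
  interpret T: rb_extension H I \<mu> "ext_twist H \<E> c" by (rule twist_extension[OF c])
  have m: "mid (ext_twist H \<E> c) = M" by (simp add: ext_twist_def)
  obtain \<gamma> where a: "\<gamma> \<in> rb_hom M M" "bij_betw \<gamma> (carrier M) (carrier M)"
    and b: "\<And>y. y \<in> carrier I \<Longrightarrow> \<gamma> (i y) = i (snd c y)"
    and d: "\<And>x. x \<in> carrier M \<Longrightarrow> inv_into (carrier H) (fst c) (p (\<gamma> x)) = p x"
    using rb_ext_equivE[OF rb_ext_equiv_sym[OF T.ext e]] unfolding m by (auto simp: ext_twist_def)
  have gc: "\<gamma> x \<in> carrier M" if "x \<in> carrier M" for x using rb_homD(1)[OF a(1)] that .
  \<comment> \<open>An equivalence is arbitrary outside the carrier, whereas members of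
    \<open>rb_Aut\<close> are extensional.\<close>
  let ?g = "restrict \<gamma> (carrier M)"
  have "?g \<in> rb_hom M M" using rb_homD[OF a(1)] by (intro rb_homI) simp_all
  moreover have "bij_betw ?g (carrier M) (carrier M)" using a(2) by simp
  moreover have "?g ` i ` carrier I = i ` snd c ` carrier I"
    unfolding image_comp by (intro image_cong) (simp_all add: b)
  ultimately have g: "?g \<in> carrier (Aut_I I \<E>)" by (simp add: Aut_I_iff carrier_rb_Aut Q(8))
  have "fst c (p x) = p (\<gamma> x)" if "x \<in> carrier M" for x
    using P(6)[of "p (\<gamma> x)"] d[OF that] gc[OF that] by simp
  then have "rho H I \<E> s ?g = c" by (intro rho_eqI[OF g c]) (simp_all add: b)
  then show "c \<in> rho H I \<E> s ` carrier (Aut_I I \<E>)" using g by blast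
qed (auto intro: rho_C_mu rho_equiv)

end

end

theorem theorem7p7:
  fixes H :: "'h rb_monoid" and I :: "'i rb_monoid"
    and \<mu> :: "'h \<Rightarrow> 'i \<Rightarrow> 'i" and \<E> :: "('i, 'e, 'h) rb_ext"
  assumes "rota_baxter_group H"
    and "rota_baxter_group I" and "comm_group I"
    and "rb_module H I \<mu>"
    and "is_rb_extension H I \<E>" and "has_action H I \<mu> \<E>"
  shows "group (Z1_RBE H I \<mu>) \<and> group (Aut_I I \<E>) \<and> group (C_mu H I \<mu>) \<and>
      comm_group (H2_RBE H I \<mu>) \<and> ext_class H I \<mu> \<E> \<in> Ext H I \<mu> \<and>
      (\<exists>s. st_section H \<E> s) \<and>
      (\<forall>s. st_section H \<E> s \<longrightarrow>
         shear \<E> s \<in> hom (Z1_RBE H I \<mu>) (Aut_I I \<E>) \<and>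
         inj_on (shear \<E> s) (carrier (Z1_RBE H I \<mu>)) \<and>
         rho H I \<E> s \<in> hom (Aut_I I \<E>) (C_mu H I \<mu>) \<and>
         shear \<E> s ` carrier (Z1_RBE H I \<mu>) = kernel (Aut_I I \<E>) (C_mu H I \<mu>) (rho H I \<E> s) \<and>
         rho H I \<E> s ` carrier (Aut_I I \<E>) =
           {c \<in> carrier (C_mu H I \<mu>).
              ext_act H I \<mu> (ext_class H I \<mu> \<E>) c = ext_class H I \<mu> \<E>} \<and>
         rho H I \<E> s ` carrier (Aut_I I \<E>) = kernel (C_mu H I \<mu>) (H2_RBE H I \<mu>) (omega H I \<mu> \<E>)) \<and>
      (\<forall>c \<in> carrier (C_mu H I \<mu>). \<exists>!k. k \<in> carrier (H2_RBE H I \<mu>) \<and>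
         ext_act H I \<mu> (ext_class H I \<mu> \<E>) c = ext_translate H I \<mu> (ext_class H I \<mu> \<E>) k) \<and>
      omega H I \<mu> \<E> \<in> carrier (C_mu H I \<mu>) \<rightarrow> carrier (H2_RBE H I \<mu>) \<and>
      (\<forall>c1 \<in> carrier (C_mu H I \<mu>). \<forall>c2 \<in> carrier (C_mu H I \<mu>).
         omega H I \<mu> \<E> (c1 \<otimes>\<^bsub>C_mu H I \<mu>\<^esub> c2) =
           H2_act H I \<mu> (omega H I \<mu> \<E> c1) c2 \<otimes>\<^bsub>H2_RBE H I \<mu>\<^esub> omega H I \<mu> \<E> c2)"
proof -
  interpret rb_extension H I \<mu> \<E>
    using assms by (intro rb_extension.intro rb_mod.intro rb_mod_axioms.intro rb_extension_axioms.intro)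
  \<comment> \<open>The image of \<open>rho\<close> is known as the set of pairs whose twist is
    equivalent to the extension; \<open>stab\<close> and \<open>ker\<close> rewrite this set as the
    stabiliser of the class and as the kernel of \<open>omega\<close>.\<close>
  have stab: "{c \<in> carrier (C_mu H I \<mu>). rb_ext_equiv I (ext_twist H \<E> c) \<E>} =
      {c \<in> carrier (C_mu H I \<mu>). ext_act H I \<mu> (ext_class H I \<mu> \<E>) c = ext_class H I \<mu> \<E>}"
    using omega_one_iff by blast
  have ker: "{c \<in> carrier (C_mu H I \<mu>). rb_ext_equiv I (ext_twist H \<E> c) \<E>} =
      kernel (C_mu H I \<mu>) (H2_RBE H I \<mu>) (omega H I \<mu> \<E>)"
    using omega_one_iff(2) by (auto simp: kernel_def)
  show ?thesis
    using group_Z1 group_Aut_I group_C_mu H2_comm_group ext_class_in_Ext section_exists omega_closed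
      shear_hom shear_inj rho_hom exact_at_Aut_I rho_image[unfolded stab] rho_image[unfolded ker]
      omega_unique omega_derivation
    by (intro conjI allI impI ballI) simp_all
qed

end
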